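(* Suppose that $\Psi:\mathbb M^*\rightarrow\mathbb M^*$ is a homeomorphism and let $\{[a_m,b_m]:m\in\mathbb N\}$ be a standard sequence in $\mathbb M$. Then, for any selector sequence $\{x_m:m\in\mathbb N\}$ for $\{[a_m,b_m]:m\in\mathbb N\}$, there are a standard sequence $\{[c_j,d_j]:j\in\mathbb N\}$ and a homeomorphism $h:\mathbb N^*\rightarrow\mathbb N^*$ such that for each $u\in\mathbb N^*$: (1) $\Psi(x_u)\in[c_j,d_j]_{h(u)}$; (2) $[c_j,d_j]_{h(u)}$ is a subinterval of $\Psi([a_m,b_m]_u)$; (3) the mapping sending $\Psi(x_u)$ to $h(u)$ (for $u\in\mathbb N^*$) is a homeomorphism from $\Psi(\{x_m:m\in\mathbb N\}^* )=\{\Psi(x_u):u\in\mathbb N^*\}$ onto $\mathbb N^*$.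
   Context: $\mathbb N$ is the set of positive integers with the discrete topology, $I=[0,1]$, $\mathbb M=\mathbb N\times I$, and $\mathbb M^*=\beta\mathbb M\setminus\mathbb M$, $\mathbb N^*=\beta\mathbb N\setminus\mathbb N$ are the Stone-Čech remainders; points of $\mathbb N^*$ are identified with free ultrafilters on $\mathbb N$. For a closed subset $A$ of $\mathbb M$, $A^*=\mathrm{cl}_{\beta\mathbb M}(A)\setminus\mathbb M$. A standard sequence is a locally finite sequence $\{[a_m,b_m]:m\in\mathbb N\}$ of pairwise disjoint non-trivial closed intervals of $\mathbb M$, each contained in a single $\{n\}\times I$ (with its usual order). A selector sequence for it is a sequence $\{x_m:m\in\mathbb N\}$ of points of $\mathbb M$ with $a_m<x_m<b_m$ for all $m$. For a sequence $\{A_n:n\in\mathbb N\}$ of subsets of $\mathbb M$ and $u\in\mathbb N^*$, $u\text{-}\lim\{A_n\}_n=\bigcap\{\mathrm{cl}_{\beta\mathbb M}(\bigcup_{n\in a}A_n):a\in u\}$. Write $[a_m,b_m]_u=u\text{-}\lim\{[a_m,b_m]\}_m$ and let $x_u$ denote the point $u\text{-}\lim\{x_m:m\in\mathbb N\}$. The standard cut-points of $[a_m,b_m]_u$ are the points $x_u$ arising from sequences with $a_m<x_m<b_m$ for all $m$; they are linearly ordered as in the ultraproduct modulo $u$. The closure of any (order-convex) subinterval of the set of standard cut-points is called a subinterval of $[a_m,b_m]_u$. A subinterval of $\Psi([a_m,b_m]_u)$ is the image under $\Psi$ of a subinterval of $[a_m,b_m]_u$. *)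

theory Defs
  imports "HOL-Analysis.Analysis"
begin

text \<open>
  The Stone-Cech compactification of a Tychonoff space X in the form given by Gillman and Jerison:
  its points are the z-ultrafilters of X, the sets {p. Z \<in> p} for the zero-sets Z of X form a base
  for the closed sets, and a point x of X is identified with the fixed z-ultrafilter of all
  zero-sets that contain x.  For metrizable X the zero-sets are the closed sets; for discrete X they
  are all subsets, so that then the points are the ultrafilters on X, literally.
\<close>

definition zero_sets :: "'a topology \<Rightarrow> 'a set set" where
  "zero_sets X = {{x \<in> topspace X. f x = 0} | f. continuous_map X euclideanreal f}"

definition z_filter :: "'a topology \<Rightarrow> 'a set set \<Rightarrow> bool" where
  "z_filter X p \<longleftrightarrow> p \<subseteq> zero_sets X \<and> topspace X \<in> p \<and> {} \<notin> p \<and>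
     (\<forall>A \<in> p. \<forall>B \<in> p. A \<inter> B \<in> p) \<and>
     (\<forall>A \<in> p. \<forall>B \<in> zero_sets X. A \<subseteq> B \<longrightarrow> B \<in> p)"

definition z_ultrafilter :: "'a topology \<Rightarrow> 'a set set \<Rightarrow> bool" where
  "z_ultrafilter X p \<longleftrightarrow> z_filter X p \<and> (\<forall>q. z_filter X q \<and> p \<subseteq> q \<longrightarrow> q = p)"

definition stone_cech :: "'a topology \<Rightarrow> 'a set set topology" where
  "stone_cech X = topology_generated_by {{p. z_ultrafilter X p \<and> Z \<notin> p} | Z. Z \<in> zero_sets X}"

definition sc_embed :: "'a topology \<Rightarrow> 'a \<Rightarrow> 'a set set" where
  "sc_embed X x = {Z \<in> zero_sets X. x \<in> Z}"


text \<open>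
  The next facts confirm that this is the Stone-Cech compactification: a compact Hausdorff space in
  which X is densely embedded, to which all continuous functions from X to the unit interval extend.
\<close>

lemma zero_setsI:
  assumes "continuous_map X euclideanreal f" "\<And>x. x \<in> topspace X \<Longrightarrow> x \<in> Z \<longleftrightarrow> f x = 0" "Z \<subseteq> topspace X"
  shows "Z \<in> zero_sets X"
proof -
  have "Z = {x \<in> topspace X. f x = 0}" using assms(2,3) by blast
  then show ?thesis using assms(1) unfolding zero_sets_def by blast
qed

lemma zero_sets_subset: "Z \<in> zero_sets X \<Longrightarrow> Z \<subseteq> topspace X"
  unfolding zero_sets_def by blast

lemma zero_setsE:
  assumes "Z \<in> zero_sets X"
  obtains f where "continuous_map X euclideanreal f" "Z = {x \<in> topspace X. f x = 0}"
  using assms unfolding zero_sets_def by blast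

lemma empty_in_zero_sets: "{} \<in> zero_sets X"
  by (rule zero_setsI[where f="\<lambda>_. 1"]) auto

lemma topspace_in_zero_sets: "topspace X \<in> zero_sets X"
  by (rule zero_setsI[where f="\<lambda>_. 0"]) auto

lemma zero_sets_Int:
  assumes "A \<in> zero_sets X" "B \<in> zero_sets X"
  shows "A \<inter> B \<in> zero_sets X"
proof -
  obtain f where f: "continuous_map X euclideanreal f" "A = {x \<in> topspace X. f x = 0}"
    using assms(1) by (rule zero_setsE)
  obtain g where g: "continuous_map X euclideanreal g" "B = {x \<in> topspace X. g x = 0}"
    using assms(2) by (rule zero_setsE)
  show ?thesis
    by (rule zero_setsI[where f="\<lambda>x. \<bar>f x\<bar> + \<bar>g x\<bar>"])
       (use f g in \<open>auto intro!: continuous_intros\<close>)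
qed

lemma zero_sets_le:
  assumes "continuous_map X euclideanreal f" "continuous_map X euclideanreal g"
  shows "{x \<in> topspace X. f x \<le> g x} \<in> zero_sets X"
proof (rule zero_setsI[where f="\<lambda>x. max (f x - g x) 0"])
  show "continuous_map X euclideanreal (\<lambda>x. max (f x - g x) 0)"
    using assms by (intro continuous_intros) auto
qed (auto simp: max_def)

lemma z_filterI:
  assumes "p \<subseteq> zero_sets X" "topspace X \<in> p" "{} \<notin> p"
    "\<And>A B. A \<in> p \<Longrightarrow> B \<in> p \<Longrightarrow> A \<inter> B \<in> p"
    "\<And>A B. A \<in> p \<Longrightarrow> B \<in> zero_sets X \<Longrightarrow> A \<subseteq> B \<Longrightarrow> B \<in> p"
  shows "z_filter X p"
  using assms unfolding z_filter_def by auto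

lemma z_filterD:
  assumes "z_filter X p"
  shows "p \<subseteq> zero_sets X" "topspace X \<in> p" "{} \<notin> p"
    "\<And>A B. A \<in> p \<Longrightarrow> B \<in> p \<Longrightarrow> A \<inter> B \<in> p"
    "\<And>A B. A \<in> p \<Longrightarrow> B \<in> zero_sets X \<Longrightarrow> A \<subseteq> B \<Longrightarrow> B \<in> p"
  using assms unfolding z_filter_def by auto

lemma z_ultrafilterD:
  assumes "z_ultrafilter X p"
  shows "p \<subseteq> zero_sets X" "topspace X \<in> p" "{} \<notin> p"
    "\<And>A B. A \<in> p \<Longrightarrow> B \<in> p \<Longrightarrow> A \<inter> B \<in> p"
    "\<And>A B. A \<in> p \<Longrightarrow> B \<in> zero_sets X \<Longrightarrow> A \<subseteq> B \<Longrightarrow> B \<in> p"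
  using assms unfolding z_ultrafilter_def z_filter_def by auto

lemma z_filter_generated:
  assumes S: "S \<subseteq> zero_sets X"
    and fip: "\<And>F. finite F \<Longrightarrow> F \<subseteq> S \<Longrightarrow> topspace X \<inter> \<Inter>F \<noteq> {}"
  obtains q where "z_filter X q" "S \<subseteq> q"
proof -
  define q where "q = {B \<in> zero_sets X. \<exists>F. finite F \<and> F \<subseteq> S \<and> topspace X \<inter> \<Inter>F \<subseteq> B}"
  have "z_filter X q"
    unfolding z_filter_def
  proof (intro conjI ballI impI)
    show "q \<subseteq> zero_sets X" unfolding q_def by blast
    show "topspace X \<in> q"
      unfolding q_def by (auto simp: topspace_in_zero_sets intro!: exI[of _ "{}"])
    show "{} \<notin> q" unfolding q_def using fip by blast
    fix A B assume A: "A \<in> q"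
    show "A \<inter> B \<in> q" if B: "B \<in> q"
    proof -
      obtain F G where "finite F" "F \<subseteq> S" "topspace X \<inter> \<Inter>F \<subseteq> A" "finite G" "G \<subseteq> S"
        "topspace X \<inter> \<Inter>G \<subseteq> B"
        using A B unfolding q_def by blast
      then have "finite (F \<union> G) \<and> F \<union> G \<subseteq> S \<and> topspace X \<inter> \<Inter>(F \<union> G) \<subseteq> A \<inter> B" by blast
      moreover have "A \<inter> B \<in> zero_sets X" using A B zero_sets_Int unfolding q_def by blast
      ultimately show ?thesis unfolding q_def by blast
    qed
    show "B \<in> q" if "B \<in> zero_sets X" "A \<subseteq> B"
      using A that unfolding q_def by blast
  qed
  moreover have "S \<subseteq> q"
  proof
    fix Z assume "Z \<in> S"
    then have "finite {Z} \<and> {Z} \<subseteq> S \<and> topspace X \<inter> \<Inter>{Z} \<subseteq> Z" by blast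
    then show "Z \<in> q" unfolding q_def using \<open>Z \<in> S\<close> S by blast
  qed
  ultimately show thesis by (rule that)
qed

lemma z_ultrafilter_extends:
  assumes "z_filter X q"
  obtains p where "z_ultrafilter X p" "q \<subseteq> p"
proof -
  let ?A = "{p. z_filter X p \<and> q \<subseteq> p}"
  have "\<exists>M\<in>?A. \<forall>p\<in>?A. M \<subseteq> p \<longrightarrow> p = M"
  proof (rule subset_Zorn_nonempty)
    show "?A \<noteq> {}" using assms by blast
    fix C assume C: "C \<noteq> {}" "subset.chain ?A C"
    have f: "z_filter X p \<and> q \<subseteq> p" if "p \<in> C" for p
      using C(2) that unfolding subset_chain_def by blast
    have ch: "p \<subseteq> r \<or> r \<subseteq> p" if "p \<in> C" "r \<in> C" for p r
      using C(2) that unfolding subset_chain_def by blast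
    have 1: "\<Union>C \<subseteq> zero_sets X" using z_filterD(1)[of X] f by (meson Union_least)
    obtain p where "p \<in> C" using C(1) by blast
    then have 2: "topspace X \<in> \<Union>C" using z_filterD(2)[of X p] f by (meson UnionI)
    have 3: "{} \<notin> \<Union>C" using z_filterD(3)[of X] f by (meson UnionE)
    have 4: "A \<inter> B \<in> \<Union>C" if A: "A \<in> \<Union>C" and B: "B \<in> \<Union>C" for A B
    proof -
      obtain p where p: "A \<in> p" "p \<in> C" using A by blast
      obtain r where r: "B \<in> r" "r \<in> C" using B by blast
      from ch[OF p(2) r(2)] show ?thesis
      proof
        assume "p \<subseteq> r"
        then have "A \<inter> B \<in> r" using z_filterD(4)[of X r A B] f[OF r(2)] p r by blast
        then show ?thesis using r by blast
      next
        assume "r \<subseteq> p"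
        then have "A \<inter> B \<in> p" using z_filterD(4)[of X p A B] f[OF p(2)] p r by blast
        then show ?thesis using p by blast
      qed
    qed
    have 5: "B \<in> \<Union>C" if A: "A \<in> \<Union>C" and B: "B \<in> zero_sets X" "A \<subseteq> B" for A B
    proof -
      obtain p where p: "A \<in> p" "p \<in> C" using A by blast
      then have "B \<in> p" using z_filterD(5)[of X p A B] f[OF p(2)] B by blast
      then show ?thesis using p by blast
    qed
    have "z_filter X (\<Union>C)" using 1 2 3 4 5 by (rule z_filterI)
    moreover have "q \<subseteq> \<Union>C" using f C(1) by (meson Union_upper ex_in_conv order_trans)
    ultimately show "\<Union>C \<in> ?A" by simp
  qed
  then obtain M where M: "M \<in> ?A" "\<forall>p\<in>?A. M \<subseteq> p \<longrightarrow> p = M" by (rule bexE)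
  have "p = M" if "z_filter X p \<and> M \<subseteq> p" for p
    using M that by (metis (mono_tags, lifting) mem_Collect_eq order_trans)
  then have "z_ultrafilter X M" using M(1) unfolding z_ultrafilter_def by simp
  moreover have "q \<subseteq> M" using M(1) by simp
  ultimately show thesis by (rule that)
qed

lemma z_ultrafilter_disjoint:
  assumes p: "z_ultrafilter X p" and Z: "Z \<in> zero_sets X" "Z \<notin> p"
  obtains A where "A \<in> p" "A \<inter> Z = {}"
proof -
  note D = z_ultrafilterD[OF p]
  have "\<exists>A\<in>p. A \<inter> Z = {}"
  proof (rule ccontr)
    assume neg: "\<not> (\<exists>A\<in>p. A \<inter> Z = {})"
    have fip: "topspace X \<inter> \<Inter>F \<noteq> {}" if "finite F" "F \<subseteq> insert Z p" for F
    proof -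
      have "\<exists>A\<in>p. A \<inter> Z \<subseteq> \<Inter>F" using that
      proof (induction F rule: finite_induct)
        case empty
        then show ?case using D(2) by blast
      next
        case (insert W F)
        then obtain A where A: "A \<in> p" "A \<inter> Z \<subseteq> \<Inter>F" by blast
        show ?case
        proof (cases "W = Z")
          case True
          then show ?thesis using A by blast
        next
          case False
          then have "A \<inter> W \<in> p" using A D(4) insert.prems by blast
          then show ?thesis using A by blast
        qed
      qed
      then obtain A where A: "A \<in> p" "A \<inter> Z \<subseteq> \<Inter>F" by blast
      have "A \<inter> Z \<noteq> {}" using A neg by blast
      then show ?thesis using A zero_sets_subset[OF Z(1)] by blast
    qed
    obtain q where q: "z_filter X q" "insert Z p \<subseteq> q"
      using z_filter_generated[of "insert Z p" X] fip D(1) Z(1) by (metis insert_subset)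
    then have "q = p" using p unfolding z_ultrafilter_def by blast
    then show False using q Z(2) by blast
  qed
  then show thesis using that by blast
qed

lemma z_ultrafilter_prime:
  assumes p: "z_ultrafilter X p" and "A \<in> zero_sets X" "B \<in> zero_sets X" "topspace X \<subseteq> A \<union> B"
  shows "A \<in> p \<or> B \<in> p"
proof (rule ccontr)
  note D = z_ultrafilterD[OF p]
  assume neg: "\<not> (A \<in> p \<or> B \<in> p)"
  obtain C where C: "C \<in> p" "C \<inter> A = {}" using z_ultrafilter_disjoint[OF p assms(2)] neg by blast
  obtain E where E: "E \<in> p" "E \<inter> B = {}" using z_ultrafilter_disjoint[OF p assms(3)] neg by blast
  have "C \<inter> E \<in> p" using C E D(4) by blast
  moreover have "C \<subseteq> topspace X" using C D(1) zero_sets_subset by blast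
  then have "C \<inter> E = {}" using C E assms(4) by blast
  ultimately show False using D(3) by simp
qed

lemma topspace_stone_cech: "topspace (stone_cech X) = {p. z_ultrafilter X p}"
proof -
  have "{p. z_ultrafilter X p} = \<Union>{{p. z_ultrafilter X p \<and> Z \<notin> p} | Z. Z \<in> zero_sets X}"
    using empty_in_zero_sets z_ultrafilterD(3) by blast
  then show ?thesis unfolding stone_cech_def by simp
qed

lemma openin_stone_cech_basic:
  "Z \<in> zero_sets X \<Longrightarrow> openin (stone_cech X) {p. z_ultrafilter X p \<and> Z \<notin> p}"
  unfolding stone_cech_def by (rule topology_generated_by_Basis) blast

lemma compact_space_stone_cech: "compact_space (stone_cech X)"
proof (rule Alexander_subbase[where \<B> = "{{p. z_ultrafilter X p \<and> Z \<notin> p} | Z. Z \<in> zero_sets X}"])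
  let ?B = "{{p. z_ultrafilter X p \<and> Z \<notin> p} | Z. Z \<in> zero_sets X}"
  show "topology (arbitrary union_of (finite intersection_of (\<lambda>x. x \<in> ?B) relative_to \<Union>?B))
      = stone_cech X" (is "?T = _")
    unfolding topology_eq
  proof (intro allI iffI)
    fix S
    have U: "openin (stone_cech X) (\<Union>?B)"
      using openin_stone_cech_basic by (intro openin_Union) blast
    show "openin (stone_cech X) S" if "openin ?T S"
    proof (rule minimal_topology_subbase[OF _ U that])
      fix W assume "W \<in> ?B"
      then show "openin (stone_cech X) W" using openin_stone_cech_basic by blast
    qed
    have basis: "openin ?T W" if "W \<in> ?B" for W
    proof -
      have "\<Union>?B \<inter> W = W" using that by blast
      moreover have "(finite intersection_of (\<lambda>x. x \<in> ?B) relative_to \<Union>?B) (\<Union>?B \<inter> W)"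
        by (rule relative_to_inc, rule finite_intersection_of_inc) (rule that)
      ultimately show ?thesis
        unfolding openin_subbase by (metis (no_types, lifting) arbitrary_union_of_inc)
    qed
    assume "openin (stone_cech X) S"
    then have "generate_topology_on ?B S"
      unfolding stone_cech_def by (rule openin_topology_generated_by)
    then show "openin ?T S"
    proof induction
      case Empty
      show ?case by (rule openin_empty)
    next
      case (Int a b)
      then show ?case by (intro openin_Int)
    next
      case (UN K)
      then show ?case by (intro openin_Union)
    next
      case (Basis s)
      then show ?case by (rule basis)
    qed
  qed
  fix C assume C: "C \<subseteq> ?B" "\<Union>C = topspace (stone_cech X)"
  let ?V = "\<lambda>Z. {p. z_ultrafilter X p \<and> Z \<notin> p}"
  define S where "S = {Z \<in> zero_sets X. ?V Z \<in> C}"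
  have CS: "C = ?V ` S" using C(1) unfolding S_def by blast
  show "\<exists>C'. finite C' \<and> C' \<subseteq> C \<and> \<Union>C' = topspace (stone_cech X)"
  proof (rule ccontr)
    assume neg: "\<not> ?thesis"
    have fip: "topspace X \<inter> \<Inter>F \<noteq> {}" if F: "finite F" "F \<subseteq> S" for F
    proof
      assume e: "topspace X \<inter> \<Inter>F = {}"
      have "\<Union>(?V ` F) = topspace (stone_cech X)"
      proof -
        have "\<exists>Z\<in>F. Z \<notin> p" if p: "z_ultrafilter X p" for p
        proof (rule ccontr)
          assume a: "\<not> ?thesis"
          have "topspace X \<inter> \<Inter>F \<in> p" using F(1) a
          proof (induction F rule: finite_induct)
            case empty
            then show ?case using z_ultrafilterD(2)[OF p] by simp
          next
            case (insert Z F)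
            then have "Z \<inter> (topspace X \<inter> \<Inter>F) \<in> p" using z_ultrafilterD(4)[OF p] by blast
            then show ?case by (simp add: Int_left_commute)
          qed
          then show False using e z_ultrafilterD(3)[OF p] by simp
        qed
        then show ?thesis unfolding topspace_stone_cech by blast
      qed
      moreover have "finite (?V ` F)" "?V ` F \<subseteq> C" using F CS by auto
      ultimately show False using neg by (metis (no_types, lifting))
    qed
    obtain q where "z_filter X q" "S \<subseteq> q"
      using z_filter_generated[of S X] fip unfolding S_def by blast
    then obtain p where "z_ultrafilter X p" "S \<subseteq> p" by (meson z_ultrafilter_extends order_trans)
    then have "p \<in> \<Union>C" "p \<notin> \<Union>(?V ` S)" using C(2) unfolding topspace_stone_cech by auto
    then show False using CS by simp
  qed
qed

lemma Hausdorff_space_stone_cech: "Hausdorff_space (stone_cech X)"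
  unfolding Hausdorff_space_def topspace_stone_cech
proof (intro allI impI)
  fix p q assume "p \<in> {p. z_ultrafilter X p} \<and> q \<in> {p. z_ultrafilter X p} \<and> p \<noteq> q"
  then have p: "z_ultrafilter X p" and q: "z_ultrafilter X q" and ne: "p \<noteq> q" by auto
  have "\<not> p \<subseteq> q" using p q ne unfolding z_ultrafilter_def by blast
  then obtain A where A: "A \<in> p" "A \<notin> q" by blast
  have Az: "A \<in> zero_sets X" using A z_ultrafilterD(1)[OF p] by blast
  obtain B where B: "B \<in> q" "B \<inter> A = {}" using z_ultrafilter_disjoint[OF q Az A(2)] .
  have Bz: "B \<in> zero_sets X" using B z_ultrafilterD(1)[OF q] by blast
  obtain f where f: "continuous_map X euclideanreal f" "A = {x \<in> topspace X. f x = 0}"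
    using Az by (rule zero_setsE)
  obtain g where g: "continuous_map X euclideanreal g" "B = {x \<in> topspace X. g x = 0}"
    using Bz by (rule zero_setsE)
  define C where "C = {x \<in> topspace X. \<bar>g x\<bar> \<le> \<bar>f x\<bar>}"
  define E where "E = {x \<in> topspace X. \<bar>f x\<bar> \<le> \<bar>g x\<bar>}"
  have z: "C \<in> zero_sets X" "E \<in> zero_sets X"
    unfolding C_def E_def using f(1) g(1) by (intro zero_sets_le continuous_intros; simp)+
  have "A \<inter> C = {}" "B \<inter> E = {}" using B(2) f(2) g(2) unfolding C_def E_def by auto
  then have "C \<notin> p" "E \<notin> q"
    using A B z_ultrafilterD(3,4)[OF p] z_ultrafilterD(3,4)[OF q] by metis+
  moreover have "r \<in> {p. z_ultrafilter X p \<and> C \<notin> p} \<Longrightarrow> r \<notin> {p. z_ultrafilter X p \<and> E \<notin> p}" for r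
  proof -
    have "topspace X \<subseteq> C \<union> E" unfolding C_def E_def by auto
    then show "r \<in> {p. z_ultrafilter X p \<and> C \<notin> p} \<Longrightarrow> r \<notin> {p. z_ultrafilter X p \<and> E \<notin> p}"
      using z_ultrafilter_prime z by blast
  qed
  ultimately show "\<exists>U V. openin (stone_cech X) U \<and> openin (stone_cech X) V \<and> p \<in> U \<and> q \<in> V \<and> disjnt U V"
    using openin_stone_cech_basic z p q unfolding disjnt_iff by blast
qed

lemma z_filter_sc_embed:
  assumes x: "x \<in> topspace X"
  shows "z_filter X (sc_embed X x)"
proof (rule z_filterI)
  show "sc_embed X x \<subseteq> zero_sets X" unfolding sc_embed_def by (rule Collect_subset)
  show "topspace X \<in> sc_embed X x" using x by (simp add: sc_embed_def topspace_in_zero_sets)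
  show "{} \<notin> sc_embed X x" by (simp add: sc_embed_def)
next
  fix A B assume "A \<in> sc_embed X x" "B \<in> sc_embed X x"
  then show "A \<inter> B \<in> sc_embed X x" by (simp add: sc_embed_def zero_sets_Int)
next
  fix A B assume "A \<in> sc_embed X x" "B \<in> zero_sets X" "A \<subseteq> B"
  then show "B \<in> sc_embed X x" by (simp add: sc_embed_def subsetD)
qed

lemma z_ultrafilter_sc_embed:
  assumes x: "x \<in> topspace X"
  shows "z_ultrafilter X (sc_embed X x)"
proof -
  have "q = sc_embed X x" if q: "z_filter X q \<and> sc_embed X x \<subseteq> q" for q
  proof (rule subset_antisym)
    note D = z_filterD[OF conjunct1[OF q]]
    show "sc_embed X x \<subseteq> q" using q by simp
    show "q \<subseteq> sc_embed X x"
    proof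
      fix Z assume Z: "Z \<in> q"
      have Zz: "Z \<in> zero_sets X" using D(1) Z by (rule subsetD)
      obtain f where f: "continuous_map X euclideanreal f" "Z = {x \<in> topspace X. f x = 0}"
        using Zz by (rule zero_setsE)
      have "x \<in> Z"
      proof (rule ccontr)
        assume "x \<notin> Z"
        then have fx: "f x \<noteq> 0" using x f(2) by simp
        let ?W = "{y \<in> topspace X. f y - f x = 0}"
        have "?W \<in> zero_sets X"
          by (rule zero_setsI[where f="\<lambda>y. f y - f x"])
             (use f(1) in \<open>auto intro!: continuous_intros\<close>)
        then have "?W \<in> sc_embed X x" using x by (simp add: sc_embed_def)
        then have "?W \<in> q" using q by (meson subsetD)
        then have "?W \<inter> Z \<in> q" using D(4) Z by meson
        moreover have "?W \<inter> Z = {}" using f(2) fx by auto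
        ultimately show False using D(3) by simp
      qed
      then show "Z \<in> sc_embed X x" using Zz by (simp add: sc_embed_def)
    qed
  qed
  then show ?thesis using z_filter_sc_embed[OF x] unfolding z_ultrafilter_def by simp
qed

lemma zero_sets_Un:
  assumes "A \<in> zero_sets X" "B \<in> zero_sets X"
  shows "A \<union> B \<in> zero_sets X"
proof -
  obtain f where f: "continuous_map X euclideanreal f" "A = {x \<in> topspace X. f x = 0}"
    using assms(1) by (rule zero_setsE)
  obtain g where g: "continuous_map X euclideanreal g" "B = {x \<in> topspace X. g x = 0}"
    using assms(2) by (rule zero_setsE)
  show ?thesis
    by (rule zero_setsI[where f="\<lambda>x. f x * g x"])
       (use f g in \<open>auto intro!: continuous_intros\<close>)
qed

lemma z_ultrafilter_Un_iff:
  assumes p: "z_ultrafilter X p" and z: "A \<in> zero_sets X" "B \<in> zero_sets X"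
  shows "A \<union> B \<in> p \<longleftrightarrow> A \<in> p \<or> B \<in> p"
proof
  note D = z_ultrafilterD[OF p]
  show "A \<union> B \<in> p" if "A \<in> p \<or> B \<in> p"
    using that D(5) zero_sets_Un[OF z] by blast
  assume AB: "A \<union> B \<in> p"
  show "A \<in> p \<or> B \<in> p"
  proof (rule ccontr)
    assume neg: "\<not> (A \<in> p \<or> B \<in> p)"
    obtain C where C: "C \<in> p" "C \<inter> A = {}" using z_ultrafilter_disjoint[OF p z(1)] neg by blast
    obtain E where E: "E \<in> p" "E \<inter> B = {}" using z_ultrafilter_disjoint[OF p z(2)] neg by blast
    have "C \<inter> E \<inter> (A \<union> B) \<in> p" using C E D(4) AB by blast
    moreover have "C \<inter> E \<inter> (A \<union> B) = {}" using C E by blast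
    ultimately show False using D(3) by simp
  qed
qed

lemma openin_stone_cech_base:
  assumes "openin (stone_cech X) U" "p \<in> U"
  obtains Z where "Z \<in> zero_sets X" "Z \<notin> p" "{q. z_ultrafilter X q \<and> Z \<notin> q} \<subseteq> U"
proof -
  let ?B = "{{p. z_ultrafilter X p \<and> Z \<notin> p} | Z. Z \<in> zero_sets X}"
  let ?P = "\<lambda>U. \<forall>p\<in>U. \<exists>Z\<in>zero_sets X. Z \<notin> p \<and> {q. z_ultrafilter X q \<and> Z \<notin> q} \<subseteq> U"
  have p: "z_ultrafilter X p" if "openin (stone_cech X) V" "p \<in> V" for p V
    using that openin_subset topspace_stone_cech by blast
  have "generate_topology_on ?B U"
    using assms(1) unfolding stone_cech_def by (rule openin_topology_generated_by)
  then have "openin (stone_cech X) U \<and> ?P U"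
  proof induction
    case (Int a b)
    have "\<exists>Z\<in>zero_sets X. Z \<notin> p \<and> {q. z_ultrafilter X q \<and> Z \<notin> q} \<subseteq> a \<inter> b"
      if pab: "p \<in> a \<inter> b" for p
    proof -
      have pa: "p \<in> a" and pb: "p \<in> b" using pab by simp_all
      obtain Z where Z: "Z \<in> zero_sets X" "Z \<notin> p" "{q. z_ultrafilter X q \<and> Z \<notin> q} \<subseteq> a"
        using bspec[OF conjunct2[OF Int.IH(1)] pa] by (elim bexE conjE)
      obtain W where W: "W \<in> zero_sets X" "W \<notin> p" "{q. z_ultrafilter X q \<and> W \<notin> q} \<subseteq> b"
        using bspec[OF conjunct2[OF Int.IH(2)] pb] by (elim bexE conjE)
      have "z_ultrafilter X p" using p[OF conjunct1[OF Int.IH(1)] pa] .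
      then have "Z \<union> W \<notin> p" using z_ultrafilter_Un_iff[of X p Z W] Z W by simp
      moreover have "{q. z_ultrafilter X q \<and> Z \<union> W \<notin> q} \<subseteq> a \<inter> b"
        using z_ultrafilter_Un_iff[OF _ Z(1) W(1)] Z(3) W(3) by fastforce
      ultimately show ?thesis using zero_sets_Un[OF Z(1) W(1)] by (intro bexI[of _ "Z \<union> W"] conjI)
    qed
    then show ?case using Int.IH by (simp add: openin_Int)
  next
    case (UN K)
    have "?P (\<Union>K)"
    proof
      fix p assume "p \<in> \<Union>K"
      then obtain k where k: "k \<in> K" "p \<in> k" by blast
      then obtain Z where Z: "Z \<in> zero_sets X" "Z \<notin> p" "{q. z_ultrafilter X q \<and> Z \<notin> q} \<subseteq> k"
        using bspec[OF conjunct2[OF UN.IH[OF k(1)]] k(2)] by (elim bexE conjE)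
      have "{q. z_ultrafilter X q \<and> Z \<notin> q} \<subseteq> \<Union>K"
        using Z(3) Union_upper[OF k(1)] by (rule order_trans)
      then show "\<exists>Z\<in>zero_sets X. Z \<notin> p \<and> {q. z_ultrafilter X q \<and> Z \<notin> q} \<subseteq> \<Union>K"
        using Z(1,2) by (intro bexI[of _ Z] conjI)
    qed
    moreover have "openin (stone_cech X) (\<Union>K)" by (rule openin_Union) (use UN.IH in simp)
    ultimately show ?case by (intro conjI)
  next
    case (Basis s)
    then obtain Z where Z: "s = {p. z_ultrafilter X p \<and> Z \<notin> p}" "Z \<in> zero_sets X" by blast
    have "?P s"
    proof
      fix p assume "p \<in> s"
      then show "\<exists>Z\<in>zero_sets X. Z \<notin> p \<and> {q. z_ultrafilter X q \<and> Z \<notin> q} \<subseteq> s"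
        using Z by (intro bexI[of _ Z] conjI) auto
    qed
    then show ?case using openin_stone_cech_basic[OF Z(2)] Z(1) by simp
  qed simp
  from bspec[OF conjunct2[OF this] assms(2)]
  obtain Z where "Z \<in> zero_sets X" "Z \<notin> p" "{q. z_ultrafilter X q \<and> Z \<notin> q} \<subseteq> U"
    by (elim bexE conjE)
  then show thesis by (rule that)
qed

lemma embedding_map_sc_embed:
  assumes cr: "completely_regular_space X" and H: "Hausdorff_space X"
  shows "embedding_map X (stone_cech X) (sc_embed X)"
  unfolding embedding_map_def
proof (rule bijective_open_imp_homeomorphic_map)
  let ?e = "sc_embed X" and ?V = "\<lambda>Z. {p. z_ultrafilter X p \<and> Z \<notin> p}"
  let ?Y = "subtopology (stone_cech X) (?e ` topspace X)"
  note u = z_ultrafilter_sc_embed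
  have sep: "\<exists>Z\<in>zero_sets X. x \<notin> Z \<and> topspace X - U \<subseteq> Z" if U: "openin X U" "x \<in> U" for x U
  proof -
    have "closedin X (topspace X - U)" "x \<in> topspace X - (topspace X - U)"
      using U openin_subset by (blast, blast)
    then obtain f :: "'a \<Rightarrow> real" where f: "continuous_map X (top_of_set {0..1}) f"
        "f x = 0" "f ` (topspace X - U) \<subseteq> {1}"
      using cr unfolding completely_regular_space_def by meson
    have "continuous_map X euclideanreal f"
      using f(1) continuous_map_in_subtopology by blast
    then have "{y \<in> topspace X. 1 \<le> f y} \<in> zero_sets X"
      by (intro zero_sets_le) auto
    then show ?thesis
      by (rule rev_bexI) (use f in \<open>auto simp: image_subset_iff\<close>)
  qed
  show "continuous_map X ?Y ?e"
    unfolding continuous_map_in_subtopology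
  proof
    show "continuous_map X (stone_cech X) ?e"
      unfolding stone_cech_def
    proof (rule continuous_on_generated_topo)
      show "?e ` topspace X \<subseteq> \<Union>{?V Z | Z. Z \<in> zero_sets X}"
        using u topspace_stone_cech[of X] unfolding stone_cech_def by auto
      fix S assume "S \<in> {?V Z | Z. Z \<in> zero_sets X}"
      then obtain Z where Z: "Z \<in> zero_sets X" "S = ?V Z" by blast
      obtain f where f: "continuous_map X euclideanreal f" "Z = {x \<in> topspace X. f x = 0}"
        using Z(1) by (rule zero_setsE)
      have "?e -` S \<inter> topspace X = {x \<in> topspace X. f x \<in> - {0}}"
        using Z u f(2) unfolding sc_embed_def by auto
      moreover have "openin X {x \<in> topspace X. f x \<in> - {0}}"
        by (rule openin_continuous_map_preimage[OF f(1)]) (simp add: open_Compl)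
      ultimately show "openin X (?e -` S \<inter> topspace X)" by simp
    qed
  qed auto
  show "open_map X ?Y ?e"
    unfolding open_map_def
  proof (intro allI impI)
    fix U assume U: "openin X U"
    define W where "W = \<Union>{?V Z | Z. Z \<in> zero_sets X \<and> topspace X - U \<subseteq> Z}"
    have "openin (stone_cech X) W"
      unfolding W_def using openin_stone_cech_basic by (intro openin_Union) blast
    moreover have "?e ` U = ?e ` topspace X \<inter> W"
    proof
      show "?e ` U \<subseteq> ?e ` topspace X \<inter> W"
      proof
        fix p assume "p \<in> ?e ` U"
        then obtain x where x: "x \<in> U" "p = ?e x" by blast
        then have xt: "x \<in> topspace X" using U openin_subset by blast
        obtain Z where "Z \<in> zero_sets X" "x \<notin> Z" "topspace X - U \<subseteq> Z"
          using sep[OF U x(1)] by blast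
        then have "p \<in> W" unfolding W_def using u[OF xt] x(2) by (auto simp: sc_embed_def)
        then show "p \<in> ?e ` topspace X \<inter> W" using xt x by blast
      qed
      show "?e ` topspace X \<inter> W \<subseteq> ?e ` U"
        unfolding W_def by (auto simp: sc_embed_def)
    qed
    ultimately show "openin ?Y (?e ` U)"
      unfolding openin_subtopology by blast
  qed
  show "?e ` topspace X = topspace ?Y"
    using u unfolding topspace_subtopology topspace_stone_cech by auto
  show "inj_on ?e (topspace X)"
  proof (rule inj_onI, rule ccontr)
    fix x y assume xy: "x \<in> topspace X" "y \<in> topspace X" "?e x = ?e y" "x \<noteq> y"
    then obtain U where U: "openin X U" "x \<in> U" "y \<notin> U"
      using H unfolding Hausdorff_space_def disjnt_iff by meson
    then obtain Z where "Z \<in> zero_sets X" "x \<notin> Z" "y \<in> Z" using sep xy by blast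
    then show False using xy(3) unfolding sc_embed_def by blast
  qed
qed

lemma dense_sc_embed:
  "stone_cech X closure_of (sc_embed X ` topspace X) = topspace (stone_cech X)"
proof (intro subset_antisym closure_of_subset_topspace subsetI)
  fix p assume p: "p \<in> topspace (stone_cech X)"
  have "\<exists>y. y \<in> sc_embed X ` topspace X \<and> y \<in> U" if U: "openin (stone_cech X) U" "p \<in> U" for U
  proof -
    obtain Z where Z: "Z \<in> zero_sets X" "Z \<notin> p" "{q. z_ultrafilter X q \<and> Z \<notin> q} \<subseteq> U"
      using U by (rule openin_stone_cech_base)
    have "Z \<noteq> topspace X"
      using Z(2) p z_ultrafilterD(2) unfolding topspace_stone_cech by blast
    then obtain x where x: "x \<in> topspace X" "x \<notin> Z" using zero_sets_subset[OF Z(1)] by blast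
    then have "sc_embed X x \<in> U"
      using Z(3) z_ultrafilter_sc_embed[OF x(1)] by (auto simp: sc_embed_def)
    then show ?thesis using x(1) by blast
  qed
  then show "p \<in> stone_cech X closure_of (sc_embed X ` topspace X)"
    using p unfolding in_closure_of by blast
qed

lemma stone_cech_extension:
  assumes f: "continuous_map X (top_of_set {0..1::real}) f"
  obtains g where "continuous_map (stone_cech X) (top_of_set {0..1}) g"
    "\<And>x. x \<in> topspace X \<Longrightarrow> g (sc_embed X x) = f x"
proof -
  let ?G = "\<lambda>t. {x \<in> topspace X. t \<le> f x}" and ?L = "\<lambda>t. {x \<in> topspace X. f x \<le> t}"
  have fc: "continuous_map X euclideanreal f" and f01: "\<And>x. x \<in> topspace X \<Longrightarrow> 0 \<le> f x \<and> f x \<le> 1"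
    using f unfolding continuous_map_in_subtopology by auto
  have G: "?G t \<in> zero_sets X" and L: "?L t \<in> zero_sets X" for t
    using fc by (intro zero_sets_le; simp)+
  define g where "g p = Sup {t. ?G t \<in> p}" for p
  have bd: "t \<le> 1" if "z_ultrafilter X p" "?G t \<in> p" for p t
  proof (rule ccontr)
    assume "\<not> t \<le> 1"
    then have "?G t = {}" using f01 by force
    then show False using z_ultrafilterD(3)[OF that(1)] that(2) by (metis (no_types, lifting))
  qed
  have zero: "?G 0 \<in> p" if "z_ultrafilter X p" for p
  proof -
    have "?G 0 = topspace X" using f01 by auto
    then show ?thesis using z_ultrafilterD(2)[OF that] by simp
  qed
  have bdd: "bdd_above {t. ?G t \<in> p}" if "z_ultrafilter X p" for p
    using bd[OF that] by (intro bdd_aboveI[of _ 1]) blast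
  have upper: "t \<le> g p" if "z_ultrafilter X p" "?G t \<in> p" for p t
    unfolding g_def using that bdd by (intro cSup_upper) auto
  have g01: "0 \<le> g p \<and> g p \<le> 1" if p: "z_ultrafilter X p" for p
  proof
    show "0 \<le> g p" using upper[OF p zero[OF p]] .
    show "g p \<le> 1" unfolding g_def using zero[OF p] bd[OF p] by (intro cSup_least) auto
  qed
  have disj: "t \<le> s" if p: "z_ultrafilter X p" "?G t \<in> p" "?L s \<in> p" for p t s
  proof (rule ccontr)
    assume "\<not> t \<le> s"
    then have "?G t \<inter> ?L s = {}" by auto
    then show False using z_ultrafilterD(3,4)[OF p(1)] p(2,3) by metis
  qed
  have or: "?G s \<in> p \<or> ?L s \<in> p" if "z_ultrafilter X p" for p s
    using that G L by (rule z_ultrafilter_prime) auto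
  have lower: "g p \<le> s" if p: "z_ultrafilter X p" "?L s \<in> p" for p s
    unfolding g_def using zero[OF p(1)] disj[OF p(1) _ p(2)] by (intro cSup_least) auto
  have less: "\<exists>s<r. ?G s \<notin> p" if p: "z_ultrafilter X p" "g p < r" for p r
  proof -
    obtain s where "g p < s" "s < r" using dense p(2) by blast
    then show ?thesis using upper[OF p(1)] by (meson not_le)
  qed
  have greater: "\<exists>s>r. ?L s \<notin> p" if p: "z_ultrafilter X p" "r < g p" for p r
  proof -
    obtain s where "s < g p" "r < s" using dense p(2) by blast
    then show ?thesis using lower[OF p(1)] by (meson not_le)
  qed
  have ge: "{p \<in> topspace (stone_cech X). g p < r} =
      \<Union>{{p. z_ultrafilter X p \<and> ?G s \<notin> p} | s. s < r}" for r
  proof (intro set_eqI iffI)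
    fix p assume "p \<in> {p \<in> topspace (stone_cech X). g p < r}"
    then have p: "z_ultrafilter X p" "g p < r" by (simp_all add: topspace_stone_cech)
    obtain s where "s < r" "?G s \<notin> p" using less[OF p] by (elim exE conjE)
    then show "p \<in> \<Union>{{p. z_ultrafilter X p \<and> ?G s \<notin> p} | s. s < r}" using p(1) by auto
  next
    fix p assume "p \<in> \<Union>{{p. z_ultrafilter X p \<and> ?G s \<notin> p} | s. s < r}"
    then obtain s where p: "z_ultrafilter X p" "?G s \<notin> p" "s < r" by auto
    then have "g p \<le> s" using or[OF p(1), of s] lower[OF p(1)] by (elim disjE) simp_all
    then show "p \<in> {p \<in> topspace (stone_cech X). g p < r}"
      using p by (simp add: topspace_stone_cech)
  qed
  have le: "{p \<in> topspace (stone_cech X). g p > r} =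
      \<Union>{{p. z_ultrafilter X p \<and> ?L s \<notin> p} | s. s > r}" for r
  proof (intro set_eqI iffI)
    fix p assume "p \<in> {p \<in> topspace (stone_cech X). g p > r}"
    then have p: "z_ultrafilter X p" "r < g p" by (simp_all add: topspace_stone_cech)
    obtain s where "r < s" "?L s \<notin> p" using greater[OF p] by (elim exE conjE)
    then show "p \<in> \<Union>{{p. z_ultrafilter X p \<and> ?L s \<notin> p} | s. s > r}" using p(1) by auto
  next
    fix p assume "p \<in> \<Union>{{p. z_ultrafilter X p \<and> ?L s \<notin> p} | s. s > r}"
    then obtain s where p: "z_ultrafilter X p" "?L s \<notin> p" "r < s" by auto
    then have "s \<le> g p" using or[OF p(1), of s] upper[OF p(1)] by (elim disjE) simp_all
    then show "p \<in> {p \<in> topspace (stone_cech X). g p > r}"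
      using p by (simp add: topspace_stone_cech)
  qed
  have "continuous_map (stone_cech X) euclideanreal g"
    unfolding continuous_map_upper_lower_semicontinuous_lt
  proof (intro allI conjI)
    fix r
    show "openin (stone_cech X) {p \<in> topspace (stone_cech X). g p < r}"
      unfolding ge using openin_stone_cech_basic G by (intro openin_Union) blast
    show "openin (stone_cech X) {p \<in> topspace (stone_cech X). g p > r}"
      unfolding le using openin_stone_cech_basic L by (intro openin_Union) blast
  qed
  then have "continuous_map (stone_cech X) (top_of_set {0..1}) g"
    unfolding continuous_map_in_subtopology using g01 by (auto simp: topspace_stone_cech)
  moreover have "g (sc_embed X x) = f x" if x: "x \<in> topspace X" for x
  proof (rule antisym)
    note u = z_ultrafilter_sc_embed[OF x]
    show "g (sc_embed X x) \<le> f x" using lower[OF u] L x by (simp add: sc_embed_def)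
    show "f x \<le> g (sc_embed X x)" using upper[OF u] G x by (simp add: sc_embed_def)
  qed
  ultimately show thesis by (rule that)
qed

definition sc_closure :: "'a topology \<Rightarrow> 'a set \<Rightarrow> 'a set set set" where
  "sc_closure X A = stone_cech X closure_of (sc_embed X ` A)"

definition sc_remainder :: "'a topology \<Rightarrow> 'a set set topology" where
  "sc_remainder X =
     subtopology (stone_cech X) (topspace (stone_cech X) - sc_embed X ` topspace X)"

definition sc_star :: "'a topology \<Rightarrow> 'a set \<Rightarrow> 'a set set set" where
  "sc_star X A = sc_closure X A - sc_embed X ` topspace X"

definition NN :: "nat set" where
  "NN = {1..}"

definition Nstar :: "nat set set topology" where
  "Nstar = sc_remainder (discrete_topology NN)"

definition MM :: "(nat \<times> real) topology" where
  "MM = prod_topology (discrete_topology NN) (top_of_set {0..1})"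

definition Mstar :: "(nat \<times> real) set set topology" where
  "Mstar = sc_remainder MM"

text \<open>
  Points of different copies of the unit interval are incomparable.
\<close>

definition M_less :: "nat \<times> real \<Rightarrow> nat \<times> real \<Rightarrow> bool" where
  "M_less x y \<longleftrightarrow> fst x = fst y \<and> snd x < snd y"

definition M_interval :: "nat \<times> real \<Rightarrow> nat \<times> real \<Rightarrow> (nat \<times> real) set" where
  "M_interval a b = {x. fst x = fst a \<and> fst x = fst b \<and> snd a \<le> snd x \<and> snd x \<le> snd b}"

text \<open>
  Sequences are indexed by \<^term>\<open>NN\<close>; their values outside \<^term>\<open>NN\<close> are irrelevant.  As the
  intervals of a standard sequence are non-empty and pairwise disjoint, local finiteness of the
  indexed family and of its set of members are the same.
\<close>

definition standard_sequence :: "(nat \<Rightarrow> nat \<times> real) \<Rightarrow> (nat \<Rightarrow> nat \<times> real) \<Rightarrow> bool" where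
  "standard_sequence a b \<longleftrightarrow>
     (\<forall>m \<in> NN. a m \<in> topspace MM \<and> b m \<in> topspace MM \<and> M_less (a m) (b m)) \<and>
     disjoint_family_on (\<lambda>m. M_interval (a m) (b m)) NN \<and>
     locally_finite_in MM ((\<lambda>m. M_interval (a m) (b m)) ` NN)"

definition selector_sequence ::
  "(nat \<Rightarrow> nat \<times> real) \<Rightarrow> (nat \<Rightarrow> nat \<times> real) \<Rightarrow> (nat \<Rightarrow> nat \<times> real) \<Rightarrow> bool" where
  "selector_sequence a b x \<longleftrightarrow>
     (\<forall>m \<in> NN. x m \<in> topspace MM \<and> M_less (a m) (x m) \<and> M_less (x m) (b m))"

text \<open>
  The arguments \<open>u\<close> below are points of \<^term>\<open>Nstar\<close>, that is, free ultrafilters on \<^term>\<open>NN\<close>.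
\<close>

definition u_lim :: "nat set set \<Rightarrow> (nat \<Rightarrow> (nat \<times> real) set) \<Rightarrow> (nat \<times> real) set set set" where
  "u_lim u A = (\<Inter>s \<in> u. sc_closure MM (\<Union>n \<in> s. A n))"

definition interval_lim ::
  "(nat \<Rightarrow> nat \<times> real) \<Rightarrow> (nat \<Rightarrow> nat \<times> real) \<Rightarrow> nat set set \<Rightarrow> (nat \<times> real) set set set" where
  "interval_lim a b u = u_lim u (\<lambda>m. M_interval (a m) (b m))"

definition point_lim :: "(nat \<Rightarrow> nat \<times> real) \<Rightarrow> nat set set \<Rightarrow> (nat \<times> real) set set" where
  "point_lim x u = the_elem (u_lim u (\<lambda>m. {x m}))"

definition cut_points ::
  "(nat \<Rightarrow> nat \<times> real) \<Rightarrow> (nat \<Rightarrow> nat \<times> real) \<Rightarrow> nat set set \<Rightarrow> (nat \<times> real) set set set" where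
  "cut_points a b u = {point_lim x u | x. selector_sequence a b x}"

definition cut_less ::
  "(nat \<Rightarrow> nat \<times> real) \<Rightarrow> (nat \<Rightarrow> nat \<times> real) \<Rightarrow> nat set set \<Rightarrow>
     (nat \<times> real) set set \<Rightarrow> (nat \<times> real) set set \<Rightarrow> bool" where
  "cut_less a b u p q \<longleftrightarrow>
     (\<exists>x y. selector_sequence a b x \<and> selector_sequence a b y \<and>
        p = point_lim x u \<and> q = point_lim y u \<and> {m \<in> NN. M_less (x m) (y m)} \<in> u)"

definition order_convex_cuts ::
  "(nat \<Rightarrow> nat \<times> real) \<Rightarrow> (nat \<Rightarrow> nat \<times> real) \<Rightarrow> nat set set \<Rightarrow>
     (nat \<times> real) set set set \<Rightarrow> bool" where
  "order_convex_cuts a b u C \<longleftrightarrow> C \<subseteq> cut_points a b u \<and>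
     (\<forall>p \<in> C. \<forall>q \<in> C. \<forall>r \<in> cut_points a b u.
        cut_less a b u p r \<and> cut_less a b u r q \<longrightarrow> r \<in> C)"

definition subinterval ::
  "(nat \<Rightarrow> nat \<times> real) \<Rightarrow> (nat \<Rightarrow> nat \<times> real) \<Rightarrow> nat set set \<Rightarrow>
     (nat \<times> real) set set set \<Rightarrow> bool" where
  "subinterval a b u J \<longleftrightarrow> (\<exists>C. order_convex_cuts a b u C \<and> J = Mstar closure_of C)"

definition image_subinterval ::
  "((nat \<times> real) set set \<Rightarrow> (nat \<times> real) set set) \<Rightarrow>
     (nat \<Rightarrow> nat \<times> real) \<Rightarrow> (nat \<Rightarrow> nat \<times> real) \<Rightarrow> nat set set \<Rightarrow>
     (nat \<times> real) set set set \<Rightarrow> bool" where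
  "image_subinterval \<Psi> a b u K \<longleftrightarrow> (\<exists>J. subinterval a b u J \<and> K = \<Psi> ` J)"

end

theory Submission
  imports Defs
begin

text \<open>
  Let \<open>P\<close> be the set of all \<open>\<Psi> x\<^sub>u\<close>, and \<open>Q\<close> the image of the remainder of the complement of the open
  intervals.  A continuous function separating \<open>P\<close> from \<open>Q\<close> has sublevel sets whose components in each
  copy of the unit interval give a standard sequence \<open>[c\<^sub>j, d\<^sub>j]\<close> covering a neighbourhood of \<open>P\<close> and
  missing \<open>Q\<close>.  Each \<open>[c\<^sub>j, d\<^sub>j]\<^sub>w\<close> is connected, so it lies in a single \<open>\<Psi> [a\<^sub>m, b\<^sub>m]\<^sub>u\<close>; hence the map
  \<open>h\<close> defined by \<open>\<Psi> x\<^sub>u \<in> [c\<^sub>j, d\<^sub>j]\<^bsub>h u\<^esub>\<close> is continuous and injective.  Its range is closed by compactness.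
  It is open because it consists of those \<open>w\<close> for which \<open>[c\<^sub>j, d\<^sub>j]\<^sub>w\<close> contains points strictly on either
  side of \<open>P\<close>, that is, points outside \<open>\<Psi> [a\<^sub>m, x\<^sub>m]\<^sup>*\<close> and points outside \<open>\<Psi> [x\<^sub>m, b\<^sub>m]\<^sup>*\<close>.  So the range
  is given by a set of indices \<open>j\<close>, and discarding all other intervals makes \<open>h\<close> a homeomorphism.  Then
  \<open>[c\<^sub>j, d\<^sub>j]\<^bsub>h u\<^esub>\<close> contains all points of \<open>\<Psi> [a\<^sub>m, b\<^sub>m]\<^sub>u\<close> that the intervals cover, and it is a
  subinterval since the cut points are dense in the interior of its preimage.
\<close>

section \<open>Remainders of Stone-Cech compactifications\<close>

text \<open>\<open>\<Psi>\<close> need not be induced by a map of \<open>MM\<close>, so neither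
  indices nor the order inside an interval can be carried across; what survives is topology, chiefly
  the connectedness of interval limits. Keeping the cover away from \<open>Q\<close> ensures that
  every covered point pulls back to a point with an index ultrafilter for the given sequence, and
  connectedness makes that index constant on each block \<open>interval_lim c d w\<close>. The
  obstacle is the range of \<open>h\<close>: a closed copy of \<open>Nstar\<close> inside
  \<open>Nstar\<close> can be nowhere dense, so a continuous injection need not have open range. The
  way out is that \<open>x m\<close> lies strictly inside its interval and cuts it into two closed
  halves with only \<open>x m\<close> in common: leaving a given half is an open condition on
  \<open>w\<close>, and leaving both forces a connected block to meet \<open>P\<close>. Surjectivity
  is used once more for the subinterval property: each remaining block belongs to exactly one
  \<open>u\<close>, so a covered point of the image of an interval limit has no other block to lie
  in.\<close>

lemma sc_closure_zero_set:
  assumes Z: "Z \<in> zero_sets X"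
  shows "sc_closure X Z = {p. z_ultrafilter X p \<and> Z \<in> p}"
proof
  have "topspace (stone_cech X) - {p. z_ultrafilter X p \<and> Z \<notin> p} = {p. z_ultrafilter X p \<and> Z \<in> p}"
    by (auto simp: topspace_stone_cech)
  then have cl: "closedin (stone_cech X) {p. z_ultrafilter X p \<and> Z \<in> p}"
    by (metis openin_closedin_eq openin_stone_cech_basic[OF Z] closedin_diff closedin_topspace)
  have "sc_embed X ` Z \<subseteq> {p. z_ultrafilter X p \<and> Z \<in> p}"
    using zero_sets_subset[OF Z] z_ultrafilter_sc_embed Z by (force simp: sc_embed_def)
  then show "sc_closure X Z \<subseteq> {p. z_ultrafilter X p \<and> Z \<in> p}"
    unfolding sc_closure_def by (rule closure_of_minimal[OF _ cl])
  show "{p. z_ultrafilter X p \<and> Z \<in> p} \<subseteq> sc_closure X Z"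
  proof clarify
    fix p assume p: "z_ultrafilter X p" "Z \<in> p"
    have "\<exists>y. y \<in> sc_embed X ` Z \<and> y \<in> U" if U: "openin (stone_cech X) U" "p \<in> U" for U
    proof -
      obtain W where W: "W \<in> zero_sets X" "W \<notin> p" "{q. z_ultrafilter X q \<and> W \<notin> q} \<subseteq> U"
        using U by (rule openin_stone_cech_base)
      \<comment> \<open>A member of \<open>p\<close> disjoint from \<open>W\<close> meets
        \<open>Z\<close>, because \<open>p\<close> contains both; the fixed ultrafilter at a common
        point omits \<open>W\<close>, so it lies in \<open>U\<close>.\<close>
      obtain B where B: "B \<in> p" "B \<inter> W = {}" using z_ultrafilter_disjoint[OF p(1) W(1,2)] .
      have "B \<inter> Z \<noteq> {}" using z_ultrafilterD(3,4)[OF p(1)] B(1) p(2) by metis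
      then obtain x where x: "x \<in> B" "x \<in> Z" by blast
      then have xt: "x \<in> topspace X" and "x \<notin> W" using zero_sets_subset[OF Z] B(2) by auto
      then have "W \<notin> sc_embed X x" by (simp add: sc_embed_def)
      then have "sc_embed X x \<in> U" using subsetD[OF W(3)] z_ultrafilter_sc_embed[OF xt] by simp
      then show ?thesis using x by blast
    qed
    then show "p \<in> sc_closure X Z"
      using p(1) unfolding sc_closure_def in_closure_of topspace_stone_cech by simp
  qed
qed

lemma closedin_zero_set: "Z \<in> zero_sets X \<Longrightarrow> closedin X Z"
proof (erule zero_setsE)
  fix f assume "continuous_map X euclideanreal f" "Z = {x \<in> topspace X. f x = 0}"
  then show "closedin X Z"
    using closedin_continuous_map_preimage[of X euclideanreal f "{0}"] by simp
qed

text \<open>Compactness of \<open>K\<close> and the finite intersection property give a point common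
  to all members of \<open>p\<close>; then \<open>p\<close> is contained in the fixed ultrafilter at
  this point, and maximality gives equality. So points of the remainder have no compact
  members.\<close>

lemma z_ultrafilter_compactin_fixed:
  assumes p: "z_ultrafilter X p" and K: "K \<in> p" "compactin X K"
  obtains x where "x \<in> K" "p = sc_embed X x"
proof -
  note D = z_ultrafilterD[OF p]
  have "K \<inter> \<Inter>p \<noteq> {}"
  proof (rule compactin_fip[THEN iffD1, THEN conjunct2, rule_format, OF K(2)], intro conjI ballI allI impI)
    show "closedin X C" if "C \<in> p" for C using closedin_zero_set D(1) that by blast
    fix \<F> assume F: "finite \<F> \<and> \<F> \<subseteq> p"
    then have "finite \<F>" "\<F> \<subseteq> p" by auto
    then have "K \<inter> \<Inter>\<F> \<in> p"
    proof (induction \<F> rule: finite_induct)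
      case (insert A \<F>)
      then have "A \<inter> (K \<inter> \<Inter>\<F>) \<in> p" using D(4) by blast
      then show ?case by (simp add: Int_left_commute)
    qed (use K in simp)
    then show "K \<inter> \<Inter>\<F> \<noteq> {}" using D(3) by metis
  qed
  then obtain x where x: "x \<in> K" "\<forall>A\<in>p. x \<in> A" by blast
  have xt: "x \<in> topspace X" using x(2) D(2) by blast
  have "p \<subseteq> sc_embed X x" using x(2) D(1) by (auto simp: sc_embed_def)
  then have "p = sc_embed X x"
    using p z_ultrafilter_sc_embed[OF xt] unfolding z_ultrafilter_def by blast
  with x(1) show thesis by (rule that)
qed

lemma topspace_sc_remainder:
  "topspace (sc_remainder X) = {p. z_ultrafilter X p \<and> p \<notin> sc_embed X ` topspace X}"
  unfolding sc_remainder_def by (auto simp: topspace_stone_cech)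

lemma sc_star_zero_set:
  "Z \<in> zero_sets X \<Longrightarrow> sc_star X Z = {p \<in> topspace (sc_remainder X). Z \<in> p}"
  unfolding sc_star_def by (auto simp: sc_closure_zero_set topspace_sc_remainder)

lemma openin_sc_remainder_basic:
  assumes "Z \<in> zero_sets X"
  shows "openin (sc_remainder X) {p \<in> topspace (sc_remainder X). Z \<notin> p}"
proof -
  have "{p \<in> topspace (sc_remainder X). Z \<notin> p} =
    {p. z_ultrafilter X p \<and> Z \<notin> p} \<inter> (topspace (stone_cech X) - sc_embed X ` topspace X)"
    by (auto simp: topspace_sc_remainder topspace_stone_cech)
  then show ?thesis
    unfolding sc_remainder_def
    using openin_stone_cech_basic[OF assms] by (auto simp: openin_subtopology)
qed

lemma closedin_sc_remainder_basic:
  assumes "Z \<in> zero_sets X"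
  shows "closedin (sc_remainder X) {p \<in> topspace (sc_remainder X). Z \<in> p}"
proof -
  have "topspace (sc_remainder X) - {p \<in> topspace (sc_remainder X). Z \<in> p} =
      {p \<in> topspace (sc_remainder X). Z \<notin> p}" by auto
  then show ?thesis using openin_sc_remainder_basic[OF assms] by (simp add: closedin_def)
qed

lemma openin_sc_remainder_base:
  assumes "openin (sc_remainder X) U" "p \<in> U"
  obtains Z where "Z \<in> zero_sets X" "Z \<notin> p" "{q \<in> topspace (sc_remainder X). Z \<notin> q} \<subseteq> U"
proof -
  obtain T where T: "openin (stone_cech X) T"
      "U = T \<inter> (topspace (stone_cech X) - sc_embed X ` topspace X)"
    using assms(1) unfolding sc_remainder_def openin_subtopology by blast
  then have "p \<in> T" using assms(2) by blast
  with T(1) obtain Z where "Z \<in> zero_sets X" "Z \<notin> p" "{q. z_ultrafilter X q \<and> Z \<notin> q} \<subseteq> T"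
    by (rule openin_stone_cech_base)
  then show thesis using that T(2) by (auto simp: topspace_sc_remainder topspace_stone_cech)
qed

lemma Hausdorff_space_sc_remainder: "Hausdorff_space (sc_remainder X)"
  unfolding sc_remainder_def by (intro Hausdorff_space_subtopology Hausdorff_space_stone_cech)

text \<open>A remainder cut out by prescribing zero-sets as members is an intersection of basic
  closed sets. The tails of \<open>MM\<close> and the cofinite subsets of \<open>NN\<close> serve as
  \<open>\<T>\<close>.\<close>

lemma closedin_sc_remainder:
  assumes T: "\<T> \<subseteq> zero_sets X" and eq: "topspace (sc_remainder X) = {p. z_ultrafilter X p \<and> \<T> \<subseteq> p}"
  shows "closedin (stone_cech X) (topspace (sc_remainder X))"
proof -
  have "topspace (sc_remainder X) =
      topspace (stone_cech X) - (\<Union>Z\<in>\<T>. {p. z_ultrafilter X p \<and> Z \<notin> p})"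
    unfolding eq topspace_stone_cech by blast
  moreover have "openin (stone_cech X) (\<Union>Z\<in>\<T>. {p. z_ultrafilter X p \<and> Z \<notin> p})"
    using openin_stone_cech_basic T by (intro openin_Union) blast
  ultimately show ?thesis by (simp add: closedin_diff)
qed

lemma sc_remainder_subtopology:
  "sc_remainder X = subtopology (stone_cech X) (topspace (sc_remainder X))"
  unfolding sc_remainder_def by (simp add: Int_commute inf.absorb2 Diff_subset)

text \<open>Closed subsets of the remainder stay closed in the compact Hausdorff space
  \<open>stone_cech X\<close>, so Urysohn applies there; \<open>g\<close> is the Urysohn function
  restricted to \<open>X\<close>. The conclusion speaks of level sets because these are zero-sets of
  \<open>X\<close>, which can be compared directly with members of ultrafilters.\<close>

lemma sc_remainder_separation:
  assumes cr: "completely_regular_space X" and H: "Hausdorff_space X"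
    and cl: "closedin (stone_cech X) (topspace (sc_remainder X))"
    and E: "closedin (sc_remainder X) E" and F: "closedin (sc_remainder X) F" and EF: "E \<inter> F = {}"
  obtains g where "continuous_map X euclideanreal g"
    "\<And>p r. p \<in> E \<Longrightarrow> r > 0 \<Longrightarrow> {x \<in> topspace X. r \<le> g x} \<notin> p"
    "\<And>p r. p \<in> F \<Longrightarrow> r < 1 \<Longrightarrow> {x \<in> topspace X. g x \<le> r} \<notin> p"
proof -
  have cl': "closedin (stone_cech X) E" "closedin (stone_cech X) F"
    using closedin_trans_full[OF _ cl] E F sc_remainder_subtopology[of X] by simp_all
  have "normal_space (stone_cech X)"
    using compact_space_stone_cech Hausdorff_space_stone_cech
    by (intro compact_Hausdorff_or_regular_imp_normal_space) auto
  then obtain f where f: "continuous_map (stone_cech X) euclideanreal f" "f ` E \<subseteq> {0}" "f ` F \<subseteq> {1}"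
    using Urysohn_lemma_alt[of "stone_cech X" E F 0 1] cl' EF unfolding disjnt_def by metis
  define g where "g = f \<circ> sc_embed X"
  have emb: "continuous_map X (stone_cech X) (sc_embed X)"
    using homeomorphic_imp_continuous_map[OF embedding_map_sc_embed[OF cr H, unfolded embedding_map_def]]
    by (simp add: continuous_map_in_subtopology)
  then have g: "continuous_map X euclideanreal g"
    unfolding g_def using f(1) by (rule continuous_map_compose)
  have ge: "{x \<in> topspace X. r \<le> g x} \<in> zero_sets X"
    and le: "{x \<in> topspace X. g x \<le> r} \<in> zero_sets X" for r
    using g by (intro zero_sets_le; simp)+
  have c: "closedin (stone_cech X) {p \<in> topspace (stone_cech X). f p \<in> S}" if "closed S" for S
    using closedin_continuous_map_preimage[OF f(1)] that by (simp flip: closed_closedin)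
  have 1: "f p \<ge> r" if "z_ultrafilter X p" "{x \<in> topspace X. r \<le> g x} \<in> p" for p r
  proof -
    \<comment> \<open>The closure of the embedded level set is the set of all ultrafilters having it
      as a member, so a bound on the closure is a bound on \<open>f p\<close>.\<close>
    have "sc_closure X {x \<in> topspace X. r \<le> g x} \<subseteq> {p \<in> topspace (stone_cech X). f p \<in> {r..}}"
      unfolding sc_closure_def
      by (rule closure_of_minimal[OF _ c])
         (use continuous_map_image_subset_topspace[OF emb] in \<open>auto simp: g_def\<close>)
    then show ?thesis using that by (auto simp: sc_closure_zero_set[OF ge])
  qed
  have 2: "f p \<le> r" if "z_ultrafilter X p" "{x \<in> topspace X. g x \<le> r} \<in> p" for p r
  proof -
    have "sc_closure X {x \<in> topspace X. g x \<le> r} \<subseteq> {p \<in> topspace (stone_cech X). f p \<in> {..r}}"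
      unfolding sc_closure_def
      by (rule closure_of_minimal[OF _ c])
         (use continuous_map_image_subset_topspace[OF emb] in \<open>auto simp: g_def\<close>)
    then show ?thesis using that by (auto simp: sc_closure_zero_set[OF le])
  qed
  have EFu: "z_ultrafilter X p" if "p \<in> E \<union> F" for p
    using that closedin_subset[OF cl'(1)] closedin_subset[OF cl'(2)]
    unfolding topspace_stone_cech by blast
  show thesis
  proof
    show "continuous_map X euclideanreal g" by (rule g)
    show "{x \<in> topspace X. r \<le> g x} \<notin> p" if "p \<in> E" "r > 0" for p r
      using 1[of p r] EFu[of p] that f(2) by force
    show "{x \<in> topspace X. g x \<le> r} \<notin> p" if "p \<in> F" "r < 1" for p r
      using 2[of p r] EFu[of p] that f(3) by force
  qed
qed

section \<open>The spaces of the theorem\<close>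

lemma infinite_NN: "infinite NN" unfolding NN_def by (rule infinite_Ici)

lemma MM_eq: "MM = top_of_set (NN \<times> {0..1})"
proof -
  have "discrete_topology NN = top_of_set NN"
    by (rule topology_eq[THEN iffD2]) (auto simp: openin_open open_discrete)
  then show ?thesis unfolding MM_def by simp
qed

lemma topspace_MM: "topspace MM = NN \<times> {0..1}"
  by (simp add: MM_eq)

lemma metrizable_space_MM: "metrizable_space MM"
  unfolding MM_def metrizable_space_prod_topology
  by (simp add: metrizable_space_discrete_topology metrizable_space_subtopology metrizable_space_euclidean)

lemma open_fiber: "open ({n::nat} \<times> (UNIV :: real set))"
  by (intro open_Times) (auto simp: open_discrete)

lemma closed_nat_set: "closed A" for A :: "nat set"
  unfolding closed_def by (rule open_discrete)

text \<open>The fibres are open, so a function may be chosen on each of them separately, namely the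
  distance to the fibre of \<open>Z\<close>.\<close>

lemma zero_sets_MM: "zero_sets MM = {Z. closed Z \<and> Z \<subseteq> NN \<times> {0..1}}"
proof (intro set_eqI iffI)
  have S: "closed (NN \<times> {0..1::real})"
    by (simp add: closed_Times closed_nat_set)
  fix Z assume Z: "Z \<in> zero_sets MM"
  then have "closedin (top_of_set (NN \<times> {0..1})) Z" using closedin_zero_set MM_eq by metis
  then show "Z \<in> {Z. closed Z \<and> Z \<subseteq> NN \<times> {0..1}}"
    using S closedin_closed_trans zero_sets_subset[OF Z] by (auto simp: topspace_MM)
next
  fix Z assume "Z \<in> {Z. closed Z \<and> Z \<subseteq> NN \<times> {0..1::real}}"
  then have Z: "closed Z" "Z \<subseteq> NN \<times> {0..1}" by auto
  define F where "F n = {t. (n, t) \<in> Z}" for n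
  have F: "closed (F n)" for n
  proof -
    have "F n = Pair n -` Z" by (auto simp: F_def)
    then show ?thesis using Z(1) by (auto intro!: closed_vimage continuous_intros)
  qed
  \<comment> \<open>\<open>infdist\<close> to the empty set is 0, so a fibre that misses
    \<open>Z\<close> needs its own nonzero value.\<close>
  define f where "f x = (if F (fst x) = {} then 1 else infdist (snd x) (F (fst x)))" for x :: "nat \<times> real"
  have "continuous_on (\<Union>n\<in>UNIV. {n} \<times> UNIV) f"
  proof (rule continuous_on_open_UN)
    show "continuous_on ({n} \<times> UNIV) f" for n
    proof (cases "F n = {}")
      case True
      then show ?thesis by (intro continuous_on_eq[OF continuous_on_const[of _ 1]]) (auto simp: f_def)
    next
      case False
      have "continuous_on ({n} \<times> UNIV) (\<lambda>x. infdist (snd x) (F n))"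
        by (intro continuous_intros)
      then show ?thesis by (rule continuous_on_eq) (use False in \<open>auto simp: f_def\<close>)
    qed
  qed (rule open_fiber)
  moreover have "(\<Union>n\<in>UNIV. {n} \<times> UNIV) = (UNIV :: (nat \<times> real) set)" by auto
  ultimately have "continuous_on (NN \<times> {0..1}) f" using continuous_on_subset by fastforce
  then have "continuous_map MM euclideanreal f" by (simp add: MM_eq)
  moreover have "x \<in> Z \<longleftrightarrow> f x = 0" for x
    using in_closed_iff_infdist_zero[OF F, of "fst x" "snd x"] by (cases x) (auto simp: f_def F_def)
  ultimately show "Z \<in> zero_sets MM"
    using Z(2) by (intro zero_setsI) (auto simp: topspace_MM)
qed

lemma zero_sets_discrete: "zero_sets (discrete_topology D) = Pow D"
proof (intro set_eqI iffI)
  show "Z \<in> Pow D" if "Z \<in> zero_sets (discrete_topology D)" for Z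
    using zero_sets_subset[OF that] by simp
  show "Z \<in> zero_sets (discrete_topology D)" if "Z \<in> Pow D" for Z
    by (rule zero_setsI[where f="\<lambda>x. if x \<in> Z then 0 else 1"]) (use that in auto)
qed

text \<open>The compact subsets of a discrete space are the finite ones, and an ultrafilter with a
  compact member is fixed; conversely a fixed one contains a singleton.\<close>

lemma topspace_Nstar:
  "u \<in> topspace Nstar \<longleftrightarrow> z_ultrafilter (discrete_topology NN) u \<and> (\<forall>s\<in>u. infinite s)"
proof -
  have "infinite s" if u: "z_ultrafilter (discrete_topology NN) u"
    "u \<notin> sc_embed (discrete_topology NN) ` NN" and s: "s \<in> u" for s
  proof
    assume "finite s"
    then have "compactin (discrete_topology NN) s"
      using z_ultrafilterD(1)[OF u(1)] s by (auto simp: zero_sets_discrete compactin_discrete_topology)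
    then obtain n where "n \<in> s" "u = sc_embed (discrete_topology NN) n"
      using z_ultrafilter_compactin_fixed[OF u(1) s] by blast
    then show False using u z_ultrafilterD(1)[OF u(1)] s by (auto simp: zero_sets_discrete)
  qed
  moreover have "u \<notin> sc_embed (discrete_topology NN) ` NN" if inf: "\<forall>s\<in>u. infinite s"
  proof
    assume "u \<in> sc_embed (discrete_topology NN) ` NN"
    then obtain n where "n \<in> NN" "u = sc_embed (discrete_topology NN) n" by auto
    then have "{n} \<in> u" by (simp add: sc_embed_def zero_sets_discrete)
    then show False using inf by blast
  qed
  ultimately show ?thesis unfolding Nstar_def topspace_sc_remainder by auto
qed

lemma NstarD:
  assumes "u \<in> topspace Nstar"
  shows "s \<in> u \<Longrightarrow> s \<subseteq> NN" "NN \<in> u" "s \<in> u \<Longrightarrow> t \<in> u \<Longrightarrow> s \<inter> t \<in> u"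
    "s \<in> u \<Longrightarrow> s \<subseteq> t \<Longrightarrow> t \<subseteq> NN \<Longrightarrow> t \<in> u" "s \<in> u \<Longrightarrow> infinite s"
    "s \<subseteq> NN \<Longrightarrow> s \<notin> u \<longleftrightarrow> NN - s \<in> u" "s \<in> u \<Longrightarrow> s \<noteq> {}"
proof -
  have u: "z_ultrafilter (discrete_topology NN) u" "\<forall>s\<in>u. infinite s"
    using assms topspace_Nstar by auto
  note D = z_ultrafilterD[OF u(1)]
  show "s \<in> u \<Longrightarrow> s \<subseteq> NN" "NN \<in> u" "s \<in> u \<Longrightarrow> t \<in> u \<Longrightarrow> s \<inter> t \<in> u"
    "s \<in> u \<Longrightarrow> s \<subseteq> t \<Longrightarrow> t \<subseteq> NN \<Longrightarrow> t \<in> u" "s \<in> u \<Longrightarrow> infinite s" "s \<in> u \<Longrightarrow> s \<noteq> {}"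
    using D u(2) by (auto simp: zero_sets_discrete)
  show "s \<subseteq> NN \<Longrightarrow> s \<notin> u \<longleftrightarrow> NN - s \<in> u"
    using z_ultrafilter_prime[OF u(1), of s "NN - s"] D(3) D(4)[of s "NN - s"]
    by (auto simp: zero_sets_discrete)
qed

text \<open>The dichotomy \<open>ul\<close> makes the filter maximal: a larger one would contain
  some set together with its complement. It also yields \<open>NN \<in> u\<close>, as the empty set
  is not infinite.\<close>

lemma NstarI:
  assumes sub: "\<And>s. s \<in> u \<Longrightarrow> s \<subseteq> NN" and I: "\<And>s t. s \<in> u \<Longrightarrow> t \<in> u \<Longrightarrow> s \<inter> t \<in> u"
    and up: "\<And>s t. s \<in> u \<Longrightarrow> s \<subseteq> t \<Longrightarrow> t \<subseteq> NN \<Longrightarrow> t \<in> u" and inf: "\<And>s. s \<in> u \<Longrightarrow> infinite s"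
    and ul: "\<And>s. s \<subseteq> NN \<Longrightarrow> s \<in> u \<or> NN - s \<in> u"
  shows "u \<in> topspace Nstar"
  unfolding topspace_Nstar z_ultrafilter_def
proof (intro conjI allI impI ballI)
  show "z_filter (discrete_topology NN) u"
  proof (rule z_filterI)
    show "{} \<notin> u" using inf by blast
    then show "topspace (discrete_topology NN) \<in> u" using ul[of NN] by auto
    show "u \<subseteq> zero_sets (discrete_topology NN)" using sub unfolding zero_sets_discrete by blast
    show "A \<inter> B \<in> u" if "A \<in> u" "B \<in> u" for A B using that by (rule I)
    show "B \<in> u" if "A \<in> u" "B \<in> zero_sets (discrete_topology NN)" "A \<subseteq> B" for A B
      using up[of A B] that unfolding zero_sets_discrete by blast
  qed
  fix q assume q: "z_filter (discrete_topology NN) q \<and> u \<subseteq> q"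
  note D = z_filterD[OF conjunct1[OF q]]
  have "s \<in> u" if "s \<in> q" for s
  proof (rule ccontr)
    assume "s \<notin> u"
    then have "NN - s \<in> q" using ul[of s] D(1) that q by (auto simp: zero_sets_discrete)
    then have "s \<inter> (NN - s) \<in> q" using D(4) that by blast
    then show False using D(3) by simp
  qed
  then show "q = u" using q by blast
qed (use inf in blast)

lemma Nstar_eqI: "u \<in> topspace Nstar \<Longrightarrow> v \<in> topspace Nstar \<Longrightarrow> u \<subseteq> v \<Longrightarrow> u = v"
  unfolding topspace_Nstar z_ultrafilter_def by blast

text \<open>An ultrafilter extending the cofinite filter is free. Non-emptiness guarantees that the
  covers constructed below consist of infinitely many intervals.\<close>

lemma topspace_Nstar_nonempty: "topspace Nstar \<noteq> {}"
proof -
  define q where "q = {A. A \<subseteq> NN \<and> finite (NN - A)}"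
  have "z_filter (discrete_topology NN) q"
  proof (rule z_filterI)
    show "A \<inter> B \<in> q" if "A \<in> q" "B \<in> q" for A B
      using that by (auto simp: q_def Diff_Int)
    show "B \<in> q" if "A \<in> q" "B \<in> zero_sets (discrete_topology NN)" "A \<subseteq> B" for A B
      using that finite_subset[of "NN - B" "NN - A"] by (auto simp: q_def zero_sets_discrete)
  qed (use infinite_NN in \<open>auto simp: q_def zero_sets_discrete\<close>)
  then obtain u where u: "z_ultrafilter (discrete_topology NN) u" "q \<subseteq> u"
    by (rule z_ultrafilter_extends)
  note D = z_ultrafilterD[OF u(1)]
  have "infinite s" if s: "s \<in> u" for s
  proof
    assume "finite s"
    moreover have "NN - (NN - s) = s" using s D(1) by (auto simp: zero_sets_discrete)
    ultimately have "NN - s \<in> q" by (simp add: q_def)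
    then have "s \<inter> (NN - s) \<in> u" using D(4) s u(2) by blast
    then show False using D(3) by simp
  qed
  then show ?thesis using u(1) topspace_Nstar by blast
qed

lemma MM_initial_compact: "compactin MM ((NN \<inter> {..n}) \<times> {0..1})"
proof -
  have "compact ((NN \<inter> {..n}) \<times> {0..1::real})"
    by (intro compact_Times finite_imp_compact compact_Icc) auto
  then show ?thesis by (auto simp: MM_eq compactin_subtopology)
qed

lemma MM_tail_zero_set: "(NN \<inter> {n<..}) \<times> {0..1} \<in> zero_sets MM"
  by (auto simp: zero_sets_MM intro!: closed_Times closed_nat_set)

lemma MM_initial_zero_set: "(NN \<inter> {..n}) \<times> {0..1} \<in> zero_sets MM"
  by (auto simp: zero_sets_MM intro!: closed_Times closed_nat_set)

text \<open>The initial parts of \<open>MM\<close> are compact, so a free ultrafilter contains none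
  of them and by primeness contains every tail. Conversely a point of \<open>MM\<close> is missing
  from the tail beyond its own fibre.\<close>

lemma topspace_Mstar:
  "p \<in> topspace Mstar \<longleftrightarrow> z_ultrafilter MM p \<and> (\<forall>n. (NN \<inter> {n<..}) \<times> {0..1} \<in> p)"
proof (intro iffI conjI allI)
  assume "p \<in> topspace Mstar"
  then have p: "z_ultrafilter MM p" "p \<notin> sc_embed MM ` topspace MM"
    unfolding Mstar_def topspace_sc_remainder by auto
  show "z_ultrafilter MM p" by (rule p)
  fix n
  have "(NN \<inter> {..n}) \<times> {0..1} \<notin> p"
  proof
    assume "(NN \<inter> {..n}) \<times> {0..1} \<in> p"
    then obtain x where "x \<in> (NN \<inter> {..n}) \<times> {0..1}" "p = sc_embed MM x"
      using z_ultrafilter_compactin_fixed[OF p(1) _ MM_initial_compact] by metis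
    then show False using p(2) by (auto simp: topspace_MM)
  qed
  moreover have "topspace MM \<subseteq> (NN \<inter> {..n}) \<times> {0..1} \<union> (NN \<inter> {n<..}) \<times> {0..1}"
    by (auto simp: topspace_MM)
  ultimately show "(NN \<inter> {n<..}) \<times> {0..1} \<in> p"
    using z_ultrafilter_prime[OF p(1) MM_initial_zero_set MM_tail_zero_set] by blast
next
  assume p: "z_ultrafilter MM p \<and> (\<forall>n. (NN \<inter> {n<..}) \<times> {0..1} \<in> p)"
  have "p \<noteq> sc_embed MM x" for x
  proof
    assume "p = sc_embed MM x"
    moreover have "(NN \<inter> {fst x<..}) \<times> {0..1} \<in> p" using p by blast
    ultimately show False by (auto simp: sc_embed_def)
  qed
  then show "p \<in> topspace Mstar"
    using p unfolding Mstar_def topspace_sc_remainder by blast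
qed

lemma closedin_Mstar: "closedin (stone_cech MM) (topspace Mstar)"
  unfolding Mstar_def
proof (rule closedin_sc_remainder)
  show "range (\<lambda>n. (NN \<inter> {n<..}) \<times> {0..1}) \<subseteq> zero_sets MM" using MM_tail_zero_set by blast
  show "topspace (sc_remainder MM) =
      {p. z_ultrafilter MM p \<and> range (\<lambda>n. (NN \<inter> {n<..}) \<times> {0..1}) \<subseteq> p}"
    using topspace_Mstar unfolding Mstar_def by blast
qed

lemma closedin_Nstar: "closedin (stone_cech (discrete_topology NN)) (topspace Nstar)"
  unfolding Nstar_def
proof (rule closedin_sc_remainder)
  let ?T = "{s. s \<subseteq> NN \<and> finite (NN - s)}"
  show "?T \<subseteq> zero_sets (discrete_topology NN)" by (auto simp: zero_sets_discrete)
  have "u \<in> topspace Nstar \<longleftrightarrow> z_ultrafilter (discrete_topology NN) u \<and> ?T \<subseteq> u" for u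
  proof
    assume u: "u \<in> topspace Nstar"
    then have "s \<in> u" if "s \<subseteq> NN" "finite (NN - s)" for s
      using NstarD(5,6)[OF u] that by metis
    then show "z_ultrafilter (discrete_topology NN) u \<and> ?T \<subseteq> u" using u topspace_Nstar by blast
  next
    assume u: "z_ultrafilter (discrete_topology NN) u \<and> ?T \<subseteq> u"
    note D = z_ultrafilterD[OF conjunct1[OF u]]
    have "infinite s" if s: "s \<in> u" for s
    proof
      assume "finite s"
      then have "NN - s \<in> u" using u by (auto intro: finite_subset[of _ s])
      then have "s \<inter> (NN - s) \<in> u" using D(4) s by blast
      then show False using D(3) by simp
    qed
    then show "u \<in> topspace Nstar" using u topspace_Nstar by blast
  qed
  then show "topspace (sc_remainder (discrete_topology NN)) =
      {p. z_ultrafilter (discrete_topology NN) p \<and> ?T \<subseteq> p}"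
    unfolding Nstar_def by blast
qed

lemma compact_space_Nstar: "compact_space Nstar"
  using compact_space_subtopology[OF closedin_compact_space[OF compact_space_stone_cech closedin_Nstar]]
    sc_remainder_subtopology[of "discrete_topology NN"] unfolding Nstar_def by simp

lemma Hausdorff_space_Nstar: "Hausdorff_space Nstar" and Hausdorff_space_Mstar: "Hausdorff_space Mstar"
  unfolding Nstar_def Mstar_def by (rule Hausdorff_space_sc_remainder)+

lemma Mstar_separation:
  assumes "closedin Mstar E" "closedin Mstar F" "E \<inter> F = {}"
  obtains g where "continuous_on (NN \<times> {0..1}) g"
    "\<And>p r. p \<in> E \<Longrightarrow> r > 0 \<Longrightarrow> {x \<in> NN \<times> {0..1}. r \<le> g x} \<notin> p"
    "\<And>p r. p \<in> F \<Longrightarrow> r < 1 \<Longrightarrow> {x \<in> NN \<times> {0..1}. g x \<le> (r::real)} \<notin> p"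
proof (rule sc_remainder_separation[of MM E F])
  show "completely_regular_space MM" "Hausdorff_space MM"
    using metrizable_space_MM
    by (simp_all add: metrizable_imp_completely_regular_space metrizable_imp_Hausdorff_space)
  show "closedin (stone_cech MM) (topspace (sc_remainder MM))"
    "closedin (sc_remainder MM) E" "closedin (sc_remainder MM) F" "E \<inter> F = {}"
    using closedin_Mstar assms unfolding Mstar_def by simp_all
  fix g assume "continuous_map MM euclideanreal g"
    "\<And>p r. p \<in> E \<Longrightarrow> r > 0 \<Longrightarrow> {x \<in> topspace MM. r \<le> g x} \<notin> p"
    "\<And>p r. p \<in> F \<Longrightarrow> r < 1 \<Longrightarrow> {x \<in> topspace MM. g x \<le> r} \<notin> p"
  then show thesis using that[of g] unfolding topspace_MM by (simp add: MM_eq)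
qed

text \<open>A function on \<open>NN\<close> separates \<open>W\<close> from its complement, and its
  sublevel set at 1/2 is an index set deciding membership in \<open>W\<close>. Any level strictly
  between 0 and 1 would do. This turns the range of \<open>h\<close> into a selection of
  intervals.\<close>

lemma clopen_Nstar:
  assumes "openin Nstar W" "closedin Nstar W"
  obtains s where "s \<subseteq> NN" "\<And>w. w \<in> topspace Nstar \<Longrightarrow> w \<in> W \<longleftrightarrow> s \<in> w"
proof -
  let ?X = "discrete_topology NN"
  have cl: "closedin (sc_remainder ?X) W" "closedin (sc_remainder ?X) (topspace Nstar - W)"
    using assms unfolding Nstar_def by (auto intro: closedin_diff)
  obtain g :: "nat \<Rightarrow> real" where g: "\<And>p r. p \<in> W \<Longrightarrow> r > 0 \<Longrightarrow> {x \<in> NN. r \<le> g x} \<notin> p"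
    "\<And>p r. p \<in> topspace Nstar - W \<Longrightarrow> r < 1 \<Longrightarrow> {x \<in> NN. g x \<le> r} \<notin> p"
  proof (rule sc_remainder_separation[OF _ _ _ cl])
    show "completely_regular_space ?X" "Hausdorff_space ?X"
      by (simp_all add: completely_regular_space_discrete_topology Hausdorff_space_discrete_topology)
    show "closedin (stone_cech ?X) (topspace (sc_remainder ?X))"
      using closedin_Nstar unfolding Nstar_def .
    show "W \<inter> (topspace Nstar - W) = {}" by blast
  qed (auto simp: that)
  let ?s = "{x \<in> NN. g x \<le> 1/2}"
  have "w \<in> W \<longleftrightarrow> ?s \<in> w" if w: "w \<in> topspace Nstar" for w
  proof
    assume "w \<in> W"
    then have "{x \<in> NN. 1/2 \<le> g x} \<notin> w" by (rule g(1)) simp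
    then have "NN - {x \<in> NN. 1/2 \<le> g x} \<in> w" using NstarD(6)[OF w, of "{x \<in> NN. 1/2 \<le> g x}"] by blast
    then show "?s \<in> w" by (rule NstarD(4)[OF w]) auto
  next
    assume "?s \<in> w" then show "w \<in> W" using g(2)[of w "1/2"] w by auto
  qed
  then show thesis by (intro that[of ?s]) auto
qed

section \<open>Discrete families of compact sets\<close>

text \<open>Covers both interval families and the singletons of a selector. Local finiteness is
  expressed by the compact initial parts of \<open>MM\<close>, so that no neighbourhoods have to be
  handled.\<close>

definition compact_family :: "(nat \<Rightarrow> (nat \<times> real) set) \<Rightarrow> bool" where
  "compact_family F \<longleftrightarrow> (\<forall>m\<in>NN. F m \<noteq> {} \<and> compact (F m) \<and> F m \<subseteq> NN \<times> {0..1}) \<and>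
     disjoint_family_on F NN \<and> (\<forall>n. finite {m\<in>NN. F m \<inter> ({..n} \<times> UNIV) \<noteq> {}})"

text \<open>The image of \<open>p\<close> under the index map that sends all points of
  \<open>F m\<close> to \<open>m\<close>. For a compact family and \<open>p\<close> in
  \<open>Mstar\<close> it is a free ultrafilter as soon as the union of the family belongs to
  \<open>p\<close>.\<close>

definition family_trace :: "(nat \<Rightarrow> (nat \<times> real) set) \<Rightarrow> (nat \<times> real) set set \<Rightarrow> nat set set" where
  "family_trace F p = {s. s \<subseteq> NN \<and> (\<Union>m\<in>s. F m) \<in> p}"

lemma compact_familyD:
  assumes "compact_family F" "m \<in> NN"
  shows "F m \<noteq> {}" "compact (F m)" "F m \<subseteq> NN \<times> {0..1}"
  using assms unfolding compact_family_def by auto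

lemma compact_family_disjoint:
  "compact_family F \<Longrightarrow> m \<in> NN \<Longrightarrow> n \<in> NN \<Longrightarrow> z \<in> F m \<Longrightarrow> z \<in> F n \<Longrightarrow> m = n"
  unfolding compact_family_def disjoint_family_on_def by blast

lemma compact_family_finite:
  "compact_family F \<Longrightarrow> finite {m\<in>NN. F m \<inter> ({..n} \<times> UNIV) \<noteq> {}}"
  unfolding compact_family_def by simp

lemma Nstar_cofinite: "u \<in> topspace Nstar \<Longrightarrow> finite s \<Longrightarrow> s \<subseteq> NN \<Longrightarrow> NN - s \<in> u"
  using NstarD(5)[of u s] NstarD(6)[of u s] by blast

text \<open>The fibre through a point outside the union is a neighbourhood that meets only finitely
  many members, and their union is closed.\<close>

lemma family_Union_zero_set:
  assumes F: "compact_family F" and s: "s \<subseteq> NN"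
  shows "(\<Union>m\<in>s. F m) \<in> zero_sets MM"
proof -
  have "open (- (\<Union>m\<in>s. F m))"
  proof (subst open_subopen, intro ballI)
    fix z assume z: "z \<in> - (\<Union>m\<in>s. F m)"
    define K where "K = {m\<in>s. F m \<inter> ({..fst z} \<times> UNIV) \<noteq> {}}"
    have "finite K"
      using F s unfolding compact_family_def K_def
      by (auto intro: finite_subset[of _ "{m\<in>NN. F m \<inter> ({..fst z} \<times> UNIV) \<noteq> {}}"])
    moreover have "compact (F m)" if "m \<in> K" for m
      using compact_familyD(2)[OF F] that s K_def by auto
    ultimately have "closed (\<Union>m\<in>K. F m)" by (intro closed_UN ballI compact_imp_closed)
    then have "open ({fst z} \<times> UNIV - (\<Union>m\<in>K. F m))" using open_fiber by blast
    moreover have "z \<in> {fst z} \<times> UNIV - (\<Union>m\<in>K. F m)" using z K_def by (cases z) auto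
    moreover have "{fst z} \<times> UNIV - (\<Union>m\<in>K. F m) \<subseteq> - (\<Union>m\<in>s. F m)" unfolding K_def by auto
    ultimately show "\<exists>T. open T \<and> z \<in> T \<and> T \<subseteq> - (\<Union>m\<in>s. F m)"
      by (intro exI[of _ "{fst z} \<times> UNIV - (\<Union>m\<in>K. F m)"] conjI)
  qed
  then show ?thesis
    using compact_familyD(3)[OF F] s unfolding zero_sets_MM by (fastforce simp: closed_def)
qed

lemma Mstar_z_ultrafilter: "p \<in> topspace Mstar \<Longrightarrow> z_ultrafilter MM p"
  by (simp add: topspace_Mstar)

lemma MstarD:
  assumes "p \<in> topspace Mstar"
  shows "Z \<in> p \<Longrightarrow> Z \<in> zero_sets MM" "{} \<notin> p" "A \<in> p \<Longrightarrow> B \<in> p \<Longrightarrow> A \<inter> B \<in> p"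
    "A \<in> p \<Longrightarrow> B \<in> zero_sets MM \<Longrightarrow> A \<subseteq> B \<Longrightarrow> B \<in> p"
    "A \<in> zero_sets MM \<Longrightarrow> B \<in> zero_sets MM \<Longrightarrow> A \<union> B \<in> p \<longleftrightarrow> A \<in> p \<or> B \<in> p"
    "NN \<times> {0..1} \<in> p"
proof -
  note u = Mstar_z_ultrafilter[OF assms]
  show "Z \<in> p \<Longrightarrow> Z \<in> zero_sets MM" using z_ultrafilterD(1)[OF u] by (rule subsetD)
  show "{} \<notin> p" by (rule z_ultrafilterD(3)[OF u])
  show "A \<in> p \<Longrightarrow> B \<in> p \<Longrightarrow> A \<inter> B \<in> p" by (rule z_ultrafilterD(4)[OF u])
  show "A \<in> p \<Longrightarrow> B \<in> zero_sets MM \<Longrightarrow> A \<subseteq> B \<Longrightarrow> B \<in> p" by (rule z_ultrafilterD(5)[OF u])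
  show "A \<in> zero_sets MM \<Longrightarrow> B \<in> zero_sets MM \<Longrightarrow> A \<union> B \<in> p \<longleftrightarrow> A \<in> p \<or> B \<in> p"
    by (rule z_ultrafilter_Un_iff[OF u])
  show "NN \<times> {0..1} \<in> p" using z_ultrafilterD(2)[OF u] by (simp add: topspace_MM)
qed

text \<open>Disjointness turns an intersection of two unions into the union over the common indices,
  primeness of \<open>p\<close> gives the dichotomy, and a finite index set would give
  \<open>p\<close> a compact member, making \<open>p\<close> fixed.\<close>

lemma family_trace_Nstar:
  assumes F: "compact_family F" and p: "p \<in> topspace Mstar" and U: "(\<Union>m\<in>NN. F m) \<in> p"
  shows "family_trace F p \<in> topspace Nstar"
proof (rule NstarI)
  fix s t assume s: "s \<in> family_trace F p"
  then have s': "s \<subseteq> NN" "(\<Union>m\<in>s. F m) \<in> p" by (auto simp: family_trace_def)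
  show "s \<subseteq> NN" by (rule s')
  show "s \<inter> t \<in> family_trace F p" if "t \<in> family_trace F p"
  proof -
    have t: "t \<subseteq> NN" "(\<Union>m\<in>t. F m) \<in> p" using that by (auto simp: family_trace_def)
    have "(\<Union>m\<in>s. F m) \<inter> (\<Union>m\<in>t. F m) = (\<Union>m\<in>s \<inter> t. F m)"
      using compact_family_disjoint[OF F] s'(1) t(1) by blast
    then show ?thesis using MstarD(3)[OF p s'(2) t(2)] s'(1) by (auto simp: family_trace_def)
  qed
  show "t \<in> family_trace F p" if "s \<subseteq> t" "t \<subseteq> NN"
    using MstarD(4)[OF p s'(2) family_Union_zero_set[OF F that(2)]] that
    by (auto simp: family_trace_def)
  show "infinite s"
  proof
    assume "finite s"
    then have "compact (\<Union>m\<in>s. F m)" using compact_familyD(2)[OF F] s'(1) by (intro compact_UN) auto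
    moreover have "(\<Union>m\<in>s. F m) \<subseteq> NN \<times> {0..1}" using compact_familyD(3)[OF F] s'(1) by blast
    ultimately have "compactin MM (\<Union>m\<in>s. F m)" by (simp add: MM_eq compactin_subtopology)
    then obtain x where "x \<in> (\<Union>m\<in>s. F m)" "p = sc_embed MM x"
      using z_ultrafilter_compactin_fixed[OF Mstar_z_ultrafilter[OF p] s'(2)] by blast
    moreover from this have "x \<in> topspace MM"
      using \<open>(\<Union>m\<in>s. F m) \<subseteq> NN \<times> {0..1}\<close> topspace_MM by blast
    ultimately show False using p unfolding Mstar_def topspace_sc_remainder by blast
  qed
next
  fix s assume s: "s \<subseteq> NN"
  then have "(\<Union>m\<in>s. F m) \<union> (\<Union>m\<in>NN - s. F m) = (\<Union>m\<in>NN. F m)" by blast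
  then show "s \<in> family_trace F p \<or> NN - s \<in> family_trace F p"
    using MstarD(5)[OF p family_Union_zero_set[OF F s] family_Union_zero_set[OF F, of "NN - s"]] U s
    by (auto simp: family_trace_def)
qed

text \<open>The trace of a point of the \<open>u\<close>-limit contains \<open>u\<close>, hence
  equals it by maximality. The point is free because \<open>u\<close> is free and only finitely many
  members meet an initial part. In this form limits along different ultrafilters are visibly
  disjoint.\<close>

lemma u_lim_family:
  assumes F: "compact_family F" and u: "u \<in> topspace Nstar"
  shows "u_lim u F = {p \<in> topspace Mstar. (\<Union>m\<in>NN. F m) \<in> p \<and> family_trace F p = u}"
proof -
  have z: "(\<Union>m\<in>s. F m) \<in> zero_sets MM" if "s \<in> u" for s
    using family_Union_zero_set[OF F] NstarD(1)[OF u that] by blast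
  have "u_lim u F = {p. z_ultrafilter MM p \<and> (\<forall>s\<in>u. (\<Union>m\<in>s. F m) \<in> p)}"
    unfolding u_lim_def using sc_closure_zero_set[OF z] NstarD(2)[OF u] by auto
  also have "\<dots> = {p \<in> topspace Mstar. (\<Union>m\<in>NN. F m) \<in> p \<and> family_trace F p = u}"
  proof (rule subset_antisym; intro subsetI CollectI conjI)
    fix p assume "p \<in> {p. z_ultrafilter MM p \<and> (\<forall>s\<in>u. (\<Union>m\<in>s. F m) \<in> p)}"
    then have p: "z_ultrafilter MM p" "\<And>s. s \<in> u \<Longrightarrow> (\<Union>m\<in>s. F m) \<in> p" by auto
    show pM: "p \<in> topspace Mstar"
      unfolding topspace_Mstar
    proof (intro conjI allI)
      fix n
      let ?s = "{m\<in>NN. F m \<inter> ({..n} \<times> UNIV) \<noteq> {}}"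
      have "NN - ?s \<in> u" using compact_family_finite[OF F] by (intro Nstar_cofinite[OF u]) auto
      then have "(\<Union>m\<in>NN - ?s. F m) \<in> p" by (rule p)
      moreover have "(\<Union>m\<in>NN - ?s. F m) \<subseteq> (NN \<inter> {n<..}) \<times> {0..1}"
        using compact_familyD(3)[OF F] by fastforce
      ultimately show "(NN \<inter> {n<..}) \<times> {0..1} \<in> p"
        using z_ultrafilterD(5)[OF p(1)] MM_tail_zero_set by blast
    qed (rule p)
    show U: "(\<Union>m\<in>NN. F m) \<in> p" by (rule p) (rule NstarD(2)[OF u])
    have "u \<subseteq> family_trace F p"
      using p(2) NstarD(1)[OF u] by (auto simp: family_trace_def)
    then show "family_trace F p = u"
      using Nstar_eqI[OF u family_trace_Nstar[OF F pM U]] by simp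
  next
    fix p assume p: "p \<in> {p \<in> topspace Mstar. (\<Union>m\<in>NN. F m) \<in> p \<and> family_trace F p = u}"
    then show "\<forall>s\<in>u. (\<Union>m\<in>s. F m) \<in> p" by (auto simp: family_trace_def)
    show "z_ultrafilter MM p" using p Mstar_z_ultrafilter by simp
  qed
  finally show ?thesis .
qed

text \<open>The preimage of the basic open set given by \<open>s\<close> consists of the points that
  omit the union of the members with index in \<open>s\<close>.\<close>

lemma continuous_family_trace:
  assumes F: "compact_family F"
  shows "continuous_map (subtopology Mstar {p. (\<Union>m\<in>NN. F m) \<in> p}) Nstar (family_trace F)"
  unfolding continuous_map_def
proof (intro conjI allI impI)
  let ?X = "subtopology Mstar {p. (\<Union>m\<in>NN. F m) \<in> p}"
  have t: "topspace ?X = {p \<in> topspace Mstar. (\<Union>m\<in>NN. F m) \<in> p}" by auto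
  show "family_trace F \<in> topspace ?X \<rightarrow> topspace Nstar"
    unfolding t using family_trace_Nstar[OF F] by auto
  fix U assume U: "openin Nstar U"
  show "openin ?X {p \<in> topspace ?X. family_trace F p \<in> U}"
  proof (subst openin_subopen, intro ballI)
    fix p assume p: "p \<in> {p \<in> topspace ?X. family_trace F p \<in> U}"
    then obtain s where s: "s \<in> zero_sets (discrete_topology NN)" "s \<notin> family_trace F p"
      "{q \<in> topspace Nstar. s \<notin> q} \<subseteq> U"
      using openin_sc_remainder_base[OF U[unfolded Nstar_def]] unfolding Nstar_def by blast
    have s': "s \<subseteq> NN" using s(1) by (auto simp: zero_sets_discrete)
    let ?T = "{q \<in> topspace Mstar. (\<Union>m\<in>s. F m) \<notin> q} \<inter> {p. (\<Union>m\<in>NN. F m) \<in> p}"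
    have "openin ?X ?T"
      using openin_sc_remainder_basic[OF family_Union_zero_set[OF F s']]
      unfolding openin_subtopology Mstar_def by blast
    moreover have "p \<in> ?T" using p s(2) s' by (auto simp: family_trace_def)
    moreover have "?T \<subseteq> {p \<in> topspace ?X. family_trace F p \<in> U}"
    proof
      fix q assume q: "q \<in> ?T"
      then have "family_trace F q \<in> topspace Nstar" using family_trace_Nstar[OF F] by blast
      moreover have "s \<notin> family_trace F q" using q by (auto simp: family_trace_def)
      ultimately show "q \<in> {p \<in> topspace ?X. family_trace F p \<in> U}" using s(3) q by auto
    qed
    ultimately show "\<exists>T. openin ?X T \<and> p \<in> T \<and> T \<subseteq> {p \<in> topspace ?X. family_trace F p \<in> U}"
      by blast
  qed
qed

section \<open>Limits of sequences of points\<close>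

lemma compact_family_points:
  assumes F: "compact_family F" and y: "\<And>m. m \<in> NN \<Longrightarrow> y m \<in> F m"
  shows "compact_family (\<lambda>m. {y m})"
  unfolding compact_family_def
proof (intro conjI ballI allI)
  show "{y m} \<subseteq> NN \<times> {0..1}" if "m \<in> NN" for m using y[OF that] compact_familyD(3)[OF F that] by blast
  show "disjoint_family_on (\<lambda>m. {y m}) NN"
    unfolding disjoint_family_on_def
  proof (intro ballI impI)
    fix m n assume "m \<in> NN" "n \<in> NN" "m \<noteq> n"
    then show "{y m} \<inter> {y n} = {}" using compact_family_disjoint[OF F, of m n "y m"] y[of m] y[of n] by auto
  qed
  show "finite {m \<in> NN. {y m} \<inter> ({..n} \<times> UNIV) \<noteq> {}}" for n
  proof (rule finite_subset)
    show "{m \<in> NN. {y m} \<inter> ({..n} \<times> UNIV) \<noteq> {}} \<subseteq> {m\<in>NN. F m \<inter> ({..n} \<times> UNIV) \<noteq> {}}"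
    proof
      fix m assume "m \<in> {m \<in> NN. {y m} \<inter> ({..n} \<times> UNIV) \<noteq> {}}"
      then have m: "m \<in> NN" and e: "y m \<in> F m \<inter> ({..n} \<times> UNIV)" using y[of m] by auto
      have "F m \<inter> ({..n} \<times> UNIV) \<noteq> {}"
      proof
        assume "F m \<inter> ({..n} \<times> UNIV) = {}"
        then show False using e by simp
      qed
      then show "m \<in> {m\<in>NN. F m \<inter> ({..n} \<times> UNIV) \<noteq> {}}" using m by simp
    qed
    show "finite {m\<in>NN. F m \<inter> ({..n} \<times> UNIV) \<noteq> {}}" by (rule compact_family_finite[OF F])
  qed
qed auto

text \<open>The image of \<open>u\<close> under \<open>y\<close> is already a maximal z-filter: if
  \<open>B\<close> is not in it, then \<open>y\<close> maps a set of \<open>u\<close> onto a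
  zero-set disjoint from \<open>B\<close>. Hence the limit is a single point and
  \<open>the_elem\<close> in \<open>point_lim\<close> is meaningful.\<close>

lemma u_lim_points:
  assumes F: "compact_family (\<lambda>m. {y m})" and u: "u \<in> topspace Nstar"
  shows "u_lim u (\<lambda>m. {y m}) = {{Z \<in> zero_sets MM. {m\<in>NN. y m \<in> Z} \<in> u}}"
proof -
  let ?q = "{Z \<in> zero_sets MM. {m\<in>NN. y m \<in> Z} \<in> u}"
  have eq: "(\<Union>m\<in>s. {y m}) = y ` s" for s by blast
  have inj: "m = n" if "m \<in> NN" "n \<in> NN" "y m = y n" for m n
    using compact_family_disjoint[OF F, of m n "y m"] that by simp
  have zs: "y ` s \<in> zero_sets MM" if "s \<subseteq> NN" for s
    using family_Union_zero_set[OF F that] unfolding eq .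
  have ys: "{m\<in>NN. y m \<in> y ` s} = s" if "s \<subseteq> NN" for s
    using that inj by blast
  have q: "z_filter MM ?q"
  proof (rule z_filterI)
    have "{m \<in> NN. y m \<in> topspace MM} = NN"
      using compact_familyD(3)[OF F] topspace_MM by blast
    then show "topspace MM \<in> ?q" using NstarD(2)[OF u] by (simp add: topspace_in_zero_sets)
    show "{} \<notin> ?q" using NstarD(7)[OF u] by auto
    show "A \<inter> B \<in> ?q" if "A \<in> ?q" "B \<in> ?q" for A B
    proof -
      have "{m \<in> NN. y m \<in> A \<inter> B} = {m \<in> NN. y m \<in> A} \<inter> {m \<in> NN. y m \<in> B}" by blast
      then show ?thesis using that NstarD(3)[OF u] zero_sets_Int by auto
    qed
    show "B \<in> ?q" if "A \<in> ?q" "B \<in> zero_sets MM" "A \<subseteq> B" for A B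
    proof -
      have "{m \<in> NN. y m \<in> A} \<subseteq> {m \<in> NN. y m \<in> B}" using that(3) by blast
      then show ?thesis using that NstarD(4)[OF u] by auto
    qed
  qed blast
  have yq: "y ` s \<in> ?q" if "s \<in> u" for s
    using zs ys NstarD(1)[OF u that] that by auto
  have max: "r = ?q" if r: "z_filter MM r" "?q \<subseteq> r" for r
  proof
    note D = z_filterD[OF r(1)]
    show "r \<subseteq> ?q"
    proof
      fix B assume B: "B \<in> r"
      have "{m\<in>NN. y m \<in> B} \<in> u"
      proof (rule ccontr)
        assume "{m\<in>NN. y m \<in> B} \<notin> u"
        then have "NN - {m\<in>NN. y m \<in> B} \<in> u" using NstarD(6)[OF u, of "{m\<in>NN. y m \<in> B}"] by blast
        then have "y ` (NN - {m\<in>NN. y m \<in> B}) \<in> r" using yq r(2) by blast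
        then have "y ` (NN - {m\<in>NN. y m \<in> B}) \<inter> B \<in> r" using D(4) B by blast
        moreover have "y ` (NN - {m\<in>NN. y m \<in> B}) \<inter> B = {}" by blast
        ultimately show False using D(3) by simp
      qed
      then show "B \<in> ?q" using B D(1) by blast
    qed
  qed (rule r)
  have qu: "z_ultrafilter MM ?q" unfolding z_ultrafilter_def using q max by blast
  have "u_lim u (\<lambda>m. {y m}) = {p. z_ultrafilter MM p \<and> (\<forall>s\<in>u. y ` s \<in> p)}"
    unfolding u_lim_def eq using sc_closure_zero_set[OF zs] NstarD(1,2)[OF u] by auto
  also have "\<dots> = {?q}"
  proof (intro subset_antisym subsetI)
    fix p assume p: "p \<in> {p. z_ultrafilter MM p \<and> (\<forall>s\<in>u. y ` s \<in> p)}"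
    then have pu: "z_ultrafilter MM p" by blast
    have "?q \<subseteq> p"
    proof
      fix Z assume Z: "Z \<in> ?q"
      then have "y ` {m\<in>NN. y m \<in> Z} \<in> p" using p by blast
      then show "Z \<in> p" using z_ultrafilterD(5)[OF pu] Z by blast
    qed
    then show "p \<in> {?q}" using max[of p] pu unfolding z_ultrafilter_def by blast
  next
    fix p assume "p \<in> {?q}"
    then show "p \<in> {p. z_ultrafilter MM p \<and> (\<forall>s\<in>u. y ` s \<in> p)}" using qu yq by simp
  qed
  finally show ?thesis .
qed

lemma point_lim_eq:
  assumes "compact_family (\<lambda>m. {y m})" "u \<in> topspace Nstar"
  shows "point_lim y u = {Z \<in> zero_sets MM. {m\<in>NN. y m \<in> Z} \<in> u}"
  unfolding point_lim_def u_lim_points[OF assms] by simp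

lemma point_lim_Mstar:
  assumes "compact_family (\<lambda>m. {y m})" "u \<in> topspace Nstar"
  shows "point_lim y u \<in> topspace Mstar"
  using u_lim_family[OF assms] u_lim_points[OF assms] point_lim_eq[OF assms] by blast

lemma point_lim_in_u_lim:
  assumes F: "compact_family F" and u: "u \<in> topspace Nstar" and y: "\<And>m. m \<in> NN \<Longrightarrow> y m \<in> F m"
  shows "point_lim y u \<in> u_lim u F"
proof -
  note c = compact_family_points[OF F y]
  have "{m \<in> NN. y m \<in> (\<Union>n\<in>s. F n)} = s" if "s \<subseteq> NN" for s
    using compact_family_disjoint[OF F] y that by blast
  then have *: "(\<Union>n\<in>s. F n) \<in> point_lim y u \<longleftrightarrow> s \<in> u" if "s \<subseteq> NN" for s
    using that family_Union_zero_set[OF F] by (simp add: point_lim_eq[OF c u])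
  then have "family_trace F (point_lim y u) = u"
    using NstarD(1)[OF u] by (auto simp: family_trace_def)
  then show ?thesis
    unfolding u_lim_family[OF F u] using * NstarD(2)[OF u] point_lim_Mstar[OF c u] by blast
qed

text \<open>The index ultrafilter is the trace of \<open>p\<close> on the singletons
  \<open>{y m}\<close>, and the limit along it has no other point.\<close>

lemma point_lim_unique:
  assumes F: "compact_family (\<lambda>m. {y m})" and p: "p \<in> topspace Mstar" "y ` NN \<in> p"
  obtains u where "u \<in> topspace Nstar" "p = point_lim y u"
proof -
  have "(\<Union>m\<in>NN. {y m}) \<in> p" using p(2) by (simp add: UNION_singleton_eq_range)
  then have "family_trace (\<lambda>m. {y m}) p \<in> topspace Nstar"
    "p \<in> u_lim (family_trace (\<lambda>m. {y m}) p) (\<lambda>m. {y m})"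
    using family_trace_Nstar[OF F p(1)] u_lim_family[OF F] p(1) by auto
  then show thesis using that u_lim_points[OF F] point_lim_eq[OF F] by auto
qed

lemma continuous_point_lim:
  assumes F: "compact_family (\<lambda>m. {y m})"
  shows "continuous_map Nstar Mstar (point_lim y)"
  unfolding continuous_map_def
proof (intro conjI allI impI)
  show "point_lim y \<in> topspace Nstar \<rightarrow> topspace Mstar" using point_lim_Mstar[OF F] by blast
  fix U assume U: "openin Mstar U"
  show "openin Nstar {u \<in> topspace Nstar. point_lim y u \<in> U}"
  proof (subst openin_subopen, intro ballI)
    fix u assume u: "u \<in> {u \<in> topspace Nstar. point_lim y u \<in> U}"
    then obtain Z where Z: "Z \<in> zero_sets MM" "Z \<notin> point_lim y u"
      "{q \<in> topspace Mstar. Z \<notin> q} \<subseteq> U"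
      using openin_sc_remainder_base[OF U[unfolded Mstar_def]] unfolding Mstar_def by blast
    let ?T = "{v \<in> topspace Nstar. {m\<in>NN. y m \<in> Z} \<notin> v}"
    have *: "Z \<notin> point_lim y v \<longleftrightarrow> {m\<in>NN. y m \<in> Z} \<notin> v" if "v \<in> topspace Nstar" for v
      using Z(1) by (simp add: point_lim_eq[OF F that])
    have "openin Nstar ?T"
      unfolding Nstar_def by (rule openin_sc_remainder_basic) (auto simp: zero_sets_discrete)
    moreover have "u \<in> ?T" using u * Z(2) by blast
    moreover have "?T \<subseteq> {u \<in> topspace Nstar. point_lim y u \<in> U}"
      using * Z(3) point_lim_Mstar[OF F] by blast
    ultimately show "\<exists>T. openin Nstar T \<and> u \<in> T \<and> T \<subseteq> {u \<in> topspace Nstar. point_lim y u \<in> U}"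
      by blast
  qed
qed

section \<open>Standard sequences\<close>

abbreviation interval_family :: "(nat \<Rightarrow> nat \<times> real) \<Rightarrow> (nat \<Rightarrow> nat \<times> real) \<Rightarrow> nat \<Rightarrow> (nat \<times> real) set"
  where "interval_family a b \<equiv> \<lambda>m. M_interval (a m) (b m)"

lemma M_interval_eq: "M_less a b \<Longrightarrow> M_interval a b = {fst a} \<times> {snd a..snd b}"
  unfolding M_interval_def M_less_def by auto

text \<open>In one direction finitely many neighbourhoods cover a compact initial part, and each
  meets finitely many sets; finitely many sets mean finitely many indices because disjoint non-empty
  members are distinct. Conversely the fibre of a point serves as its neighbourhood.\<close>

lemma standard_sequence_iff:
  "standard_sequence a b \<longleftrightarrow>
     (\<forall>m\<in>NN. a m \<in> NN \<times> {0..1} \<and> b m \<in> NN \<times> {0..1} \<and> M_less (a m) (b m)) \<and>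
     compact_family (interval_family a b)"
proof -
  let ?F = "interval_family a b"
  have "locally_finite_in MM (?F ` NN) \<longleftrightarrow> (\<forall>n. finite {m\<in>NN. ?F m \<inter> ({..n} \<times> UNIV) \<noteq> {}})"
    if ab: "\<forall>m\<in>NN. a m \<in> NN \<times> {0..1} \<and> b m \<in> NN \<times> {0..1} \<and> M_less (a m) (b m)"
      and dj: "disjoint_family_on ?F NN"
  proof
    have sub: "?F m \<subseteq> NN \<times> {0..1}" if "m \<in> NN" for m
      using ab that by (auto simp: M_interval_def)
    have inj: "inj_on ?F NN"
    proof (rule inj_onI)
      fix m n assume mn: "m \<in> NN" "n \<in> NN" "?F m = ?F n"
      have "a m \<in> ?F m" using ab mn(1) by (auto simp: M_interval_def M_less_def)
      then have "a m \<in> ?F m \<inter> ?F n" using mn(3) by blast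
      then show "m = n" using dj mn unfolding disjoint_family_on_def by blast
    qed
    { assume lf: "locally_finite_in MM (?F ` NN)"
      show "\<forall>n. finite {m\<in>NN. ?F m \<inter> ({..n} \<times> UNIV) \<noteq> {}}"
      proof
        fix n
        let ?K = "(NN \<inter> {..n}) \<times> {0..1::real}"
        have "\<forall>x\<in>?K. \<exists>V. openin MM V \<and> x \<in> V \<and> finite {U \<in> ?F ` NN. U \<inter> V \<noteq> {}}"
          using lf unfolding locally_finite_in_def topspace_MM by blast
        then obtain V where
          "\<forall>x\<in>?K. openin MM (V x) \<and> x \<in> V x \<and> finite {U \<in> ?F ` NN. U \<inter> V x \<noteq> {}}"
          unfolding bchoice_iff by (elim exE)
        then have V: "\<And>x. x \<in> ?K \<Longrightarrow> openin MM (V x)" "\<And>x. x \<in> ?K \<Longrightarrow> x \<in> V x"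
          "\<And>x. x \<in> ?K \<Longrightarrow> finite {U \<in> ?F ` NN. U \<inter> V x \<noteq> {}}" by blast+
        have "\<forall>W\<in>V ` ?K. openin MM W" using V(1) by simp
        moreover have "?K \<subseteq> \<Union>(V ` ?K)" 
        proof
          show "x \<in> \<Union>(V ` ?K)" if "x \<in> ?K" for x using that V(2)[OF that] by (rule UN_I)
        qed
        ultimately have "\<exists>\<F>. finite \<F> \<and> \<F> \<subseteq> V ` ?K \<and> ?K \<subseteq> \<Union>\<F>"
          using MM_initial_compact[of n] unfolding compactin_def by simp
        then obtain K where K: "finite K" "K \<subseteq> ?K" "?K \<subseteq> \<Union>(V ` K)"
          by (metis (no_types, lifting) finite_subset_image)
        have fin: "finite (\<Union>x\<in>K. {U \<in> ?F ` NN. U \<inter> V x \<noteq> {}})" using K(1,2) V(3) by blast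
        have "?F ` {m\<in>NN. ?F m \<inter> ({..n} \<times> UNIV) \<noteq> {}} \<subseteq> (\<Union>x\<in>K. {U \<in> ?F ` NN. U \<inter> V x \<noteq> {}})"
        proof
          fix U assume "U \<in> ?F ` {m\<in>NN. ?F m \<inter> ({..n} \<times> UNIV) \<noteq> {}}"
          then obtain m z where m: "m \<in> NN" "U = ?F m" "z \<in> ?F m" "z \<in> {..n} \<times> UNIV" by blast
          then have "z \<in> ?K" using sub[OF m(1)] by auto
          then obtain x where "x \<in> K" "z \<in> V x" using K(3) by blast
          then show "U \<in> (\<Union>x\<in>K. {U \<in> ?F ` NN. U \<inter> V x \<noteq> {}})" using m by blast
        qed
        then have "finite (?F ` {m\<in>NN. ?F m \<inter> ({..n} \<times> UNIV) \<noteq> {}})" using fin finite_subset by blast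
        then show "finite {m\<in>NN. ?F m \<inter> ({..n} \<times> UNIV) \<noteq> {}}"
          by (rule finite_imageD) (rule inj_on_subset[OF inj], blast)
      qed }
    assume fin: "\<forall>n. finite {m\<in>NN. ?F m \<inter> ({..n} \<times> UNIV) \<noteq> {}}"
    show "locally_finite_in MM (?F ` NN)"
      unfolding locally_finite_in_def
    proof (intro conjI ballI)
      show "\<Union>(?F ` NN) \<subseteq> topspace MM" using sub topspace_MM by blast
      fix x assume x: "x \<in> topspace MM"
      let ?V = "(NN \<times> {0..1}) \<inter> ({fst x} \<times> UNIV)"
      have "openin MM ?V" unfolding MM_eq using open_fiber by (rule openin_open_Int)
      moreover have "x \<in> ?V" using x topspace_MM by (cases x) auto
      moreover have "finite {U \<in> ?F ` NN. U \<inter> ?V \<noteq> {}}"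
      proof (rule finite_subset)
        show "{U \<in> ?F ` NN. U \<inter> ?V \<noteq> {}} \<subseteq> ?F ` {m\<in>NN. ?F m \<inter> ({..fst x} \<times> UNIV) \<noteq> {}}"
          by blast
        show "finite (?F ` {m\<in>NN. ?F m \<inter> ({..fst x} \<times> UNIV) \<noteq> {}})" using fin by blast
      qed
      ultimately show "\<exists>V. openin MM V \<and> x \<in> V \<and> finite {U \<in> ?F ` NN. U \<inter> V \<noteq> {}}" by blast
    qed
  qed
  moreover have "?F m \<noteq> {} \<and> compact (?F m) \<and> ?F m \<subseteq> NN \<times> {0..1}"
    if "a m \<in> NN \<times> {0..1} \<and> b m \<in> NN \<times> {0..1} \<and> M_less (a m) (b m)" for m
    using that by (auto simp: M_interval_eq M_less_def intro!: compact_Times)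
  ultimately show ?thesis
    unfolding standard_sequence_def compact_family_def topspace_MM by blast
qed

lemma standard_sequenceD:
  assumes "standard_sequence a b"
  shows "m \<in> NN \<Longrightarrow> a m \<in> NN \<times> {0..1}" "m \<in> NN \<Longrightarrow> b m \<in> NN \<times> {0..1}"
    "m \<in> NN \<Longrightarrow> M_less (a m) (b m)" "compact_family (interval_family a b)"
  using assms unfolding standard_sequence_iff by blast+

lemma compact_family_subset:
  assumes "compact_family F"
    and "\<And>m. m \<in> NN \<Longrightarrow> G m \<noteq> {} \<and> compact (G m) \<and> G m \<subseteq> F m"
  shows "compact_family G"
  unfolding compact_family_def
proof (intro conjI ballI allI)
  fix m assume m: "m \<in> NN"
  show "G m \<noteq> {}" "compact (G m)" using assms(2) m by auto
  show "G m \<subseteq> NN \<times> {0..1}" using assms(2)[OF m] compact_familyD(3)[OF assms(1) m] by blast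
next
  show "disjoint_family_on G NN"
    using assms
    unfolding compact_family_def disjoint_family_on_def by blast
  show "finite {m \<in> NN. G m \<inter> ({..n} \<times> UNIV) \<noteq> {}}" for n
  proof (rule finite_subset)
    show "{m \<in> NN. G m \<inter> ({..n} \<times> UNIV) \<noteq> {}} \<subseteq> {m\<in>NN. F m \<inter> ({..n} \<times> UNIV) \<noteq> {}}" using assms(2) by blast
    show "finite {m\<in>NN. F m \<inter> ({..n} \<times> UNIV) \<noteq> {}}" by (rule compact_family_finite[OF assms(1)])
  qed
qed

lemma standard_sequence_sub:
  assumes ab: "standard_sequence a b"
    and cd: "\<And>m. m \<in> NN \<Longrightarrow> M_less (c m) (d m) \<and> c m \<in> M_interval (a m) (b m) \<and> d m \<in> M_interval (a m) (b m)"
  shows "standard_sequence c d"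
  unfolding standard_sequence_iff
proof (intro conjI ballI)
  note F = standard_sequenceD(4)[OF ab]
  show "compact_family (interval_family c d)"
  proof (rule compact_family_subset[OF F])
    fix m assume "m \<in> NN"
    with cd[OF this] show "M_interval (c m) (d m) \<noteq> {} \<and> compact (M_interval (c m) (d m)) \<and>
        M_interval (c m) (d m) \<subseteq> M_interval (a m) (b m)"
      by (auto simp: M_interval_eq M_less_def intro!: compact_Times) (auto simp: M_interval_def)
  qed
  fix m assume m: "m \<in> NN"
  show "c m \<in> NN \<times> {0..1}" "d m \<in> NN \<times> {0..1}" "M_less (c m) (d m)"
    using cd[OF m] compact_familyD(3)[OF F m] by auto
qed

lemma selector_in_interval: "M_less a x \<Longrightarrow> M_less x b \<Longrightarrow> x \<in> M_interval a b"
  unfolding M_less_def M_interval_def by auto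

lemma selector_sequenceD:
  assumes "selector_sequence a b x" "m \<in> NN"
  shows "M_less (a m) (x m)" "M_less (x m) (b m)" "x m \<in> M_interval (a m) (b m)"
  using assms selector_in_interval unfolding selector_sequence_def by auto

lemma selector_compact_family:
  "standard_sequence a b \<Longrightarrow> selector_sequence a b x \<Longrightarrow> compact_family (\<lambda>m. {x m})"
  using compact_family_points standard_sequenceD(4) selector_sequenceD(3) by blast

lemma interval_lim_eq:
  assumes "standard_sequence a b" "u \<in> topspace Nstar"
  shows "interval_lim a b u = {p \<in> topspace Mstar. (\<Union>m\<in>NN. M_interval (a m) (b m)) \<in> p \<and>
    family_trace (interval_family a b) p = u}"
  unfolding interval_lim_def by (rule u_lim_family[OF standard_sequenceD(4)[OF assms(1)] assms(2)])

lemma interval_lim_trace: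
  assumes "standard_sequence a b" "p \<in> topspace Mstar" "(\<Union>m\<in>NN. M_interval (a m) (b m)) \<in> p"
  shows "family_trace (interval_family a b) p \<in> topspace Nstar"
    "p \<in> interval_lim a b (family_trace (interval_family a b) p)"
  using family_trace_Nstar[OF standard_sequenceD(4)[OF assms(1)] assms(2,3)] assms interval_lim_eq
  by auto

text \<open>A basic neighbourhood of \<open>p\<close> is given by a zero-set \<open>Z\<close>
  outside \<open>p\<close>. In every interval not inside \<open>Z\<close> an interior point off
  \<open>Z\<close> is chosen; the indices of these intervals form \<open>s\<close>, which lies in
  \<open>u\<close> since otherwise \<open>Z\<close> would contain a member of \<open>p\<close>. The
  same \<open>y\<close> works for every \<open>v\<close> containing \<open>s\<close>, which is what
  openness arguments in \<open>Nstar\<close> require.\<close>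

lemma selector_dense:
  assumes ab: "standard_sequence a b" and u: "u \<in> topspace Nstar" and p: "p \<in> interval_lim a b u"
    and U: "openin Mstar U" "p \<in> U"
  obtains y s where "selector_sequence a b y" "s \<in> u"
    "\<And>v. v \<in> topspace Nstar \<Longrightarrow> s \<in> v \<Longrightarrow> point_lim y v \<in> U"
proof -
  let ?F = "interval_family a b"
  note F = standard_sequenceD(4)[OF ab]
  have pM: "p \<in> topspace Mstar" and pU: "(\<Union>m\<in>NN. ?F m) \<in> p" and pu: "family_trace ?F p = u"
    using p interval_lim_eq[OF ab u] by auto
  obtain Z where Z: "Z \<in> zero_sets MM" "Z \<notin> p" "{q \<in> topspace Mstar. Z \<notin> q} \<subseteq> U"
    using openin_sc_remainder_base[OF U[unfolded Mstar_def]] unfolding Mstar_def by blast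
  have "\<exists>y. M_less (a m) y \<and> M_less y (b m) \<and> (\<not> ?F m \<subseteq> Z \<longrightarrow> y \<notin> Z)" if m: "m \<in> NN" for m
  proof -
    have ab': "fst (b m) = fst (a m)" "snd (a m) < snd (b m)"
      using standard_sequenceD(3)[OF ab m] by (auto simp: M_less_def)
    show ?thesis
    proof (cases "?F m \<subseteq> Z")
      \<comment> \<open>No point off \<open>Z\<close> exists; the midpoint is a default, and the
        index is left out of the set \<open>?s\<close> below.\<close>
      case True
      then show ?thesis
        using ab' by (intro exI[of _ "(fst (a m), (snd (a m) + snd (b m)) / 2)"]) (auto simp: M_less_def)
    next
      case False
      let ?T = "Pair (fst (a m)) -` Z"
      have "closed ?T" using Z(1) by (auto simp: zero_sets_MM intro!: closed_vimage continuous_intros)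
      \<comment> \<open>\<open>?T\<close> is closed, so if it contained the open interval it would
        contain the closed one.\<close>
      moreover have "closure {snd (a m)<..<snd (b m)} = {snd (a m)..snd (b m)}" using ab'(2) by simp
      moreover have "\<not> {snd (a m)..snd (b m)} \<subseteq> ?T"
        using False M_interval_eq[OF standard_sequenceD(3)[OF ab m]] by auto
      ultimately have "\<not> {snd (a m)<..<snd (b m)} \<subseteq> ?T" by (metis closure_minimal)
      then obtain t where "t \<in> {snd (a m)<..<snd (b m)}" "t \<notin> ?T" by blast
      then show ?thesis using ab' by (intro exI[of _ "(fst (a m), t)"]) (simp add: M_less_def)
    qed
  qed
  then obtain y where y: "\<And>m. m \<in> NN \<Longrightarrow> M_less (a m) (y m) \<and> M_less (y m) (b m)"
    "\<And>m. m \<in> NN \<Longrightarrow> \<not> ?F m \<subseteq> Z \<Longrightarrow> y m \<notin> Z" by metis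
  have yF: "y m \<in> ?F m" if "m \<in> NN" for m using y(1)[OF that] selector_in_interval by blast
  have sel: "selector_sequence a b y"
    unfolding selector_sequence_def topspace_MM using y(1) yF compact_familyD(3)[OF F] by blast
  let ?s = "{m\<in>NN. \<not> ?F m \<subseteq> Z}"
  have "?s \<in> u"
  proof (rule ccontr)
    assume "?s \<notin> u"
    then have "NN - ?s \<in> family_trace ?F p" using NstarD(6)[OF u, of ?s] pu by blast
    then have "(\<Union>m\<in>NN - ?s. ?F m) \<in> p" by (simp add: family_trace_def)
    moreover have "(\<Union>m\<in>NN - ?s. ?F m) \<subseteq> Z" by blast
    ultimately show False using MstarD(4)[OF pM _ Z(1)] Z(2) by blast
  qed
  moreover have "point_lim y v \<in> U" if v: "v \<in> topspace Nstar" "?s \<in> v" for v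
  proof -
    note c = compact_family_points[OF F yF]
    have "{m\<in>NN. y m \<in> Z} \<notin> v"
    proof
      assume "{m\<in>NN. y m \<in> Z} \<in> v"
      then have "{m\<in>NN. y m \<in> Z} \<inter> ?s \<in> v" using NstarD(3)[OF v(1)] v(2) by blast
      moreover have "{m\<in>NN. y m \<in> Z} \<inter> ?s = {}" using y(2) by blast
      ultimately show False using NstarD(7)[OF v(1)] by metis
    qed
    then have "Z \<notin> point_lim y v" by (simp add: point_lim_eq[OF c v(1)])
    then show ?thesis using Z(3) point_lim_Mstar[OF c v(1)] by blast
  qed
  ultimately show thesis using that sel by blast
qed

section \<open>Closedness and connectedness of interval limits\<close>

lemma closedin_Mstar_basic: "Z \<in> zero_sets MM \<Longrightarrow> closedin Mstar {p \<in> topspace Mstar. Z \<in> p}"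
  and openin_Mstar_basic: "Z \<in> zero_sets MM \<Longrightarrow> openin Mstar {p \<in> topspace Mstar. Z \<notin> p}"
  unfolding Mstar_def by (rule closedin_sc_remainder_basic openin_sc_remainder_basic, assumption)+

lemma closedin_interval_lim:
  assumes ab: "standard_sequence a b" and u: "u \<in> topspace Nstar"
  shows "closedin Mstar (interval_lim a b u)"
proof -
  let ?F = "interval_family a b"
  note F = standard_sequenceD(4)[OF ab]
  have z: "(\<Union>m\<in>s. ?F m) \<in> zero_sets MM" if "s \<in> u" for s
    using family_Union_zero_set[OF F] NstarD(1)[OF u that] by blast
  have "interval_lim a b u = (\<Inter>s\<in>u. {p \<in> topspace Mstar. (\<Union>m\<in>s. ?F m) \<in> p})"
  proof
    show "interval_lim a b u \<subseteq> (\<Inter>s\<in>u. {p \<in> topspace Mstar. (\<Union>m\<in>s. ?F m) \<in> p})"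
      unfolding interval_lim_eq[OF ab u] by (auto simp: family_trace_def)
    show "(\<Inter>s\<in>u. {p \<in> topspace Mstar. (\<Union>m\<in>s. ?F m) \<in> p}) \<subseteq> interval_lim a b u"
      unfolding interval_lim_def u_lim_def
      using sc_closure_zero_set[OF z] Mstar_z_ultrafilter by blast
  qed
  then show ?thesis
    using closedin_Mstar_basic[OF z] NstarD(2)[OF u] by (metis (no_types, lifting) closedin_INT empty_iff)
qed

text \<open>If two closed pieces split the limit, a function \<open>g\<close> separating them takes
  values on both sides of 1/2 within \<open>u\<close>-many intervals, and connectedness of each such
  interval gives a point where \<open>g\<close> is 1/2. The limit of these points belongs to both
  level sets, while every point of the interval limit avoids one of them.\<close>

lemma connectedin_interval_lim:
  assumes ab: "standard_sequence a b" and u: "u \<in> topspace Nstar"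
  shows "connectedin Mstar (interval_lim a b u)"
  unfolding connectedin_closedin
proof (intro conjI notI)
  let ?F = "interval_family a b" and ?I = "interval_lim a b u"
  note F = standard_sequenceD(4)[OF ab]
  show sub: "?I \<subseteq> topspace Mstar" using interval_lim_eq[OF ab u] by blast
  assume "\<exists>E1 E2. closedin Mstar E1 \<and> closedin Mstar E2 \<and> ?I \<subseteq> E1 \<union> E2 \<and>
    E1 \<inter> E2 \<inter> ?I = {} \<and> E1 \<inter> ?I \<noteq> {} \<and> E2 \<inter> ?I \<noteq> {}"
  then obtain E1 E2 where E: "closedin Mstar E1" "closedin Mstar E2" "?I \<subseteq> E1 \<union> E2"
    "E1 \<inter> E2 \<inter> ?I = {}" "E1 \<inter> ?I \<noteq> {}" "E2 \<inter> ?I \<noteq> {}" by blast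
  then obtain p1 p2 where p: "p1 \<in> E1" "p1 \<in> ?I" "p2 \<in> E2" "p2 \<in> ?I" by blast
  have cl: "closedin Mstar (E1 \<inter> ?I)" "closedin Mstar (E2 \<inter> ?I)" "(E1 \<inter> ?I) \<inter> (E2 \<inter> ?I) = {}"
    using E closedin_interval_lim[OF ab u] by (auto intro: closedin_Int)
  obtain g :: "nat \<times> real \<Rightarrow> real" where g: "continuous_on (NN \<times> {0..1}) g"
    "\<And>p r. p \<in> E1 \<inter> ?I \<Longrightarrow> r > 0 \<Longrightarrow> {x \<in> NN \<times> {0..1}. r \<le> g x} \<notin> p"
    "\<And>p r. p \<in> E2 \<inter> ?I \<Longrightarrow> r < 1 \<Longrightarrow> {x \<in> NN \<times> {0..1}. g x \<le> r} \<notin> p"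
    by (rule Mstar_separation[OF cl], rule that)
  define Z1 where "Z1 = {x \<in> NN \<times> {0..1}. g x \<le> 1/2}"
  define Z2 where "Z2 = {x \<in> NN \<times> {0..1}. 1/2 \<le> g x}"
  have gc: "continuous_map MM euclideanreal g" using g(1) by (simp add: MM_eq)
  have Z: "Z1 \<in> zero_sets MM" "Z2 \<in> zero_sets MM"
    unfolding Z1_def Z2_def topspace_MM[symmetric] using gc by (intro zero_sets_le; simp)+
  have n1: "Z2 \<notin> q" if "q \<in> E1 \<inter> ?I" for q unfolding Z2_def by (rule g(2)[OF that]) simp
  have n2: "Z1 \<notin> q" if "q \<in> E2 \<inter> ?I" for q unfolding Z1_def by (rule g(3)[OF that]) simp
  \<comment> \<open>If \<open>Z\<close> contained \<open>u\<close>-many of the intervals, it would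
    contain a member of \<open>q\<close> and so belong to \<open>q\<close>.\<close>
  have big: "{m\<in>NN. \<not> ?F m \<subseteq> Z} \<in> u" if "q \<in> ?I" "Z \<notin> q" "Z \<in> zero_sets MM" for q Z
  proof (rule ccontr)
    let ?s = "{m\<in>NN. \<not> ?F m \<subseteq> Z}"
    have q: "q \<in> topspace Mstar" "family_trace ?F q = u" using that interval_lim_eq[OF ab u] by auto
    assume "?s \<notin> u"
    then have "NN - ?s \<in> family_trace ?F q" using NstarD(6)[OF u, of ?s] q by blast
    then have "(\<Union>m\<in>NN - ?s. ?F m) \<in> q" by (simp add: family_trace_def)
    moreover have "(\<Union>m\<in>NN - ?s. ?F m) \<subseteq> Z" by blast
    ultimately show False using MstarD(4)[OF q(1) _ that(3)] that(2) by blast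
  qed
  let ?s = "{m\<in>NN. \<not> ?F m \<subseteq> Z2} \<inter> {m\<in>NN. \<not> ?F m \<subseteq> Z1}"
  have s: "?s \<in> u"
    using NstarD(3)[OF u big[OF p(2) n1 Z(2)] big[OF p(4) n2 Z(1)]] p by blast
  have "\<exists>y\<in>?F m. m \<in> ?s \<longrightarrow> y \<in> Z1 \<inter> Z2" if m: "m \<in> NN" for m
  proof (cases "m \<in> ?s")
    case False
    then show ?thesis using compact_familyD(1)[OF F m] by blast
  next
    case True
    have "connected (?F m)"
      unfolding M_interval_eq[OF standard_sequenceD(3)[OF ab m]] by (intro connected_Times) auto
    moreover have "NN \<times> {0..1} \<subseteq> Z1 \<union> Z2" unfolding Z1_def Z2_def by auto
    then have "?F m \<subseteq> Z1 \<union> Z2" using compact_familyD(3)[OF F m] by (rule order_trans[rotated])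
    moreover have "closed Z1" "closed Z2" using Z by (auto simp: zero_sets_MM)
    ultimately have "?F m \<inter> Z1 \<inter> Z2 \<noteq> {}"
      using True unfolding connected_closed by blast
    then show ?thesis by blast
  qed
  then obtain y where y: "\<And>m. m \<in> NN \<Longrightarrow> y m \<in> ?F m" "\<And>m. m \<in> ?s \<Longrightarrow> y m \<in> Z1 \<inter> Z2"
    by (metis (no_types, lifting) Int_iff mem_Collect_eq)
  have yI: "point_lim y u \<in> ?I"
    unfolding interval_lim_def using point_lim_in_u_lim[OF F u y(1)] .
  have "{m\<in>NN. y m \<in> Z1} \<in> u" "{m\<in>NN. y m \<in> Z2} \<in> u"
    using y(2) by (auto intro!: NstarD(4)[OF u s])
  then have "Z1 \<in> point_lim y u" "Z2 \<in> point_lim y u"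
    using Z by (simp_all add: point_lim_eq[OF compact_family_points[OF F y(1)] u])
  then show False using n1 n2 yI E(3) by blast
qed

section \<open>Cutting a standard sequence along a selector\<close>

lemma point_lim_in_interval:
  "standard_sequence a b \<Longrightarrow> selector_sequence a b y \<Longrightarrow> u \<in> topspace Nstar \<Longrightarrow>
    point_lim y u \<in> interval_lim a b u"
  unfolding interval_lim_def using point_lim_in_u_lim standard_sequenceD(4) selector_sequenceD(3) by blast

lemma interval_lim_disjoint:
  assumes "standard_sequence a b" "u \<in> topspace Nstar" "v \<in> topspace Nstar"
    "p \<in> interval_lim a b u" "p \<in> interval_lim a b v"
  shows "u = v"
  using assms(4,5) unfolding interval_lim_eq[OF assms(1,2)] interval_lim_eq[OF assms(1,3)] by auto

text \<open>The point is a limit of \<open>z\<close> along some \<open>v\<close>, and disjointness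
  of the interval limits gives \<open>v = u\<close>.\<close>

lemma point_lim_unique_interval:
  assumes ab: "standard_sequence a b" and z: "selector_sequence a b z" and u: "u \<in> topspace Nstar"
    and p: "p \<in> interval_lim a b u" "z ` NN \<in> p"
  shows "p = point_lim z u"
proof -
  have "p \<in> topspace Mstar" using p interval_lim_eq[OF ab u] by blast
  then obtain v where v: "v \<in> topspace Nstar" "p = point_lim z v"
    using point_lim_unique[OF selector_compact_family[OF ab z]] p(2) by blast
  then have "p \<in> interval_lim a b v" using point_lim_in_interval[OF ab z] by blast
  then show ?thesis using interval_lim_disjoint[OF ab u v(1) p(1)] v(2) by simp
qed

lemma selector_range_zero_set:
  assumes "standard_sequence a b" "selector_sequence a b z" "s \<subseteq> NN"
  shows "z ` s \<in> zero_sets MM"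
  using family_Union_zero_set[OF selector_compact_family[OF assms(1,2)] assms(3)]
  by (simp add: UNION_singleton_eq_range)

lemma standard_sequence_halves:
  assumes ab: "standard_sequence a b" and z: "selector_sequence a b z"
  shows "standard_sequence a z" "standard_sequence z b"
proof -
  have "a m \<in> M_interval (a m) (b m)" "b m \<in> M_interval (a m) (b m)" if "m \<in> NN" for m
    using standard_sequenceD(3)[OF ab that] by (auto simp: M_less_def M_interval_def)
  then show "standard_sequence a z" "standard_sequence z b"
    using selector_sequenceD[OF z] by (auto intro!: standard_sequence_sub[OF ab])
qed

abbreviation interval_union :: "(nat \<Rightarrow> nat \<times> real) \<Rightarrow> (nat \<Rightarrow> nat \<times> real) \<Rightarrow> (nat \<times> real) set" where
  "interval_union a b \<equiv> (\<Union>m\<in>NN. M_interval (a m) (b m))"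

lemma interval_union_zero_set: "standard_sequence a b \<Longrightarrow> interval_union a b \<in> zero_sets MM"
  by (intro family_Union_zero_set standard_sequenceD(4)) auto

lemma M_less_trans: "M_less a b \<Longrightarrow> M_less b c \<Longrightarrow> M_less a c"
  by (simp add: M_less_def)

lemma M_interval_endpoints: "M_less a b \<Longrightarrow> a \<in> M_interval a b" "M_less a b \<Longrightarrow> b \<in> M_interval a b"
  by (auto simp: M_interval_def M_less_def)

lemma M_interval_split:
  assumes "M_less a z" "M_less z b"
  shows "M_interval a z \<union> M_interval z b = M_interval a b" "M_interval a z \<inter> M_interval z b = {z}"
  using assms by (auto simp: M_interval_def M_less_def prod_eq_iff)

text \<open>A common point of a left and a right half lies in two of the original intervals, so
  disjointness forces the same index. These two zero-sets are the sides of the cut in the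
  connectedness arguments.\<close>

lemma interval_union_halves:
  assumes ab: "standard_sequence a b" and z: "selector_sequence a b z"
  shows "interval_union a z \<union> interval_union z b = interval_union a b"
    "interval_union a z \<inter> interval_union z b = z ` NN"
proof -
  note sp = M_interval_split[OF selector_sequenceD(1,2)[OF z]]
  show "interval_union a z \<union> interval_union z b = interval_union a b"
    using sp(1) by (simp flip: UN_Un_distrib)
  show "interval_union a z \<inter> interval_union z b = z ` NN"
  proof
    show "interval_union a z \<inter> interval_union z b \<subseteq> z ` NN"
    proof
      fix t assume "t \<in> interval_union a z \<inter> interval_union z b"
      then obtain m n where mn: "m \<in> NN" "n \<in> NN" "t \<in> M_interval (a m) (z m)" "t \<in> M_interval (z n) (b n)"
        by blast
      then have "t \<in> M_interval (a m) (b m)" "t \<in> M_interval (a n) (b n)"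
        using sp(1)[OF mn(1) mn(1)] sp(1)[OF mn(2) mn(2)] by blast+
      then have "m = n" using compact_family_disjoint[OF standard_sequenceD(4)[OF ab] mn(1,2)] by blast
      then show "t \<in> z ` NN" using mn sp(2)[OF mn(1) mn(1)] by blast
    qed
    show "z ` NN \<subseteq> interval_union a z \<inter> interval_union z b"
      using sp(2) by blast
  qed
qed

text \<open>The cut point lies in the limit of the right halves, as the limit of their endpoints, so
  limits of selectors of these halves come arbitrarily close to it; such selectors lie strictly
  beyond \<open>x m\<close>, hence in no left half.\<close>

lemma point_lim_near_right:
  assumes ab: "standard_sequence a b" and x: "selector_sequence a b x" and u: "u \<in> topspace Nstar"
    and U: "openin Mstar U" "point_lim x u \<in> U"
  obtains p where "p \<in> U" "p \<in> interval_lim a b u" "interval_union a x \<notin> p"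
proof -
  note xb = standard_sequence_halves(2)[OF ab x]
  note F = standard_sequenceD(4)[OF ab]
  have "point_lim x u \<in> interval_lim x b u"
    unfolding interval_lim_def
    by (rule point_lim_in_u_lim[OF standard_sequenceD(4)[OF xb] u])
       (rule M_interval_endpoints(1)[OF selector_sequenceD(2)[OF x]])
  then obtain y s where y: "selector_sequence x b y" "s \<in> u"
    "\<And>v. v \<in> topspace Nstar \<Longrightarrow> s \<in> v \<Longrightarrow> point_lim y v \<in> U"
    using selector_dense[OF xb u _ U] by metis
  have ya: "selector_sequence a b y"
    using y(1) x M_less_trans unfolding selector_sequence_def by blast
  have "{m\<in>NN. y m \<in> interval_union a x} = {}"
  proof (rule equals0I)
    fix m assume "m \<in> {m\<in>NN. y m \<in> interval_union a x}"
    then obtain n where mn: "m \<in> NN" "n \<in> NN" "y m \<in> M_interval (a n) (x n)" by blast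
    then have "y m \<in> M_interval (a n) (b n)"
      using M_interval_split(1)[OF selector_sequenceD(1,2)[OF x mn(2)]] by blast
    then have "m = n"
      using compact_family_disjoint[OF F mn(1,2)] selector_sequenceD(3)[OF ya mn(1)] by blast
    then show False using mn(3) selector_sequenceD(1)[OF y(1) mn(1)] by (auto simp: M_interval_def M_less_def)
  qed
  then have "{m\<in>NN. y m \<in> interval_union a x} \<notin> u" using NstarD(7)[OF u] by metis
  then have "interval_union a x \<notin> point_lim y u"
    unfolding point_lim_eq[OF selector_compact_family[OF ab ya] u] by blast
  then show thesis using that y(2,3) u point_lim_in_interval[OF ab ya u] by blast
qed

text \<open>Mirror image of \<open>point_lim_near_right\<close>, with selectors of the left
  halves.\<close>

lemma point_lim_near_left:
  assumes ab: "standard_sequence a b" and x: "selector_sequence a b x" and u: "u \<in> topspace Nstar"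
    and U: "openin Mstar U" "point_lim x u \<in> U"
  obtains p where "p \<in> U" "p \<in> interval_lim a b u" "interval_union x b \<notin> p"
proof -
  note ax = standard_sequence_halves(1)[OF ab x]
  note F = standard_sequenceD(4)[OF ab]
  have "point_lim x u \<in> interval_lim a x u"
    unfolding interval_lim_def
    by (rule point_lim_in_u_lim[OF standard_sequenceD(4)[OF ax] u])
       (rule M_interval_endpoints(2)[OF selector_sequenceD(1)[OF x]])
  then obtain y s where y: "selector_sequence a x y" "s \<in> u"
    "\<And>v. v \<in> topspace Nstar \<Longrightarrow> s \<in> v \<Longrightarrow> point_lim y v \<in> U"
    using selector_dense[OF ax u _ U] by metis
  have ya: "selector_sequence a b y"
    using y(1) x M_less_trans unfolding selector_sequence_def by blast
  have "{m\<in>NN. y m \<in> interval_union x b} = {}"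
  proof (rule equals0I)
    fix m assume "m \<in> {m\<in>NN. y m \<in> interval_union x b}"
    then obtain n where mn: "m \<in> NN" "n \<in> NN" "y m \<in> M_interval (x n) (b n)" by blast
    then have "y m \<in> M_interval (a n) (b n)"
      using M_interval_split(1)[OF selector_sequenceD(1,2)[OF x mn(2)]] by blast
    then have "m = n"
      using compact_family_disjoint[OF F mn(1,2)] selector_sequenceD(3)[OF ya mn(1)] by blast
    then show False using mn(3) selector_sequenceD(2)[OF y(1) mn(1)] by (auto simp: M_interval_def M_less_def)
  qed
  then have "{m\<in>NN. y m \<in> interval_union x b} \<notin> u" using NstarD(7)[OF u] by metis
  then have "interval_union x b \<notin> point_lim y u"
    unfolding point_lim_eq[OF selector_compact_family[OF ab ya] u] by blast
  then show thesis using that y(2,3) u point_lim_in_interval[OF ab ya u] by blast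
qed

text \<open>If the sequences differ on a set of \<open>u\<close>, the image of that set under
  \<open>y\<close> belongs to the common limit, yet \<open>z\<close> never enters it, since equal
  values in disjoint intervals have equal indices. The lemma reconciles different representatives of
  a point in \<open>cut_less\<close>.\<close>

lemma point_lim_eq_imp_eventually:
  assumes ab: "standard_sequence a b" and y: "selector_sequence a b y" and z: "selector_sequence a b z"
    and u: "u \<in> topspace Nstar" and eq: "point_lim y u = point_lim z u"
  shows "{m\<in>NN. y m = z m} \<in> u"
proof (rule ccontr)
  let ?t = "NN - {m\<in>NN. y m = z m}"
  assume "{m\<in>NN. y m = z m} \<notin> u"
  then have t: "?t \<in> u" using NstarD(6)[OF u, of "{m\<in>NN. y m = z m}"] by blast
  have Z: "y ` ?t \<in> zero_sets MM" by (rule selector_range_zero_set[OF ab y]) blast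
  have "?t \<subseteq> {m\<in>NN. y m \<in> y ` ?t}" by blast
  then have "{m\<in>NN. y m \<in> y ` ?t} \<in> u" by (rule NstarD(4)[OF u t]) blast
  then have "y ` ?t \<in> point_lim z u"
    unfolding eq[symmetric] point_lim_eq[OF selector_compact_family[OF ab y] u] using Z by blast
  then have "{m\<in>NN. z m \<in> y ` ?t} \<in> u"
    unfolding point_lim_eq[OF selector_compact_family[OF ab z] u] by blast
  moreover have "{m\<in>NN. z m \<in> y ` ?t} = {}"
  proof (rule equals0I)
    fix m assume "m \<in> {m\<in>NN. z m \<in> y ` ?t}"
    then obtain n where mn: "m \<in> NN" "n \<in> NN" "y n \<noteq> z n" "z m = y n" by blast
    have "m = n"
      using compact_family_disjoint[OF standard_sequenceD(4)[OF ab] mn(1,2)]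
        selector_sequenceD(3)[OF z mn(1)] selector_sequenceD(3)[OF y mn(2)] mn(4) by simp
    then show False using mn by simp
  qed
  ultimately show False using NstarD(7)[OF u] by metis
qed

text \<open>If \<open>r\<close> between \<open>p\<close> and \<open>q\<close> were missing from
  \<open>K\<close>, the left and right halves at a representative of \<open>r\<close> would split
  the connected set \<open>K\<close>: their only common point in the interval limit is
  \<open>r\<close>, and they catch \<open>p\<close> and \<open>q\<close> respectively.\<close>

lemma order_convex_connected:
  assumes ab: "standard_sequence a b" and u: "u \<in> topspace Nstar"
    and K: "connectedin Mstar K" "K \<subseteq> interval_lim a b u"
  shows "order_convex_cuts a b u (cut_points a b u \<inter> K)"
  unfolding order_convex_cuts_def
proof (intro conjI ballI impI)
  fix p q r assume p: "p \<in> cut_points a b u \<inter> K" and q: "q \<in> cut_points a b u \<inter> K"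
    and r: "r \<in> cut_points a b u" and less: "cut_less a b u p r \<and> cut_less a b u r q"
  obtain y z where y: "selector_sequence a b y" "p = point_lim y u" and z: "selector_sequence a b z"
    "r = point_lim z u" and yz: "{m\<in>NN. M_less (y m) (z m)} \<in> u"
    using less unfolding cut_less_def by blast
  obtain z' y' where z': "selector_sequence a b z'" "r = point_lim z' u" and y': "selector_sequence a b y'"
    "q = point_lim y' u" and z'y': "{m\<in>NN. M_less (z' m) (y' m)} \<in> u"
    using less unfolding cut_less_def by blast
  \<comment> \<open>The two inequalities may use different representatives of \<open>r\<close>;
    these agree on a set of \<open>u\<close>, so one cut serves both.\<close>
  have "{m\<in>NN. z' m = z m} \<in> u"
    using point_lim_eq_imp_eventually[OF ab z'(1) z(1) u] z(2) z'(2) by simp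
  then have zy': "{m\<in>NN. M_less (z' m) (y' m)} \<inter> {m\<in>NN. z' m = z m} \<in> u"
    using NstarD(3)[OF u z'y'] by blast
  let ?L = "interval_union a z" and ?R = "interval_union z b"
  note halves = standard_sequence_halves[OF ab z(1)]
  have LR: "?L \<in> zero_sets MM" "?R \<in> zero_sets MM" using halves interval_union_zero_set by auto
  have "{m\<in>NN. y m \<in> ?L} \<in> u"
  proof (rule NstarD(4)[OF u yz])
    have "y m \<in> M_interval (a m) (z m)" if "m \<in> NN" "M_less (y m) (z m)" for m
      using selector_in_interval selector_sequenceD(1)[OF y(1)] that by blast
    then show "{m\<in>NN. M_less (y m) (z m)} \<subseteq> {m\<in>NN. y m \<in> ?L}" by blast
  qed blast
  then have pL: "?L \<in> p" using LR y(2) by (simp add: point_lim_eq[OF selector_compact_family[OF ab y(1)] u])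
  have "{m\<in>NN. y' m \<in> ?R} \<in> u"
  proof (rule NstarD(4)[OF u zy'])
    have "y' m \<in> M_interval (z m) (b m)" if "m \<in> NN" "M_less (z' m) (y' m)" "z' m = z m" for m
      using selector_in_interval selector_sequenceD(2)[OF y'(1)] that by metis
    then show "{m\<in>NN. M_less (z' m) (y' m)} \<inter> {m\<in>NN. z' m = z m} \<subseteq> {m\<in>NN. y' m \<in> ?R}" by blast
  qed blast
  then have qR: "?R \<in> q" using LR y'(2) by (simp add: point_lim_eq[OF selector_compact_family[OF ab y'(1)] u])
  have KM: "j \<in> topspace Mstar" "interval_union a b \<in> j" if "j \<in> K" for j
    using that K(2) interval_lim_eq[OF ab u] by auto
  show "r \<in> cut_points a b u \<inter> K"
  proof (rule ccontr)
    assume rK: "r \<notin> cut_points a b u \<inter> K"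
    let ?E1 = "{j \<in> topspace Mstar. ?L \<in> j}" and ?E2 = "{j \<in> topspace Mstar. ?R \<in> j}"
    have "K \<subseteq> ?E1 \<union> ?E2"
      using KM MstarD(5)[OF _ LR] interval_union_halves(1)[OF ab z(1)] by auto
    moreover have "?E1 \<inter> ?E2 \<inter> K = {}"
    proof (rule equals0I)
      fix j assume j: "j \<in> ?E1 \<inter> ?E2 \<inter> K"
      then have "z ` NN \<in> j" using MstarD(3)[of j ?L ?R] interval_union_halves(2)[OF ab z(1)] by simp
      then have "j = r" using point_lim_unique_interval[OF ab z(1) u] j K(2) z(2) by blast
      then show False using rK r j by blast
    qed
    moreover have "p \<in> ?E1 \<inter> K" "q \<in> ?E2 \<inter> K" using p q pL qR KM by auto
    ultimately show False
      using K(1) closedin_Mstar_basic[OF LR(1)] closedin_Mstar_basic[OF LR(2)]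
      unfolding connectedin_closedin by blast
  qed
qed blast

section \<open>Covering closed subsets of the remainder by standard sequences\<close>

text \<open>The intervals are the components of \<open>{g \<le> 1/2}\<close> that meet
  \<open>{g \<le> 1/3}\<close>. The gap between the levels puts a neighbourhood of each point of the
  lower level into a single component; compactness then leaves finitely many components, none of
  them a single point. With one level alone there could be infinitely many or degenerate
  components.\<close>

lemma interval_cover:
  fixes g :: "real \<Rightarrow> real"
  assumes g: "continuous_on {0..1} g"
  obtains D where "finite D"
    "\<And>l r. (l, r) \<in> D \<Longrightarrow> 0 \<le> l \<and> l < r \<and> r \<le> 1 \<and> (\<forall>t\<in>{l..r}. g t \<le> 1/2)"
    "\<And>l r l' r' t. (l, r) \<in> D \<Longrightarrow> (l', r') \<in> D \<Longrightarrow> t \<in> {l..r} \<Longrightarrow> t \<in> {l'..r'} \<Longrightarrow> l = l' \<and> r = r'"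
    "\<And>t. t \<in> {0..1} \<Longrightarrow> g t \<le> 1/3 \<Longrightarrow> \<exists>l r. (l, r) \<in> D \<and> t \<in> {l..r}"
proof -
  define T where "T = {t\<in>{0..1}. g t \<le> 1/2}"
  define K where "K = {t\<in>{0..1}. g t \<le> 1/3}"
  have level: "compact {t\<in>{0..1}. g t \<le> c}" for c
  proof -
    have "{t\<in>{0..1}. g t \<le> c} = {0..1} \<inter> g -` {..c}" by auto
    then show ?thesis
      using continuous_closed_preimage[OF g closed_atLeastAtMost, of "{..c}"]
        compact_Int_closed[OF compact_Icc, of "{0..1} \<inter> g -` {..c}" 0 1]
      by (simp add: Int_absorb1)
  qed
  let ?comp = "connected_component_set T"
  have "\<exists>e>0. ball t e \<inter> {0..1} \<subseteq> T" if t: "t \<in> K" for t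
  proof -
    have t01: "t \<in> {0..1}" "g t \<le> 1/3" using t unfolding K_def by auto
    \<comment> \<open>1/6 is the gap between the levels 1/3 and 1/2.\<close>
    then obtain e where e: "e > 0" "\<And>s. s \<in> {0..1} \<Longrightarrow> dist s t < e \<Longrightarrow> dist (g s) (g t) < 1/6"
      using g unfolding continuous_on_iff by (metis divide_pos_pos zero_less_numeral zero_less_one)
    have "g s \<le> 1/2" if "s \<in> ball t e \<inter> {0..1}" for s
      using e(2)[of s] that t01(2) by (auto simp: dist_commute dist_real_def abs_if split: if_splits)
    then show ?thesis using e(1) unfolding T_def by blast
  qed
  then obtain e where e: "\<And>t. t \<in> K \<Longrightarrow> e t > 0" "\<And>t. t \<in> K \<Longrightarrow> ball t (e t) \<inter> {0..1} \<subseteq> T"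
    by metis
  have K01: "t \<in> {0..1}" if "t \<in> K" for t using that unfolding K_def by blast
  have ball: "ball t (e t) \<inter> {0..1} \<subseteq> ?comp t" if "t \<in> K" for t
    using K01[OF that] e[OF that]
    by (intro connected_component_maximal) (auto intro!: convex_connected convex_Int convex_ball)
  have eq: "?comp s = ?comp t" if "t \<in> K" "s \<in> ball t (e t)" "s \<in> {0..1}" for s t
    using ball[OF that(1)] that connected_component_eq[of s T t] by blast
  obtain K' where K': "K' \<subseteq> K" "finite K'" "K \<subseteq> (\<Union>t\<in>K'. ball t (e t))"
  proof (rule compactE_image[of K K "\<lambda>t. ball t (e t)"])
    show "compact K" using level unfolding K_def .
    show "K \<subseteq> (\<Union>t\<in>K. ball t (e t))" using e(1) by (meson UN_I centre_in_ball subsetI)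
  qed (auto intro: that)
  have "?comp ` K \<subseteq> ?comp ` K'"
  proof
    fix C assume "C \<in> ?comp ` K"
    then obtain s where s: "s \<in> K" "C = ?comp s" by blast
    then obtain t where "t \<in> K'" "s \<in> ball t (e t)" using K'(3) by blast
    then show "C \<in> ?comp ` K'" using eq[of t s] K'(1) K01[OF s(1)] s(2) by blast
  qed
  then have fin: "finite (?comp ` K)" using K'(2) finite_surj by blast
  have Icc: "\<exists>l r. C = {l..r}" if C: "C \<in> ?comp ` K" for C
  proof -
    obtain t where t: "C = ?comp t" using C by (rule imageE)
    have "compact T" using level unfolding T_def .
    then have "compact (T \<inter> C)"
      unfolding t by (intro compact_Int_closed closed_connected_component compact_imp_closed)
    then have "compact C" unfolding t using Int_absorb1[OF connected_component_subset] by metis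
    moreover have "connected C" unfolding t by simp
    ultimately show ?thesis using connected_compact_interval_1 by blast
  qed
  define D where "D = {(l, r). l \<le> r \<and> {l..r} \<in> ?comp ` K}"
  show thesis
  proof
    \<comment> \<open>A nonempty closed interval determines its endpoints, so \<open>D\<close> is no
      larger than the finite set of components.\<close>
    have "D \<subseteq> (\<lambda>C. (Inf C, Sup C)) ` ?comp ` K"
    proof
      fix d assume "d \<in> D"
      then obtain l r where d: "d = (l, r)" "l \<le> r" "{l..r} \<in> ?comp ` K" unfolding D_def by blast
      then have "d = (\<lambda>C. (Inf C, Sup C)) {l..r}" by simp
      then show "d \<in> (\<lambda>C. (Inf C, Sup C)) ` ?comp ` K" using d(3) by (rule image_eqI)
    qed
    then show "finite D" using fin finite_surj by blast
    show "0 \<le> l \<and> l < r \<and> r \<le> 1 \<and> (\<forall>t\<in>{l..r}. g t \<le> 1/2)" if lrD: "(l, r) \<in> D" for l r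
    proof -
      obtain t where lr: "l \<le> r" "t \<in> K" "{l..r} = ?comp t" using lrD unfolding D_def by blast
      have sub: "{l..r} \<subseteq> T" unfolding lr(3) by (rule connected_component_subset)
      have t: "t \<in> {0..1}" "e t > 0" using K01 e(1) lr(2) by auto
      \<comment> \<open>A second point of the component: a positive step shorter than
        \<open>e t\<close>, taken towards the farther endpoint so as to stay in the unit
        interval.\<close>
      define s where "s = (if t \<le> 1/2 then t + min (e t / 2) (1/2) else t - min (e t / 2) (1/2))"
      have "s \<in> ball t (e t) \<inter> {0..1}" "t \<in> ball t (e t) \<inter> {0..1}" "s \<noteq> t"
        using t unfolding s_def by (auto simp: dist_real_def min_def)
      then have "s \<in> {l..r}" "t \<in> {l..r}" "s \<noteq> t" using ball[OF lr(2)] lr(3) by blast+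
      then have "l < r" by auto
      moreover have "l \<in> T" "r \<in> T" using sub lr(1) by auto
      ultimately show ?thesis using sub unfolding T_def by auto
    qed
    show "l = l' \<and> r = r'" if D: "(l, r) \<in> D" "(l', r') \<in> D" "t \<in> {l..r}" "t \<in> {l'..r'}" for l r l' r' t
    proof -
      obtain s where s: "l \<le> r" "{l..r} = ?comp s" using D(1) unfolding D_def by blast
      obtain s' where s': "l' \<le> r'" "{l'..r'} = ?comp s'" using D(2) unfolding D_def by blast
      have "?comp t = ?comp s" "?comp t = ?comp s'"
        using connected_component_eq[of t T s] connected_component_eq[of t T s'] D(3,4) s(2) s'(2) by auto
      then have "{l..r} = {l'..r'}" using s s' by simp
      then show ?thesis using s(1) s'(1) by (simp add: Icc_eq_Icc)
    qed
    show "\<exists>l r. (l, r) \<in> D \<and> t \<in> {l..r}" if "t \<in> {0..1}" "g t \<le> 1/3" for t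
    proof -
      have t: "t \<in> K" using that unfolding K_def by blast
      then obtain l r where lr: "?comp t = {l..r}" using Icc by blast
      have "t \<in> ball t (e t) \<inter> {0..1}" using e(1)[OF t] that(1) by simp
      then have "t \<in> {l..r}" using ball[OF t] unfolding lr by (rule rev_subsetD)
      moreover from this have "(l, r) \<in> D" unfolding D_def using t lr by auto
      ultimately show ?thesis by blast
    qed
  qed
qed

text \<open>For \<open>g\<close> separating \<open>P\<close> at level 0 from \<open>Q\<close> at
  level 1, the intervals cover \<open>{g \<le> 1/3}\<close> fibre by fibre and stay inside
  \<open>{g \<le> 1/2}\<close>. The closed set \<open>D\<close> takes up the rest of
  \<open>MM\<close>, so that omitting \<open>D\<close> is an open condition under which a point is
  covered.\<close>

lemma covering_sequence:
  assumes P: "closedin Mstar P" "P \<noteq> {}" and Q: "closedin Mstar Q" and PQ: "P \<inter> Q = {}"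
  obtains c d D where "standard_sequence c d" "D \<in> zero_sets MM" "NN \<times> {0..1} \<subseteq> D \<union> interval_union c d"
    "\<And>p. p \<in> P \<Longrightarrow> D \<notin> p" "\<And>q. q \<in> Q \<Longrightarrow> interval_union c d \<notin> q"
proof -
  obtain g :: "nat \<times> real \<Rightarrow> real" where g: "continuous_on (NN \<times> {0..1}) g"
    "\<And>p r. p \<in> P \<Longrightarrow> r > 0 \<Longrightarrow> {x \<in> NN \<times> {0..1}. r \<le> g x} \<notin> p"
    "\<And>p r. p \<in> Q \<Longrightarrow> r < 1 \<Longrightarrow> {x \<in> NN \<times> {0..1}. g x \<le> r} \<notin> p"
    by (rule Mstar_separation[OF P(1) Q PQ], rule that)
  have gc: "continuous_map MM euclideanreal g" using g(1) by (simp add: MM_eq)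
  define D where "D = {x \<in> NN \<times> {0..1}. 1/3 \<le> g x}"
  define E where "E = {x \<in> NN \<times> {0..1}. g x \<le> 1/2}"
  have Dz: "D \<in> zero_sets MM" and Ez: "E \<in> zero_sets MM"
    unfolding D_def E_def topspace_MM[symmetric] using gc by (intro zero_sets_le; simp)+
  have DP: "D \<notin> p" if "p \<in> P" for p unfolding D_def by (rule g(2)[OF that]) simp
  have EQ: "E \<notin> q" if "q \<in> Q" for q unfolding E_def by (rule g(3)[OF that]) simp
  have PM: "p \<in> topspace Mstar" if "p \<in> P" for p using closedin_subset[OF P(1)] that by blast
  have QM: "p \<in> topspace Mstar" if "p \<in> Q" for p using closedin_subset[OF Q] that by blast
  have "\<forall>n\<in>NN. \<exists>I. finite I \<and> (\<forall>(l, r)\<in>I. 0 \<le> l \<and> l < r \<and> r \<le> 1 \<and> (\<forall>t\<in>{l..r}. g (n, t) \<le> 1/2)) \<and>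
      (\<forall>(l, r)\<in>I. \<forall>(l', r')\<in>I. \<forall>t. t \<in> {l..r} \<longrightarrow> t \<in> {l'..r'} \<longrightarrow> l = l' \<and> r = r') \<and>
      (\<forall>t\<in>{0..1}. g (n, t) \<le> 1/3 \<longrightarrow> (\<exists>(l, r)\<in>I. t \<in> {l..r}))"
  proof
    fix n assume n: "n \<in> NN"
    have "continuous_on {0..1} (g \<circ> Pair n)"
      by (rule continuous_on_compose)
         (use n in \<open>auto intro!: continuous_intros continuous_on_subset[OF g(1)]\<close>)
    then have gn: "continuous_on {0..1} (\<lambda>t. g (n, t))" by (simp add: o_def)
    obtain I where "finite I"
      "\<And>l r. (l, r) \<in> I \<Longrightarrow> 0 \<le> l \<and> l < r \<and> r \<le> 1 \<and> (\<forall>t\<in>{l..r}. g (n, t) \<le> 1/2)"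
      "\<And>l r l' r' t. (l, r) \<in> I \<Longrightarrow> (l', r') \<in> I \<Longrightarrow> t \<in> {l..r} \<Longrightarrow> t \<in> {l'..r'} \<Longrightarrow> l = l' \<and> r = r'"
      "\<And>t. t \<in> {0..1} \<Longrightarrow> g (n, t) \<le> 1/3 \<Longrightarrow> \<exists>l r. (l, r) \<in> I \<and> t \<in> {l..r}"
      by (rule interval_cover[OF gn], rule that)
    then show "\<exists>I. finite I \<and> (\<forall>(l, r)\<in>I. 0 \<le> l \<and> l < r \<and> r \<le> 1 \<and> (\<forall>t\<in>{l..r}. g (n, t) \<le> 1/2)) \<and>
      (\<forall>(l, r)\<in>I. \<forall>(l', r')\<in>I. \<forall>t. t \<in> {l..r} \<longrightarrow> t \<in> {l'..r'} \<longrightarrow> l = l' \<and> r = r') \<and>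
      (\<forall>t\<in>{0..1}. g (n, t) \<le> 1/3 \<longrightarrow> (\<exists>(l, r)\<in>I. t \<in> {l..r}))"
      by (intro exI[of _ I]) fast
  qed
  then obtain I where I0: "\<forall>n\<in>NN. finite (I n) \<and>
      (\<forall>(l, r)\<in>I n. 0 \<le> l \<and> l < r \<and> r \<le> 1 \<and> (\<forall>t\<in>{l..r}. g (n, t) \<le> 1/2)) \<and>
      (\<forall>(l, r)\<in>I n. \<forall>(l', r')\<in>I n. \<forall>t. t \<in> {l..r} \<longrightarrow> t \<in> {l'..r'} \<longrightarrow> l = l' \<and> r = r') \<and>
      (\<forall>t\<in>{0..1}. g (n, t) \<le> 1/3 \<longrightarrow> (\<exists>(l, r)\<in>I n. t \<in> {l..r}))"
    unfolding bchoice_iff by (elim exE)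
  have fin: "finite (I n)" if "n \<in> NN" for n using I0 that by blast
  have I1: "0 \<le> l \<and> l < r \<and> r \<le> 1 \<and> (\<forall>t\<in>{l..r}. g (n, t) \<le> 1/2)" if "n \<in> NN" "(l, r) \<in> I n" for n l r
    using I0 that by blast
  have I2: "l = l' \<and> r = r'" if "n \<in> NN" "(l, r) \<in> I n" "(l', r') \<in> I n" "t \<in> {l..r}" "t \<in> {l'..r'}" for n l r l' r' t
    using I0 that by fast
  have I3: "\<exists>l r. (l, r) \<in> I n \<and> t \<in> {l..r}" if "n \<in> NN" "t \<in> {0..1}" "g (n, t) \<le> 1/3" for n t
    using I0 that by fast
  define K where "K = Sigma NN I"
  define cell where "cell k = {fst k} \<times> {fst (snd k)..snd (snd k)}" for k :: "nat \<times> real \<times> real"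
  have cellK: "compact (cell k)" "cell k \<subseteq> E" "cell k \<subseteq> NN \<times> {0..1}" if "k \<in> K" for k
  proof -
    obtain n l r where k: "k = (n, l, r)" "n \<in> NN" "(l, r) \<in> I n" using \<open>k \<in> K\<close> unfolding K_def by (cases k) auto
    show "compact (cell k)" unfolding cell_def by (intro compact_Times) auto
    show "cell k \<subseteq> E" "cell k \<subseteq> NN \<times> {0..1}" using I1[OF k(2,3)] k(1,2) unfolding cell_def E_def by auto
  qed
  have DK: "NN \<times> {0..1} \<subseteq> D \<union> (\<Union>k\<in>K. cell k)"
  proof
    fix z assume z: "z \<in> NN \<times> {0..1::real}"
    show "z \<in> D \<union> (\<Union>k\<in>K. cell k)"
    proof (cases "z \<in> D")
      case False
      then have "g (fst z, snd z) \<le> 1/3" using z unfolding D_def by auto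
      then obtain l r where "(l, r) \<in> I (fst z)" "snd z \<in> {l..r}" using I3[of "fst z" "snd z"] z by auto
      then have "(fst z, l, r) \<in> K" "z \<in> cell (fst z, l, r)" using z unfolding K_def cell_def by (cases z; auto)+
      then show ?thesis by blast
    qed blast
  qed
  \<comment> \<open>Finitely many intervals have compact union, and a point of \<open>P\<close>
    would contain it because it omits \<open>D\<close>; here \<open>P\<close> must be
    non-empty.\<close>
  have "infinite K"
  proof
    assume "finite K"
    then have c: "compact (\<Union>k\<in>K. cell k)" using cellK(1) by blast
    moreover have s: "(\<Union>k\<in>K. cell k) \<subseteq> NN \<times> {0..1}" using cellK(3) by blast
    ultimately have z: "(\<Union>k\<in>K. cell k) \<in> zero_sets MM" by (simp add: zero_sets_MM compact_imp_closed)
    obtain p where p: "p \<in> P" using P(2) by blast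
    have "D \<union> (\<Union>k\<in>K. cell k) \<in> p"
      by (rule MstarD(4)[OF PM[OF p] MstarD(6)[OF PM[OF p]] zero_sets_Un[OF Dz z] DK])
    then have "(\<Union>k\<in>K. cell k) \<in> p" using MstarD(5)[OF PM[OF p] Dz z] DP[OF p] by blast
    moreover have "compactin MM (\<Union>k\<in>K. cell k)" using c s by (simp add: MM_eq compactin_subtopology)
    ultimately obtain x where "x \<in> (\<Union>k\<in>K. cell k)" "p = sc_embed MM x"
      using z_ultrafilter_compactin_fixed[OF Mstar_z_ultrafilter[OF PM[OF p]]] by blast
    moreover from this have "x \<in> topspace MM" using s topspace_MM by blast
    ultimately show False using PM[OF p] unfolding Mstar_def topspace_sc_remainder by blast
  qed
  moreover have "countable K" unfolding K_def by (intro countable_SIGMA) (auto intro: countable_finite fin)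
  ultimately have bij: "bij_betw (from_nat_into K) UNIV K" by (rule bij_betw_from_nat_into[rotated])
  \<comment> \<open>\<open>from_nat_into\<close> counts from 0, whereas \<open>NN\<close> starts at
    1.\<close>
  define e where "e m = from_nat_into K (m - 1)" for m
  have e: "bij_betw e NN K"
  proof -
    have "bij_betw (\<lambda>m. m - 1) NN (UNIV :: nat set)"
      by (rule bij_betwI[where g=Suc]) (auto simp: NN_def)
    then have "bij_betw (from_nat_into K \<circ> (\<lambda>m. m - 1)) NN K" using bij by (rule bij_betw_trans)
    then show ?thesis by (simp add: o_def e_def[abs_def])
  qed
  have eK: "e m \<in> K" if "m \<in> NN" for m using e that by (rule bij_betwE[rule_format])
  have einj: "m = n" if "m \<in> NN" "n \<in> NN" "e m = e n" for m n
    using e that unfolding bij_betw_def inj_on_def by blast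
  define c where "c m = (fst (e m), fst (snd (e m)))" for m
  define d where "d m = (fst (e m), snd (snd (e m)))" for m
  have cd: "c m \<in> NN \<times> {0..1} \<and> d m \<in> NN \<times> {0..1} \<and> M_less (c m) (d m)" if m: "m \<in> NN" for m
  proof -
    obtain n l r where k: "e m = (n, l, r)" "n \<in> NN" "(l, r) \<in> I n" using eK[OF m] unfolding K_def by (cases "e m") auto
    then show ?thesis using I1[OF k(2,3)] by (auto simp: c_def d_def M_less_def)
  qed
  have int: "M_interval (c m) (d m) = cell (e m)" if "m \<in> NN" for m
    using M_interval_eq cd[OF that] by (simp add: c_def d_def cell_def)
  have un: "interval_union c d = (\<Union>k\<in>K. cell k)"
    unfolding bij_betw_imp_surj_on[OF e, symmetric] using int by simp
  have "compact_family (interval_family c d)"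
    unfolding compact_family_def
  proof (intro conjI ballI allI)
    fix m assume m: "m \<in> NN"
    show "M_interval (c m) (d m) \<noteq> {}" using cd[OF m] by (auto simp: M_interval_eq M_less_def)
    show "compact (M_interval (c m) (d m))" "M_interval (c m) (d m) \<subseteq> NN \<times> {0..1}"
      unfolding int[OF m] using cellK eK[OF m] by blast+
  next
    show "disjoint_family_on (interval_family c d) NN"
      unfolding disjoint_family_on_def
    proof (intro ballI impI equals0I)
      fix m n z assume mn: "m \<in> NN" "n \<in> NN" "m \<noteq> n" "z \<in> M_interval (c m) (d m) \<inter> M_interval (c n) (d n)"
      obtain i l r where k: "e m = (i, l, r)" "i \<in> NN" "(l, r) \<in> I i" using eK[OF mn(1)] unfolding K_def by (cases "e m") auto
      obtain j l' r' where k': "e n = (j, l', r')" "(l', r') \<in> I j" using eK[OF mn(2)] unfolding K_def by (cases "e n") auto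
      have "fst z = i" "fst z = j" "snd z \<in> {l..r}" "snd z \<in> {l'..r'}"
        using mn(4) unfolding int[OF mn(1)] int[OF mn(2)] cell_def k(1) k'(1) by auto
      then have "e m = e n" using I2[of i l r l' r' "snd z"] k k' by simp
      then show False using einj mn by blast
    qed
    fix n
    have "e ` {m \<in> NN. M_interval (c m) (d m) \<inter> ({..n} \<times> UNIV) \<noteq> {}} \<subseteq> Sigma (NN \<inter> {..n}) I"
    proof
      fix k assume "k \<in> e ` {m \<in> NN. M_interval (c m) (d m) \<inter> ({..n} \<times> UNIV) \<noteq> {}}"
      then obtain m z where m: "m \<in> NN" "k = e m" "z \<in> cell k" "fst z \<le> n" using int by force
      then have "k \<in> K" "fst k \<le> n" using eK unfolding cell_def by auto
      then show "k \<in> Sigma (NN \<inter> {..n}) I" unfolding K_def by auto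
    qed
    moreover have "finite (Sigma (NN \<inter> {..n}) I)" using fin by (intro finite_SigmaI) auto
    ultimately have "finite (e ` {m \<in> NN. M_interval (c m) (d m) \<inter> ({..n} \<times> UNIV) \<noteq> {}})"
      by (rule finite_subset)
    moreover have "inj_on e {m \<in> NN. M_interval (c m) (d m) \<inter> ({..n} \<times> UNIV) \<noteq> {}}"
      using einj by (intro inj_onI) blast
    ultimately show "finite {m \<in> NN. M_interval (c m) (d m) \<inter> ({..n} \<times> UNIV) \<noteq> {}}"
      by (rule finite_imageD)
  qed
  then have std: "standard_sequence c d" unfolding standard_sequence_iff using cd by blast
  have "interval_union c d \<subseteq> E" unfolding un using cellK(2) by blast
  then have "interval_union c d \<notin> q" if "q \<in> Q" for q
    using MstarD(4)[OF QM[OF that] _ Ez] EQ[OF that] by blast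
  then show thesis using that[OF std Dz] DK DP unfolding un by blast
qed

lemma standard_sequence_reindex:
  assumes cd: "standard_sequence c d" and i: "bij_betw i NN J" and J: "J \<subseteq> NN"
  shows "standard_sequence (c \<circ> i) (d \<circ> i)"
  unfolding standard_sequence_iff
proof (intro conjI ballI)
  note F = standard_sequenceD(4)[OF cd]
  have iN: "i m \<in> NN" if "m \<in> NN" for m using bij_betwE[OF i] J that by blast
  have inj: "inj_on i NN" using i unfolding bij_betw_def by blast
  show "(c \<circ> i) m \<in> NN \<times> {0..1}" "(d \<circ> i) m \<in> NN \<times> {0..1}" "M_less ((c \<circ> i) m) ((d \<circ> i) m)"
    if "m \<in> NN" for m using standard_sequenceD(1,2,3)[OF cd iN[OF that]] by auto
  show "compact_family (interval_family (c \<circ> i) (d \<circ> i))"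
    unfolding compact_family_def
  proof (intro conjI ballI allI)
    show "disjoint_family_on (interval_family (c \<circ> i) (d \<circ> i)) NN"
      unfolding disjoint_family_on_def
    proof (intro ballI impI equals0I)
      fix m n z assume mn: "m \<in> NN" "n \<in> NN" "m \<noteq> n"
        "z \<in> M_interval ((c \<circ> i) m) ((d \<circ> i) m) \<inter> M_interval ((c \<circ> i) n) ((d \<circ> i) n)"
      then have "i m = i n" using compact_family_disjoint[OF F iN[OF mn(1)] iN[OF mn(2)], of z] by simp
      then show False using inj mn unfolding inj_on_def by blast
    qed
    fix n
    have "i ` {m \<in> NN. M_interval ((c \<circ> i) m) ((d \<circ> i) m) \<inter> ({..n} \<times> UNIV) \<noteq> {}} \<subseteq>
        {m \<in> NN. M_interval (c m) (d m) \<inter> ({..n} \<times> UNIV) \<noteq> {}}"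
      using iN by auto
    then have "finite (i ` {m \<in> NN. M_interval ((c \<circ> i) m) ((d \<circ> i) m) \<inter> ({..n} \<times> UNIV) \<noteq> {}})"
      using compact_family_finite[OF F] by (rule finite_subset)
    then show "finite {m \<in> NN. M_interval ((c \<circ> i) m) ((d \<circ> i) m) \<inter> ({..n} \<times> UNIV) \<noteq> {}}"
      by (rule finite_imageD) (rule inj_on_subset[OF inj], blast)
  qed (use compact_familyD[OF F iN] in auto)
qed

text \<open>Removing open intervals leaves a closed set, hence a zero-set. For a standard sequence
  it meets the intervals only in endpoints, so selectors avoid it, and omitting it is an open
  condition that forces the union of the intervals to be a member.\<close>

definition interval_frame :: "(nat \<Rightarrow> nat \<times> real) \<Rightarrow> (nat \<Rightarrow> nat \<times> real) \<Rightarrow> (nat \<times> real) set" where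
  "interval_frame a b = NN \<times> {0..1} - (\<Union>m\<in>NN. {z. M_less (a m) z \<and> M_less z (b m)})"

lemma interval_frame_zero_set: "interval_frame a b \<in> zero_sets MM"
proof -
  have "open {z. M_less a z \<and> M_less z b}" for a b :: "nat \<times> real"
  proof (cases "fst a = fst b")
    case True
    then have "{z. M_less a z \<and> M_less z b} = {fst a} \<times> {snd a<..<snd b}" by (auto simp: M_less_def)
    then show ?thesis by (simp add: open_Times open_discrete)
  next
    case False
    then have "{z. M_less a z \<and> M_less z b} = {}" by (auto simp: M_less_def)
    then show ?thesis by (simp only: open_empty)
  qed
  then have "closed (interval_frame a b)"
    unfolding interval_frame_def by (intro closed_Diff open_UN closed_Times) (auto simp: closed_nat_set)
  then show ?thesis unfolding zero_sets_MM by (auto simp: interval_frame_def)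
qed

lemma interval_frame_selector:
  assumes ab: "standard_sequence a b" and y: "selector_sequence a b y" and u: "u \<in> topspace Nstar"
  shows "interval_frame a b \<notin> point_lim y u"
proof -
  have "{m\<in>NN. y m \<in> interval_frame a b} = {}"
    using selector_sequenceD(1,2)[OF y] unfolding interval_frame_def by blast
  then have "{m\<in>NN. y m \<in> interval_frame a b} \<notin> u" using NstarD(7)[OF u] by metis
  then show ?thesis unfolding point_lim_eq[OF selector_compact_family[OF ab y] u] by blast
qed

lemma interval_frame_or_union:
  assumes ab: "standard_sequence a b" and p: "p \<in> topspace Mstar" "interval_frame a b \<notin> p"
  shows "interval_union a b \<in> p"
proof -
  note z = interval_frame_zero_set interval_union_zero_set[OF ab]
  have "{z. M_less (a m) z \<and> M_less z (b m)} \<subseteq> M_interval (a m) (b m)" for m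
    using selector_in_interval by blast
  then have "NN \<times> {0..1} \<subseteq> interval_frame a b \<union> interval_union a b"
    unfolding interval_frame_def by blast
  then have "interval_frame a b \<union> interval_union a b \<in> p"
    by (rule MstarD(4)[OF p(1) MstarD(6)[OF p(1)] zero_sets_Un[OF z]])
  then show ?thesis using MstarD(5)[OF p(1) z] p(2) by blast
qed

section \<open>Transferring intervals along a homeomorphism\<close>

text \<open>\<open>pullback\<close> is all that is kept of the disjointness from \<open>Q\<close>,
  and \<open>D\<close> completes the intervals to a cover of \<open>MM\<close>. Intervals may be
  discarded by adding them to \<open>D\<close>, as long as \<open>D_avoid\<close> survives; thus the
  same locale serves before and after the selection that makes \<open>h\<close> onto.\<close>

locale interval_transfer =
  fixes \<Psi> \<Phi> :: "(nat \<times> real) set set \<Rightarrow> (nat \<times> real) set set"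
    and a b x c d :: "nat \<Rightarrow> nat \<times> real" and D :: "(nat \<times> real) set"
  assumes homeo: "homeomorphic_maps Mstar Mstar \<Psi> \<Phi>"
    and ab: "standard_sequence a b" and x: "selector_sequence a b x" and cd: "standard_sequence c d"
    and D: "D \<in> zero_sets MM" "NN \<times> {0..1} \<subseteq> D \<union> interval_union c d"
    and D_avoid: "\<And>u. u \<in> topspace Nstar \<Longrightarrow> D \<notin> \<Psi> (point_lim x u)"
    and pullback: "\<And>q. q \<in> topspace Mstar \<Longrightarrow> interval_union c d \<in> q \<Longrightarrow> interval_union a b \<in> \<Phi> q"
begin

abbreviation "cd_trace \<equiv> family_trace (interval_family c d)"
abbreviation "ab_trace \<equiv> family_trace (interval_family a b)"

definition h :: "nat set set \<Rightarrow> nat set set" where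
  "h u = cd_trace (\<Psi> (point_lim x u))"

lemma \<Psi>_cont: "continuous_map Mstar Mstar \<Psi>" and \<Phi>_cont: "continuous_map Mstar Mstar \<Phi>"
  and \<Phi>\<Psi>: "p \<in> topspace Mstar \<Longrightarrow> \<Phi> (\<Psi> p) = p" and \<Psi>\<Phi>: "p \<in> topspace Mstar \<Longrightarrow> \<Psi> (\<Phi> p) = p"
  using homeo unfolding homeomorphic_maps_def by auto

lemma \<Psi>_in: "p \<in> topspace Mstar \<Longrightarrow> \<Psi> p \<in> topspace Mstar" and \<Phi>_in: "p \<in> topspace Mstar \<Longrightarrow> \<Phi> p \<in> topspace Mstar"
  using \<Psi>_cont \<Phi>_cont unfolding continuous_map_def by auto

lemma x_family: "compact_family (\<lambda>m. {x m})"
  by (rule selector_compact_family[OF ab x])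

lemma x_in: "u \<in> topspace Nstar \<Longrightarrow> point_lim x u \<in> topspace Mstar"
  by (rule point_lim_Mstar[OF x_family])

lemma union_zero_set: "interval_union c d \<in> zero_sets MM"
  by (rule interval_union_zero_set[OF cd])

lemma D_or_union: "q \<in> topspace Mstar \<Longrightarrow> D \<notin> q \<Longrightarrow> interval_union c d \<in> q"
  using MstarD(4)[of q _ "D \<union> interval_union c d"] MstarD(6)[of q] MstarD(5)[of q, OF _ D(1) union_zero_set]
    zero_sets_Un[OF D(1) union_zero_set] D(2) by blast

lemma blockD:
  assumes "w \<in> topspace Nstar" "q \<in> interval_lim c d w"
  shows "q \<in> topspace Mstar" "interval_union c d \<in> q" "cd_trace q = w"
    "\<Phi> q \<in> topspace Mstar" "interval_union a b \<in> \<Phi> q"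
  using assms interval_lim_eq[OF cd assms(1)] \<Phi>_in pullback by auto

lemma h_in: "u \<in> topspace Nstar \<Longrightarrow> h u \<in> topspace Nstar"
  and point_in_block: "u \<in> topspace Nstar \<Longrightarrow> \<Psi> (point_lim x u) \<in> interval_lim c d (h u)"
  unfolding h_def using interval_lim_trace[OF cd \<Psi>_in[OF x_in]] D_or_union[OF \<Psi>_in[OF x_in]] D_avoid by auto

text \<open>The \<open>\<Phi>\<close>-preimages of the basic closed sets for \<open>Z\<close> and
  \<open>Z'\<close> are closed, cover the connected block and both meet it, so they meet each other
  inside it.\<close>

lemma connected_split:
  assumes w: "w \<in> topspace Nstar" and Z: "Z \<in> zero_sets MM" "Z' \<in> zero_sets MM"
    and cov: "\<And>q. q \<in> interval_lim c d w \<Longrightarrow> Z \<in> \<Phi> q \<or> Z' \<in> \<Phi> q"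
    and q: "q \<in> interval_lim c d w" "Z \<in> \<Phi> q" "q' \<in> interval_lim c d w" "Z' \<in> \<Phi> q'"
  obtains r where "r \<in> interval_lim c d w" "Z \<in> \<Phi> r" "Z' \<in> \<Phi> r"
proof -
  define E where "E W = {q \<in> topspace Mstar. \<Phi> q \<in> {p \<in> topspace Mstar. W \<in> p}}" for W
  have E: "closedin Mstar (E W)" if "W \<in> zero_sets MM" for W
    unfolding E_def by (rule closedin_continuous_map_preimage[OF \<Phi>_cont closedin_Mstar_basic[OF that]])
  have "interval_lim c d w \<subseteq> E Z \<union> E Z'" using cov blockD[OF w] unfolding E_def by blast
  moreover have "q \<in> E Z" "q' \<in> E Z'" using q blockD[OF w] unfolding E_def by blast+
  ultimately have "E Z \<inter> E Z' \<inter> interval_lim c d w \<noteq> {}"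
    using connectedin_interval_lim[OF cd w] E[OF Z(1)] E[OF Z(2)] q(1,3)
    unfolding connectedin_closedin by blast
  then show thesis using that unfolding E_def by blast
qed

text \<open>If some \<open>s\<close> were in one trace and its complement in the other, the
  intervals with index in \<open>s\<close> and the remaining ones would split the block;
  \<open>connected_split\<close> then yields a point with two disjoint members.\<close>

lemma trace_constant:
  assumes w: "w \<in> topspace Nstar" and q: "q \<in> interval_lim c d w" "q' \<in> interval_lim c d w"
  shows "ab_trace (\<Phi> q) = ab_trace (\<Phi> q')"
proof (rule Nstar_eqI)
  note F = standard_sequenceD(4)[OF ab]
  show "ab_trace (\<Phi> q) \<in> topspace Nstar" and t': "ab_trace (\<Phi> q') \<in> topspace Nstar"
    using interval_lim_trace(1)[OF ab] blockD[OF w] q by auto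
  show "ab_trace (\<Phi> q) \<subseteq> ab_trace (\<Phi> q')"
  proof
    fix s assume "s \<in> ab_trace (\<Phi> q)"
    then have s: "s \<subseteq> NN" "(\<Union>m\<in>s. M_interval (a m) (b m)) \<in> \<Phi> q" unfolding family_trace_def by auto
    show "s \<in> ab_trace (\<Phi> q')"
    proof (rule ccontr)
      assume "s \<notin> ab_trace (\<Phi> q')"
      then have "NN - s \<in> ab_trace (\<Phi> q')" using NstarD(6)[OF t' s(1)] by blast
      then have s': "(\<Union>m\<in>NN - s. M_interval (a m) (b m)) \<in> \<Phi> q'" unfolding family_trace_def by auto
      let ?Z = "\<Union>m\<in>s. M_interval (a m) (b m)" and ?Z' = "\<Union>m\<in>NN - s. M_interval (a m) (b m)"
      have Z: "?Z \<in> zero_sets MM" "?Z' \<in> zero_sets MM"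
        using family_Union_zero_set[OF F] s(1) by auto
      have "?Z \<union> ?Z' = interval_union a b" using s(1) by blast
      then have "?Z \<in> \<Phi> r \<or> ?Z' \<in> \<Phi> r" if "r \<in> interval_lim c d w" for r
        using MstarD(5)[OF blockD(4)[OF w that] Z] blockD(5)[OF w that] by simp
      then obtain r where r: "r \<in> interval_lim c d w" "?Z \<in> \<Phi> r" "?Z' \<in> \<Phi> r"
        using connected_split[OF w Z _ q(1) s(2) q(2) s'] by blast
      moreover have "?Z \<inter> ?Z' = {}"
        using compact_family_disjoint[OF F] s(1) by blast
      ultimately show False using MstarD(2,3)[OF blockD(4)[OF w r(1)]] by metis
    qed
  qed
qed

text \<open>The constant trace is computed at the one known point of the block,
  \<open>\<Psi> (point_lim x u)\<close>.\<close>

lemma block_subset: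
  assumes u: "u \<in> topspace Nstar" and q: "q \<in> interval_lim c d (h u)"
  shows "\<Phi> q \<in> interval_lim a b u"
proof -
  have "ab_trace (\<Phi> q) = ab_trace (\<Phi> (\<Psi> (point_lim x u)))"
    by (rule trace_constant[OF h_in[OF u] q point_in_block[OF u]])
  also have "\<dots> = u"
    using point_lim_in_interval[OF ab x u] interval_lim_eq[OF ab u] \<Phi>\<Psi>[OF x_in[OF u]] by simp
  finally show ?thesis using blockD[OF h_in[OF u] q] interval_lim_eq[OF ab u] by blast
qed

lemma h_inj:
  assumes "u \<in> topspace Nstar" "v \<in> topspace Nstar" "h u = h v"
  shows "u = v"
proof -
  have "\<Phi> (\<Psi> (point_lim x u)) \<in> interval_lim a b u" "\<Phi> (\<Psi> (point_lim x u)) \<in> interval_lim a b v"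
    using block_subset[OF assms(1) point_in_block[OF assms(1)]] block_subset[OF assms(2)]
      point_in_block[OF assms(1)] assms(3) by simp_all
  then show ?thesis by (rule interval_lim_disjoint[OF ab assms(1,2)])
qed

lemma h_continuous: "continuous_map Nstar Nstar h"
proof -
  have "continuous_map Nstar Mstar (\<Psi> \<circ> point_lim x)"
    by (rule continuous_map_compose[OF continuous_point_lim[OF x_family] \<Psi>_cont])
  then have "continuous_map Nstar (subtopology Mstar {p. interval_union c d \<in> p}) (\<Psi> \<circ> point_lim x)"
    using D_or_union[OF \<Psi>_in[OF x_in]] D_avoid by (auto simp: continuous_map_in_subtopology)
  then have "continuous_map Nstar Nstar (cd_trace \<circ> (\<Psi> \<circ> point_lim x))"
    using continuous_family_trace[OF standard_sequenceD(4)[OF cd]] by (rule continuous_map_compose)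
  then show ?thesis by (simp add: h_def[abs_def] o_def)
qed

text \<open>Used with \<open>Z\<close> one half of the intervals: the block then reaches strictly
  past the cut into the other half.\<close>

definition leaves :: "(nat \<times> real) set \<Rightarrow> nat set set set" where
  "leaves Z = {w \<in> topspace Nstar. \<exists>q\<in>interval_lim c d w. Z \<notin> \<Phi> q}"

text \<open>The witness in one block is replaced by the limit of a selector whose
  \<open>\<Phi>\<close>-image omits \<open>Z\<close> along all ultrafilters near \<open>w\<close>,
  by the uniformity in \<open>selector_dense\<close>.\<close>

lemma openin_leaves:
  assumes Z: "Z \<in> zero_sets MM"
  shows "openin Nstar (leaves Z)"
proof (subst openin_subopen, intro ballI)
  fix w assume "w \<in> leaves Z"
  then obtain q where w: "w \<in> topspace Nstar" and q: "q \<in> interval_lim c d w" "Z \<notin> \<Phi> q"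
    unfolding leaves_def by blast
  let ?U = "{q \<in> topspace Mstar. \<Phi> q \<in> {p \<in> topspace Mstar. Z \<notin> p}}"
  have U: "openin Mstar ?U"
    by (rule openin_continuous_map_preimage[OF \<Phi>_cont openin_Mstar_basic[OF Z]])
  have qU: "q \<in> ?U" using blockD[OF w q(1)] q(2) by blast
  obtain y s where y: "selector_sequence c d y" "s \<in> w"
    "\<And>v. v \<in> topspace Nstar \<Longrightarrow> s \<in> v \<Longrightarrow> point_lim y v \<in> ?U"
    by (rule selector_dense[OF cd w q(1) U qU], rule that)
  \<comment> \<open>Basic open sets are given by non-membership; omitting the complement of
    \<open>s\<close> amounts to containing \<open>s\<close>.\<close>
  let ?T = "{v \<in> topspace Nstar. NN - s \<notin> v}"
  have s: "s \<subseteq> NN" using NstarD(1)[OF w y(2)] .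
  have T: "NN - s \<notin> v \<longleftrightarrow> s \<in> v" if "v \<in> topspace Nstar" for v using NstarD(6)[OF that s] by blast
  have "openin Nstar ?T"
    unfolding Nstar_def by (rule openin_sc_remainder_basic) (auto simp: zero_sets_discrete)
  moreover have "w \<in> ?T" using w y(2) T by blast
  moreover have "?T \<subseteq> leaves Z"
  proof
    fix v assume "v \<in> ?T"
    then have v: "v \<in> topspace Nstar" "s \<in> v" using T by auto
    then show "v \<in> leaves Z"
      using y(3)[OF v] point_lim_in_interval[OF cd y(1) v(1)] unfolding leaves_def by blast
  qed
  ultimately show "\<exists>T. openin Nstar T \<and> w \<in> T \<and> T \<subseteq> leaves Z" by blast
qed

text \<open>A block with points strictly on both sides of the cut contains, by connectedness, a
  point on the cut. Its image under \<open>\<Phi>\<close> is some \<open>point_lim x u\<close>, and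
  the index of its block is then \<open>h u\<close>.\<close>

lemma leaves_both_imp_range:
  assumes Z: "Z \<in> zero_sets MM" "Z' \<in> zero_sets MM" "Z \<union> Z' = interval_union a b" "Z \<inter> Z' = x ` NN"
    and w: "w \<in> leaves Z" "w \<in> leaves Z'"
  obtains u where "u \<in> topspace Nstar" "w = h u"
proof -
  obtain q q' where wN: "w \<in> topspace Nstar" and q: "q \<in> interval_lim c d w" "Z \<notin> \<Phi> q"
    "q' \<in> interval_lim c d w" "Z' \<notin> \<Phi> q'" using w unfolding leaves_def by blast
  have or: "Z \<in> \<Phi> r \<or> Z' \<in> \<Phi> r" if "r \<in> interval_lim c d w" for r
    using MstarD(5)[OF blockD(4)[OF wN that] Z(1,2)] blockD(5)[OF wN that] Z(3) by simp
  then obtain r where r: "r \<in> interval_lim c d w" "Z \<in> \<Phi> r" "Z' \<in> \<Phi> r"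
    using connected_split[OF wN Z(1,2) or q(3) _ q(1)] q by blast
  then have "x ` NN \<in> \<Phi> r" using MstarD(3)[OF blockD(4)[OF wN r(1)]] Z(4) by metis
  then obtain u where u: "u \<in> topspace Nstar" "\<Phi> r = point_lim x u"
    using point_lim_unique[OF x_family blockD(4)[OF wN r(1)]] by blast
  then have "w = h u" unfolding h_def using \<Psi>\<Phi>[OF blockD(1)[OF wN r(1)]] blockD(3)[OF wN r(1)] by metis
  with u(1) show thesis by (rule that)
qed

text \<open>The limits of the left and of the right endpoints differ, because no right endpoint is a
  left endpoint. This excludes a block that shrinks to a point of the cut.\<close>

lemma block_not_constant:
  assumes w: "w \<in> topspace Nstar"
  obtains q q' where "q \<in> interval_lim c d w" "q' \<in> interval_lim c d w" "q \<noteq> q'"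
proof -
  note F = standard_sequenceD(4)[OF cd]
  have c: "c m \<in> M_interval (c m) (d m)" and d: "d m \<in> M_interval (c m) (d m)" if "m \<in> NN" for m
    using M_interval_endpoints[OF standard_sequenceD(3)[OF cd that]] by auto
  have cF: "compact_family (\<lambda>m. {c m})" by (rule compact_family_points[OF F c])
  have dF: "compact_family (\<lambda>m. {d m})" by (rule compact_family_points[OF F d])
  have "c ` NN \<in> zero_sets MM"
    using family_Union_zero_set[OF cF, of NN] by (simp add: UNION_singleton_eq_range)
  moreover have c_all: "{m\<in>NN. c m \<in> c ` NN} \<in> w"
    using NstarD(2)[OF w] by (simp cong: conj_cong)
  moreover have "{m\<in>NN. d m \<in> c ` NN} = {}"
  proof (rule equals0I)
    fix m assume "m \<in> {m\<in>NN. d m \<in> c ` NN}"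
    then obtain n where mn: "m \<in> NN" "n \<in> NN" "d m = c n" by blast
    then have "m = n" using compact_family_disjoint[OF F mn(1,2) d[OF mn(1)]] c[OF mn(2)] by simp
    then show False using standard_sequenceD(3)[OF cd mn(1)] mn(3) by (simp add: M_less_def)
  qed
  then have "{m\<in>NN. d m \<in> c ` NN} \<notin> w" using NstarD(7)[OF w] by metis
  ultimately have "c ` NN \<in> point_lim c w" "c ` NN \<notin> point_lim d w"
    unfolding point_lim_eq[OF cF w] point_lim_eq[OF dF w] by simp_all
  then have "point_lim c w \<noteq> point_lim d w" by blast
  moreover have "point_lim c w \<in> interval_lim c d w" "point_lim d w \<in> interval_lim c d w"
    unfolding interval_lim_def using point_lim_in_u_lim[OF F w] c d by auto
  ultimately show thesis using that by blast
qed

text \<open>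
  If \<^term>\<open>interval_lim c d (h u)\<close> were mapped into the side \<^term>\<open>Z\<close>, nearby blocks, which by openness of
  the trace also contain points off \<^term>\<open>Z'\<close>, would have to approach the image of \<^term>\<open>point_lim x u\<close>
  from the other side; such a block contains an image of some cut point \<^term>\<open>point_lim x v\<close>, and
  being near forces \<open>v = u\<close>.
\<close>

lemma range_imp_leaves:
  assumes Z: "Z \<in> zero_sets MM" "Z' \<in> zero_sets MM" "Z \<union> Z' = interval_union a b" "Z \<inter> Z' = x ` NN"
    and u: "u \<in> topspace Nstar"
    and near: "\<And>U. openin Mstar U \<Longrightarrow> point_lim x u \<in> U \<Longrightarrow> \<exists>p\<in>U. p \<in> interval_lim a b u \<and> Z \<notin> p"
  shows "h u \<in> leaves Z"
proof (rule ccontr)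
  note w = h_in[OF u]
  assume neg: "h u \<notin> leaves Z"
  then have inZ: "Z \<in> \<Phi> q" if "q \<in> interval_lim c d (h u)" for q
    using w that unfolding leaves_def by blast
  \<comment> \<open>A block leaving neither half would consist of the single point
    \<open>\<Psi> (point_lim x u)\<close>.\<close>
  have "h u \<in> leaves Z'"
  proof (rule ccontr)
    assume "h u \<notin> leaves Z'"
    then have inZ': "Z' \<in> \<Phi> q" if "q \<in> interval_lim c d (h u)" for q
      using w that unfolding leaves_def by blast
    have eq: "q = \<Psi> (point_lim x u)" if q: "q \<in> interval_lim c d (h u)" for q
    proof -
      have "x ` NN \<in> \<Phi> q" using MstarD(3)[OF blockD(4)[OF w q] inZ[OF q] inZ'[OF q]] Z(4) by simp
      then have "\<Phi> q = point_lim x u"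
        by (rule point_lim_unique_interval[OF ab x u block_subset[OF u q]])
      then show ?thesis using \<Psi>\<Phi>[OF blockD(1)[OF w q]] by simp
    qed
    obtain q q' where "q \<in> interval_lim c d (h u)" "q' \<in> interval_lim c d (h u)" "q \<noteq> q'"
      by (rule block_not_constant[OF w])
    then show False using eq by metis
  qed
  let ?X = "subtopology Mstar {q. interval_union c d \<in> q}"
  have "openin ?X {q \<in> topspace ?X. cd_trace q \<in> leaves Z'}"
    by (rule openin_continuous_map_preimage[OF continuous_family_trace[OF standard_sequenceD(4)[OF cd]] openin_leaves[OF Z(2)]])
  then obtain T where T: "openin Mstar T" "{q \<in> topspace ?X. cd_trace q \<in> leaves Z'} = T \<inter> {q. interval_union c d \<in> q}"
    unfolding openin_subtopology by blast
  have Tt: "cd_trace q \<in> leaves Z'" if "q \<in> T" "interval_union c d \<in> q" for q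
    using T(2) that by blast
  \<comment> \<open>Omitting \<open>D\<close> makes points covered, and \<open>T\<close> puts the
    index of their block into \<open>leaves Z'\<close>; both are open conditions.\<close>
  let ?V = "{q \<in> topspace Mstar. D \<notin> q} \<inter> T"
  let ?U = "{p \<in> topspace Mstar. \<Psi> p \<in> ?V}"
  have "openin Mstar ?U"
    by (rule openin_continuous_map_preimage[OF \<Psi>_cont openin_Int[OF openin_Mstar_basic[OF D(1)] T(1)]])
  moreover have "point_lim x u \<in> ?U"
  proof -
    have "interval_union c d \<in> \<Psi> (point_lim x u)" using blockD(2)[OF w point_in_block[OF u]] .
    then have "\<Psi> (point_lim x u) \<in> T"
      using T(2) \<open>h u \<in> leaves Z'\<close> \<Psi>_in[OF x_in[OF u]] unfolding h_def by auto
    then show ?thesis using D_avoid[OF u] x_in[OF u] \<Psi>_in[OF x_in[OF u]] by simp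
  qed
  ultimately obtain p where p: "p \<in> ?U" "p \<in> interval_lim a b u" "Z \<notin> p" using near by blast
  have pM: "p \<in> topspace Mstar" and DT: "D \<notin> \<Psi> p" "\<Psi> p \<in> T" using p(1) by auto
  have cov: "interval_union c d \<in> \<Psi> p" by (rule D_or_union[OF \<Psi>_in[OF pM] DT(1)])
  note tr = interval_lim_trace[OF cd \<Psi>_in[OF pM] cov]
  have "cd_trace (\<Psi> p) \<in> leaves Z'" by (rule Tt[OF DT(2) cov])
  moreover have lZ: "cd_trace (\<Psi> p) \<in> leaves Z"
    using tr p(3) \<Phi>\<Psi>[OF pM] unfolding leaves_def by force
  ultimately obtain v where v: "v \<in> topspace Nstar" "cd_trace (\<Psi> p) = h v"
    using leaves_both_imp_range[OF Z] by blast
  then have "\<Phi> (\<Psi> p) \<in> interval_lim a b v" using block_subset tr(2) by simp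
  then have "v = u" using interval_lim_disjoint[OF ab v(1) u] p(2) \<Phi>\<Psi>[OF pM] by simp
  then show False using v(2) lZ neg by simp
qed

lemma range_h_eq:
  "h ` topspace Nstar = leaves (interval_union a x) \<inter> leaves (interval_union x b)"
proof -
  let ?L = "interval_union a x" and ?R = "interval_union x b"
  have Z: "?L \<in> zero_sets MM" "?R \<in> zero_sets MM"
    using standard_sequence_halves[OF ab x] interval_union_zero_set by auto
  note LR = interval_union_halves[OF ab x]
  have RL: "?R \<union> ?L = interval_union a b" "?R \<inter> ?L = x ` NN"
    using LR by (simp_all only: Un_commute Int_commute)
  show ?thesis
  proof
    show "h ` topspace Nstar \<subseteq> leaves ?L \<inter> leaves ?R"
    proof (intro image_subsetI IntI)
      fix u assume u: "u \<in> topspace Nstar"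
      show "h u \<in> leaves ?L"
        by (rule range_imp_leaves[OF Z LR u]) (metis point_lim_near_right[OF ab x u])
      show "h u \<in> leaves ?R"
        by (rule range_imp_leaves[OF Z(2,1) RL u]) (metis point_lim_near_left[OF ab x u])
    qed
    show "leaves ?L \<inter> leaves ?R \<subseteq> h ` topspace Nstar"
      using leaves_both_imp_range[OF Z LR] by blast
  qed
qed

lemma clopen_range_h: "openin Nstar (h ` topspace Nstar)" "closedin Nstar (h ` topspace Nstar)"
proof -
  show "openin Nstar (h ` topspace Nstar)"
    unfolding range_h_eq
    using standard_sequence_halves[OF ab x] interval_union_zero_set by (intro openin_Int openin_leaves)
  have "compactin Nstar (topspace Nstar)" using compact_space_Nstar by (simp add: compact_space_def)
  then have "compactin Nstar (h ` topspace Nstar)" using h_continuous by (rule image_compactin)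
  then show "closedin Nstar (h ` topspace Nstar)"
    by (rule compactin_imp_closedin[OF Hausdorff_space_Nstar])
qed

end

text \<open>A set \<open>J\<close> of indices decides the clopen range of \<open>h\<close>; the
  intervals indexed by \<open>J\<close> are kept and the others added to \<open>D\<close>. Given
  \<open>w\<close>, its image under the enumeration \<open>i\<close> of \<open>J\<close> contains
  \<open>J\<close> and so equals \<open>h u\<close> for some \<open>u\<close>; read through
  \<open>i\<close>, this says that \<open>w\<close> is the new index of the same
  \<open>u\<close>.\<close>

lemma interval_transfer_surjective:
  assumes "interval_transfer \<Psi> \<Phi> a b x c d D"
  obtains c' d' D' where "interval_transfer \<Psi> \<Phi> a b x c' d' D'"
    "interval_transfer.h \<Psi> x c' d' ` topspace Nstar = topspace Nstar"
proof -
  interpret interval_transfer \<Psi> \<Phi> a b x c d D by (rule assms)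
  note F = standard_sequenceD(4)[OF cd]
  obtain J where J: "J \<subseteq> NN" "\<And>w. w \<in> topspace Nstar \<Longrightarrow> w \<in> h ` topspace Nstar \<longleftrightarrow> J \<in> w"
    by (rule clopen_Nstar[OF clopen_range_h], rule that)
  have Jh: "J \<in> h u" if "u \<in> topspace Nstar" for u using J(2)[OF h_in[OF that]] that by blast
  obtain u0 where u0: "u0 \<in> topspace Nstar" using topspace_Nstar_nonempty by blast
  have "infinite J" using NstarD(5)[OF h_in[OF u0] Jh[OF u0]] .
  then have bJ: "bij_betw (from_nat_into J) UNIV J" by (intro bij_betw_from_nat_into) simp_all
  have "bij_betw (\<lambda>m. m - 1) NN (UNIV :: nat set)"
    by (rule bij_betwI[where g=Suc]) (auto simp: NN_def)
  from bij_betw_trans[OF this bJ] obtain i where i: "bij_betw i NN J" by blast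
  have iJ: "i m \<in> J" if "m \<in> NN" for m using bij_betwE[OF i] that by blast
  have i_inj: "m = n" if "m \<in> NN" "n \<in> NN" "i m = i n" for m n
    using i that unfolding bij_betw_def inj_on_def by blast
  have un: "(\<Union>m\<in>s. M_interval ((c \<circ> i) m) ((d \<circ> i) m)) = (\<Union>j\<in>i ` s. M_interval (c j) (d j))" for s by simp
  have unJ: "interval_union (c \<circ> i) (d \<circ> i) = (\<Union>j\<in>J. M_interval (c j) (d j))"
    unfolding un bij_betw_imp_surj_on[OF i] ..
  let ?rest = "\<Union>j\<in>NN - J. M_interval (c j) (d j)"
  have rest: "?rest \<in> zero_sets MM" by (rule family_Union_zero_set[OF F]) blast
  have std: "standard_sequence (c \<circ> i) (d \<circ> i)" by (rule standard_sequence_reindex[OF cd i J(1)])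
  interpret R: interval_transfer \<Psi> \<Phi> a b x "c \<circ> i" "d \<circ> i" "D \<union> ?rest"
  proof
    show "D \<union> ?rest \<in> zero_sets MM" by (rule zero_sets_Un[OF D(1) rest])
    have "interval_union c d \<subseteq> ?rest \<union> interval_union (c \<circ> i) (d \<circ> i)" unfolding unJ by blast
    then have "D \<union> interval_union c d \<subseteq> D \<union> (?rest \<union> interval_union (c \<circ> i) (d \<circ> i))"
      by (rule Un_mono[OF order_refl])
    then show "NN \<times> {0..1} \<subseteq> D \<union> ?rest \<union> interval_union (c \<circ> i) (d \<circ> i)"
      unfolding Un_assoc by (rule order_trans[OF D(2)])
    show "D \<union> ?rest \<notin> \<Psi> (point_lim x u)" if u: "u \<in> topspace Nstar" for u
    proof -
      \<comment> \<open>Since \<open>J\<close> belongs to \<open>h u\<close>, the union of the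
        discarded intervals is not a member of \<open>\<Psi> (point_lim x u)\<close>, so it may be
        added to \<open>D\<close>.\<close>
      have "NN - J \<notin> h u" using Jh[OF u] NstarD(6)[OF h_in[OF u] J(1)] by blast
      then have "?rest \<notin> \<Psi> (point_lim x u)" unfolding h_def family_trace_def by blast
      then show ?thesis using MstarD(5)[OF \<Psi>_in[OF x_in[OF u]] D(1) rest] D_avoid[OF u] by blast
    qed
    show "interval_union a b \<in> \<Phi> q" if "q \<in> topspace Mstar" "interval_union (c \<circ> i) (d \<circ> i) \<in> q" for q
    proof (rule pullback[OF that(1)])
      have "interval_union (c \<circ> i) (d \<circ> i) \<subseteq> interval_union c d" unfolding unJ using J(1) by blast
      then show "interval_union c d \<in> q" by (rule MstarD(4)[OF that(1,2) union_zero_set])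
    qed
  qed (rule homeo ab x std)+
  have "w \<in> R.h ` topspace Nstar" if w: "w \<in> topspace Nstar" for w
  proof -
    \<comment> \<open>The image of \<open>w\<close> under \<open>i\<close>, an ultrafilter on the
      old indices.\<close>
    define v where "v = {s. s \<subseteq> NN \<and> {m\<in>NN. i m \<in> s} \<in> w}"
    have vN: "v \<in> topspace Nstar"
    proof (rule NstarI)
      fix s t assume s: "s \<in> v"
      then have s': "s \<subseteq> NN" "{m\<in>NN. i m \<in> s} \<in> w" unfolding v_def by auto
      show "s \<subseteq> NN" by (rule s')
      show "s \<inter> t \<in> v" if "t \<in> v"
      proof -
        have "{m\<in>NN. i m \<in> s} \<inter> {m\<in>NN. i m \<in> t} \<in> w"
          using NstarD(3)[OF w s'(2)] that unfolding v_def by blast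
        moreover have "{m\<in>NN. i m \<in> s} \<inter> {m\<in>NN. i m \<in> t} = {m\<in>NN. i m \<in> s \<inter> t}" by blast
        ultimately show ?thesis using s'(1) unfolding v_def by auto
      qed
      show "t \<in> v" if "s \<subseteq> t" "t \<subseteq> NN"
      proof -
        have "{m\<in>NN. i m \<in> t} \<in> w" by (rule NstarD(4)[OF w s'(2)]) (use that in auto)
        then show ?thesis using that(2) unfolding v_def by blast
      qed
      show "infinite s"
      proof
        assume "finite s"
        then have "finite (i ` {m\<in>NN. i m \<in> s})" by (rule rev_finite_subset) blast
        then have "finite {m\<in>NN. i m \<in> s}"
          by (rule finite_imageD) (use i_inj in \<open>auto intro: inj_onI\<close>)
        then show False using NstarD(5)[OF w s'(2)] by blast
      qed
    next
      fix s assume "s \<subseteq> NN"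
      have "NN - {m\<in>NN. i m \<in> s} = {m\<in>NN. i m \<in> NN - s}" using iJ J(1) by blast
      then show "s \<in> v \<or> NN - s \<in> v"
        using NstarD(6)[OF w, of "{m\<in>NN. i m \<in> s}"] \<open>s \<subseteq> NN\<close> unfolding v_def by auto
    qed
    have "{m\<in>NN. i m \<in> J} = NN" using iJ by blast
    then have "J \<in> v" using J(1) NstarD(2)[OF w] unfolding v_def by simp
    then obtain u where u: "u \<in> topspace Nstar" "v = h u" using J(2)[OF vN] by blast
    have "w \<subseteq> R.h u"
    proof
      fix t assume t: "t \<in> w"
      have tN: "t \<subseteq> NN" by (rule NstarD(1)[OF w t])
      then have "{m\<in>NN. i m \<in> i ` t} = t" using i_inj by blast
      then have "i ` t \<in> v" using t iJ J(1) tN unfolding v_def by auto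
      then have "(\<Union>m\<in>t. M_interval ((c \<circ> i) m) ((d \<circ> i) m)) \<in> \<Psi> (point_lim x u)"
        unfolding un u(2) h_def family_trace_def by blast
      then show "t \<in> R.h u" using tN unfolding R.h_def family_trace_def by blast
    qed
    then have "w = R.h u" by (rule Nstar_eqI[OF w R.h_in[OF u(1)]])
    then show ?thesis using u(1) by blast
  qed
  then have "R.h ` topspace Nstar = topspace Nstar" using R.h_in by blast
  then show thesis using that R.interval_transfer_axioms by blast
qed

section \<open>Blocks as subintervals when \<open>h\<close> is onto\<close>

context interval_transfer
begin

text \<open>\<open>J\<close> is closed and connected, so its cut points are order-convex and only
  their density in \<open>J\<close> is at issue. A cut point near \<open>p\<close> may fall outside
  \<open>J\<close>, since \<open>\<Psi> p\<close> may lie at the end of its block. Therefore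
  \<open>\<Psi> p\<close> is first approximated by a selector limit \<open>q\<close> in the block,
  which has a neighbourhood of covered points, and then \<open>\<Phi> q\<close> by a cut
  point.\<close>

lemma surjective_image_subinterval:
  assumes surj: "h ` topspace Nstar = topspace Nstar" and u: "u \<in> topspace Nstar"
  shows "image_subinterval \<Psi> a b u (interval_lim c d (h u))"
proof -
  note w = h_in[OF u]
  let ?K = "interval_lim c d (h u)"
  define J where "J = \<Phi> ` ?K"
  have KM: "?K \<subseteq> topspace Mstar" using blockD(1)[OF w] by blast
  have J_sub: "J \<subseteq> interval_lim a b u" unfolding J_def using block_subset[OF u] by blast
  have J_conn: "connectedin Mstar J"
    unfolding J_def by (rule connectedin_continuous_map_image[OF \<Phi>_cont connectedin_interval_lim[OF cd w]])
  have "homeomorphic_map Mstar Mstar \<Phi>"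
    using homeo homeomorphic_maps_sym homeomorphic_maps_map by blast
  then have J_closed: "closedin Mstar J"
    unfolding J_def using homeomorphic_map_closedness_eq closedin_interval_lim[OF cd w] KM by blast
  have \<Psi>J: "\<Psi> ` J = ?K"
  proof -
    have "\<Psi> (\<Phi> q) = q" if "q \<in> ?K" for q using \<Psi>\<Phi> KM that by blast
    then show ?thesis unfolding J_def by (force simp: image_image)
  qed
  let ?C = "cut_points a b u \<inter> J"
  have "J \<subseteq> Mstar closure_of ?C"
  proof
    fix p assume p: "p \<in> J"
    have pM: "p \<in> topspace Mstar" using closedin_subset[OF J_closed] p by blast
    have \<Psi>p: "\<Psi> p \<in> ?K" using \<Psi>J p by blast
    have "\<exists>r. r \<in> ?C \<and> r \<in> T" if T: "p \<in> T" "openin Mstar T" for T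
    proof -
      let ?V = "{q \<in> topspace Mstar. \<Phi> q \<in> T}"
      have V: "openin Mstar ?V" by (rule openin_continuous_map_preimage[OF \<Phi>_cont T(2)])
      have pV: "\<Psi> p \<in> ?V" using \<Psi>_in[OF pM] \<Phi>\<Psi>[OF pM] T(1) by simp
      obtain y s where y: "selector_sequence c d y" "s \<in> h u"
        "\<And>v. v \<in> topspace Nstar \<Longrightarrow> s \<in> v \<Longrightarrow> point_lim y v \<in> ?V"
        by (rule selector_dense[OF cd w \<Psi>p V pV], rule that)
      define q where "q = point_lim y (h u)"
      have qV: "\<Phi> q \<in> T" unfolding q_def using y(3)[OF w y(2)] by blast
      have qK: "q \<in> ?K" unfolding q_def by (rule point_lim_in_interval[OF cd y(1) w])
      have q_frame: "interval_frame c d \<notin> q" unfolding q_def by (rule interval_frame_selector[OF cd y(1) w])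
      let ?U = "{p \<in> topspace Mstar. \<Psi> p \<in> {q \<in> topspace Mstar. interval_frame c d \<notin> q}} \<inter> T"
      have U: "openin Mstar ?U"
        by (intro openin_Int T(2) openin_continuous_map_preimage[OF \<Psi>_cont] openin_Mstar_basic
            interval_frame_zero_set)
      have qU: "\<Phi> q \<in> ?U"
        using blockD(1,4)[OF w qK] \<Psi>\<Phi>[OF blockD(1)[OF w qK]] q_frame qV by simp
      obtain z t where z: "selector_sequence a b z" "t \<in> u"
        "\<And>v. v \<in> topspace Nstar \<Longrightarrow> t \<in> v \<Longrightarrow> point_lim z v \<in> ?U"
        by (rule selector_dense[OF ab u block_subset[OF u qK] U qU], rule that)
      define r where "r = point_lim z u"
      have rM: "r \<in> topspace Mstar" and r_frame: "interval_frame c d \<notin> \<Psi> r" and rT: "r \<in> T"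
        using z(3)[OF u z(2)] unfolding r_def by auto
      note cov = interval_frame_or_union[OF cd \<Psi>_in[OF rM] r_frame]
      note tr = interval_lim_trace[OF cd \<Psi>_in[OF rM] cov]
      \<comment> \<open>Here surjectivity enters: the block containing \<open>\<Psi> r\<close> is
        that of some \<open>v\<close>, and since \<open>r\<close> lies in the interval limit of
        \<open>u\<close>, it follows that \<open>v = u\<close>.\<close>
      have "cd_trace (\<Psi> r) \<in> h ` topspace Nstar" using tr(1) surj by simp
      then obtain v where v: "cd_trace (\<Psi> r) = h v" "v \<in> topspace Nstar" by (rule imageE)
      have "r \<in> interval_lim a b v"
        using block_subset[OF v(2)] tr(2) \<Phi>\<Psi>[OF rM] unfolding v(1) by metis
      then have "v = u"
        using interval_lim_disjoint[OF ab v(2) u] point_lim_in_interval[OF ab z(1) u] unfolding r_def by blast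
      then have "\<Psi> r \<in> ?K" using tr(2) v(1) by simp
      then have "r \<in> J" unfolding J_def using \<Phi>\<Psi>[OF rM] by (metis image_eqI)
      moreover have "r \<in> cut_points a b u" unfolding cut_points_def r_def using z(1) by blast
      ultimately show ?thesis using rT by blast
    qed
    then show "p \<in> Mstar closure_of ?C" using pM unfolding in_closure_of by blast
  qed
  then have "J = Mstar closure_of ?C"
    using closure_of_minimal[of ?C J, OF _ J_closed] by blast
  then have "subinterval a b u J"
    unfolding subinterval_def using order_convex_connected[OF ab u J_conn J_sub] by blast
  then show ?thesis unfolding image_subinterval_def using \<Psi>J by blast
qed

end

theorem theorem1p5:
  fixes \<Psi> :: "(nat \<times> real) set set \<Rightarrow> (nat \<times> real) set set"
    and a b x :: "nat \<Rightarrow> nat \<times> real"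
  assumes "homeomorphic_map Mstar Mstar \<Psi>"
    and "standard_sequence a b"
    and "selector_sequence a b x"
  shows "\<exists>c d h. standard_sequence c d \<and> homeomorphic_map Nstar Nstar h \<and>
    (\<forall>u \<in> topspace Nstar.
       \<Psi> (point_lim x u) \<in> interval_lim c d (h u) \<and>
       image_subinterval \<Psi> a b u (interval_lim c d (h u))) \<and>
    \<Psi> ` sc_star MM (x ` NN) = {\<Psi> (point_lim x u) | u. u \<in> topspace Nstar} \<and>
    (\<exists>g. (\<forall>u \<in> topspace Nstar. g (\<Psi> (point_lim x u)) = h u) \<and>
       homeomorphic_map (subtopology Mstar (\<Psi> ` sc_star MM (x ` NN))) Nstar g)"
proof -
  note ab = assms(2) and x = assms(3)
  obtain \<Phi> where homeo: "homeomorphic_maps Mstar Mstar \<Psi> \<Phi>"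
    using assms(1) unfolding homeomorphic_map_maps by blast
  have \<Phi>\<Psi>: "\<Phi> (\<Psi> p) = p" if "p \<in> topspace Mstar" for p
    using homeo that unfolding homeomorphic_maps_def by blast
  have \<Psi>_cont: "continuous_map Mstar Mstar \<Psi>" and \<Psi>_in: "p \<in> topspace Mstar \<Longrightarrow> \<Psi> p \<in> topspace Mstar" for p
    using homeo unfolding homeomorphic_maps_def continuous_map_def by auto
  have \<Phi>_in: "p \<in> topspace Mstar \<Longrightarrow> \<Phi> p \<in> topspace Mstar"
    and \<Psi>\<Phi>: "p \<in> topspace Mstar \<Longrightarrow> \<Psi> (\<Phi> p) = p" for p
    using homeo unfolding homeomorphic_maps_def continuous_map_def by auto
  note xF = selector_compact_family[OF ab x]
  have xz: "x ` NN \<in> zero_sets MM" by (rule selector_range_zero_set[OF ab x]) simp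
  define X where "X = sc_star MM (x ` NN)"
  have X_eq: "X = {p \<in> topspace Mstar. x ` NN \<in> p}"
    unfolding X_def Mstar_def by (rule sc_star_zero_set[OF xz])
  have x_in_X: "point_lim x u \<in> X" if u: "u \<in> topspace Nstar" for u
  proof -
    have "{m\<in>NN. x m \<in> x ` NN} \<in> u" using NstarD(2)[OF u] by (simp cong: conj_cong)
    then have "x ` NN \<in> point_lim x u" unfolding point_lim_eq[OF xF u] using xz by blast
    then show ?thesis unfolding X_eq using point_lim_Mstar[OF xF u] by blast
  qed
  have X_image: "X = point_lim x ` topspace Nstar"
  proof
    show "X \<subseteq> point_lim x ` topspace Nstar"
      unfolding X_eq using point_lim_unique[OF xF] by blast
  qed (use x_in_X in blast)
  define Q where "Q = {p \<in> topspace Mstar. interval_frame a b \<in> p}"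
  have XQ: "X \<inter> Q = {}"
    unfolding X_image Q_def using interval_frame_selector[OF ab x] by blast
  have sub: "X \<subseteq> topspace Mstar" "Q \<subseteq> topspace Mstar" unfolding X_eq Q_def by auto
  have disj: "\<Psi> ` X \<inter> \<Psi> ` Q = {}"
  proof (intro equals0I)
    fix q assume "q \<in> \<Psi> ` X \<inter> \<Psi> ` Q"
    then obtain p p' where p: "p \<in> X" "q = \<Psi> p" "p' \<in> Q" "q = \<Psi> p'" by blast
    then have "p = p'" using \<Phi>\<Psi>[OF subsetD[OF sub(1) p(1)]] \<Phi>\<Psi>[OF subsetD[OF sub(2) p(3)]] by simp
    then show False using p XQ by blast
  qed
  have cl: "closedin Mstar (\<Psi> ` X)" "closedin Mstar (\<Psi> ` Q)"
    using homeomorphic_map_closedness_eq[OF assms(1), of X] closedin_Mstar_basic[OF xz]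
      homeomorphic_map_closedness_eq[OF assms(1), of Q] closedin_Mstar_basic[OF interval_frame_zero_set]
    unfolding X_eq Q_def by simp_all
  have ne: "\<Psi> ` X \<noteq> {}" using topspace_Nstar_nonempty unfolding X_image by blast
  obtain c d D where cd: "standard_sequence c d" "D \<in> zero_sets MM" "NN \<times> {0..1} \<subseteq> D \<union> interval_union c d"
    "\<And>p. p \<in> \<Psi> ` X \<Longrightarrow> D \<notin> p" "\<And>q. q \<in> \<Psi> ` Q \<Longrightarrow> interval_union c d \<notin> q"
    by (rule covering_sequence[OF cl(1) ne cl(2) disj], rule that)
  have pre: "interval_transfer \<Psi> \<Phi> a b x c d D"
  proof
    show "D \<notin> \<Psi> (point_lim x u)" if "u \<in> topspace Nstar" for u using cd(4) x_in_X[OF that] by blast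
    show "interval_union a b \<in> \<Phi> q" if q: "q \<in> topspace Mstar" "interval_union c d \<in> q" for q
    proof (rule interval_frame_or_union[OF ab \<Phi>_in[OF q(1)]])
      show "interval_frame a b \<notin> \<Phi> q"
      proof
        assume "interval_frame a b \<in> \<Phi> q"
        then have "\<Phi> q \<in> Q" using \<Phi>_in[OF q(1)] unfolding Q_def by blast
        then have "\<Psi> (\<Phi> q) \<in> \<Psi> ` Q" by (rule imageI)
        then show False using cd(5) q \<Psi>\<Phi>[OF q(1)] by simp
      qed
    qed
  qed (rule homeo ab x cd)+
  obtain c' d' D' where tr: "interval_transfer \<Psi> \<Phi> a b x c' d' D'"
    and surj: "interval_transfer.h \<Psi> x c' d' ` topspace Nstar = topspace Nstar"
    by (rule interval_transfer_surjective[OF pre], rule that)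
  interpret interval_transfer \<Psi> \<Phi> a b x c' d' D' by (rule tr)
  have h: "homeomorphic_map Nstar Nstar h"
    using h_continuous compact_space_Nstar Hausdorff_space_Nstar surj h_inj
    by (intro continuous_imp_homeomorphic_map inj_onI) auto
  let ?Y = "subtopology Mstar (\<Psi> ` X)"
  have Y: "topspace ?Y = \<Psi> ` X" using \<Psi>_in sub(1) by auto
  let ?f = "\<Psi> \<circ> point_lim x"
  have f: "homeomorphic_map Nstar ?Y ?f"
  proof (rule continuous_imp_homeomorphic_map)
    show "continuous_map Nstar ?Y ?f"
      using continuous_map_compose[OF continuous_point_lim[OF xF] \<Psi>_cont] x_in_X
      by (auto simp: continuous_map_in_subtopology)
    show "?f ` topspace Nstar = topspace ?Y" unfolding Y unfolding X_image by (rule image_comp[symmetric])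
    \<comment> \<open>\<open>h\<close> factors through \<open>?f\<close>, so injectivity of
      \<open>h\<close> suffices.\<close>
    show "inj_on ?f (topspace Nstar)"
      by (rule inj_onI) (use h_inj in \<open>simp add: h_def\<close>)
  qed (auto intro: compact_space_Nstar Hausdorff_space_subtopology Hausdorff_space_Mstar)
  then obtain k where k: "homeomorphic_maps Nstar ?Y ?f k" unfolding homeomorphic_map_maps by blast
  have "homeomorphic_map ?Y Nstar k"
    using k homeomorphic_maps_sym homeomorphic_maps_map by blast
  \<comment> \<open>The map required in (3) is \<open>h\<close> after the inverse \<open>k\<close>
    of the parametrisation of \<open>\<Psi>\<close>-images by \<open>u\<close>.\<close>
  then have "homeomorphic_map ?Y Nstar (h \<circ> k)" using h by (rule homeomorphic_map_compose)
  moreover have "(h \<circ> k) (\<Psi> (point_lim x u)) = h u" if "u \<in> topspace Nstar" for u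
    using k that unfolding homeomorphic_maps_def by auto
  moreover have "\<Psi> ` X = {\<Psi> (point_lim x u) | u. u \<in> topspace Nstar}" unfolding X_image by blast
  ultimately show ?thesis
    using local.cd h point_in_block surjective_image_subinterval[OF surj] unfolding X_def
    by (intro exI[of _ c'] exI[of _ d'] exI[of _ h] conjI ballI exI[of _ "h \<circ> k"]) auto
qed

end
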